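(* Let $(\mathbf{u}^-,\mathbf{B}^-)\in \mathbf{W}_h$ be given with $\nabla\cdot\mathbf{u}^-=0$, and assume that $\mathbf{B}^-\in L^\infty(\Omega)$. Then the following mixed problem is well-posed with respect to the norms $\|\cdot\|_X$ on $\mathbf{W}_h$ and $\|\cdot\|_Q$ on $Q_h$: for $\mathbf{h}\in \mathbf{W}_h^*$ and $g\in Q_h^*$, find $(\mathbf{x},p)\in \mathbf{W}_h\times Q_h$ such that for all $(\mathbf{y},q)\in \mathbf{W}_h\times Q_h$ $$a(\mathbf{x},\mathbf{y})+b(\mathbf{y},p)=\langle \mathbf{h},\mathbf{y}\rangle,\qquad b(\mathbf{x},q)=\langle g,q\rangle .$$ That is, for every $\mathbf{h}\in\mathbf{W}_h^*$ and $g\in Q_h^*$ there is exactly one solution $(\mathbf{x},p)$, and there is a constant $C>0$ independent of $\mathbf{h}$ and $g$ such that $\|\mathbf{x}\|_X+\|p\|_Q\le C(\|\mathbf{h}\|_{\mathbf{W}_h^*}+\|g\|_{Q_h^*})$, where the dual norms are those induced by $\|\cdot\|_X$ and $\|\cdot\|_Q$.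
   Context: $\Omega\subset\mathbb{R}^3$ is a bounded, contractible Lipschitz polyhedron; $(\cdot,\cdot)$ and $\|\cdot\|$ are the $L^2(\Omega)$ inner product and norm. $\mathrm{Re},\mathrm{Re_m},S>0$ and $\mathrm{R_H}\ge0$ are constants. $H_0(\mathrm{curl})$ and $H_0(\mathrm{div})$ denote the $H(\mathrm{curl},\Omega)$, $H(\mathrm{div},\Omega)$ fields with vanishing tangential, respectively normal, trace on $\partial\Omega$. $H_0^h(\mathrm{grad})\subset H_0^1(\Omega)$, $H_0^h(\mathrm{curl})\subset H_0(\mathrm{curl})$, $H_0^h(\mathrm{div})\subset H_0(\mathrm{div})$, $L^2_h$ are conforming finite element spaces forming a finite element de Rham sequence $$0\to H_0^h(\mathrm{grad})\xrightarrow{\mathrm{grad}}H_0^h(\mathrm{curl})\xrightarrow{\mathrm{curl}}H_0^h(\mathrm{div})\xrightarrow{\mathrm{div}}L^2_h\to0,$$ which is exact since $\Omega$ is contractible. The discrete weak curl $\tilde\nabla_h\times:[L^2(\Omega)]^3\to H_0^h(\mathrm{curl})$ is defined by $(\tilde\nabla_h\times\mathbf{B},\mathbf{k}_h)=(\mathbf{B},\nabla\times\mathbf{k}_h)$ for all $\mathbf{k}_h\in H_0^h(\mathrm{curl})$. $\mathbf{V}_h\subset[H_0^1(\Omega)]^3$ and $Q_h\subset L_0^2(\Omega)$ (mean-zero $L^2$ functions) are finite element spaces satisfying the inf-sup condition: there is $\beta_0>0$ with $\sup_{\mathbf{0}\neq\mathbf{v}\in\mathbf{V}_h}(\nabla\cdot\mathbf{v},q)/\|\nabla\mathbf{v}\|\ge\beta_0\|q\|$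 for all $q\in Q_h$. Put $\mathbf{W}_h:=\mathbf{V}_h\times H_0^h(\mathrm{div})$. For $\mathbf{x}=(\mathbf{u},\mathbf{B})$, $\mathbf{y}=(\mathbf{v},\mathbf{C})\in\mathbf{W}_h$ and $q\in Q_h$, $$\begin{aligned}a(\mathbf{x},\mathbf{y}):=&\ \mathrm{Re}^{-1}(\nabla\mathbf{u},\nabla\mathbf{v})+((\mathbf{u}^-\cdot\nabla)\mathbf{u},\mathbf{v})-S((\tilde\nabla_h\times\mathbf{B})\times\mathbf{B}^-,\mathbf{v})+(\nabla\cdot\mathbf{B},\nabla\cdot\mathbf{C})\\&+\mathrm{Re_m}^{-1}(\tilde\nabla_h\times\mathbf{B},\tilde\nabla_h\times\mathbf{C})-(\mathbf{u}\times\mathbf{B}^-,\tilde\nabla_h\times\mathbf{C})+\mathrm{R_H}((\tilde\nabla_h\times\mathbf{B})\times\mathbf{B}^-,\tilde\nabla_h\times\mathbf{C}),\end{aligned}$$ $$b(\mathbf{x},q):=(\nabla\cdot\mathbf{u},q).$$ The norms are $\|(\mathbf{u},\mathbf{B})\|_X^2:=\|\nabla\mathbf{u}\|^2+\|\nabla\cdot\mathbf{B}\|^2+\|\tilde\nabla_h\times\mathbf{B}\|^2$ and $\|p\|_Q:=\|p\|$. *)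

theory Defs
  imports "HOL-Analysis.Analysis"
begin

section \<open>Square-integrable fields modulo equality almost everywhere\<close>

definition square_integrable :: "(real^3 \<Rightarrow> 'b::euclidean_space) \<Rightarrow> bool" where
  "square_integrable f \<longleftrightarrow> f \<in> borel_measurable lborel \<and> integrable lborel (\<lambda>x. (norm (f x))\<^sup>2)"

definition l2_rel :: "(real^3 \<Rightarrow> 'b::euclidean_space) \<Rightarrow> (real^3 \<Rightarrow> 'b) \<Rightarrow> bool" where
  "l2_rel f g \<longleftrightarrow> square_integrable f \<and> square_integrable g \<and> (AE x in lborel. f x = g x)"

lemma square_integrable_zero: "square_integrable (\<lambda>x. 0)"
  by (simp add: square_integrable_def)

lemma square_integrable_add:
  assumes "square_integrable f" "square_integrable g"
  shows "square_integrable (\<lambda>x. f x + g x)"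
proof -
  have m: "(\<lambda>x. f x + g x) \<in> borel_measurable lborel"
    using assms by (auto simp: square_integrable_def)
  have i: "integrable lborel (\<lambda>x. 2 * (norm (f x))\<^sup>2 + 2 * (norm (g x))\<^sup>2)"
    using assms by (auto simp: square_integrable_def)
  have b: "norm ((norm (f x + g x))\<^sup>2) \<le> norm (2 * (norm (f x))\<^sup>2 + 2 * (norm (g x))\<^sup>2)" for x
  proof -
    have "(norm (f x + g x))\<^sup>2 \<le> (norm (f x) + norm (g x))\<^sup>2"
      by (intro power_mono norm_triangle_ineq) auto
    also have "\<dots> \<le> 2 * (norm (f x))\<^sup>2 + 2 * (norm (g x))\<^sup>2"
      using sum_squares_bound[of "norm (f x)" "norm (g x)"] by (simp add: power2_sum)
    finally show ?thesis by simp
  qed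
  have "integrable lborel (\<lambda>x. (norm (f x + g x))\<^sup>2)"
    by (rule Bochner_Integration.integrable_bound[OF i]) (use m b in auto)
  with m show ?thesis by (simp add: square_integrable_def)
qed

lemma square_integrable_scaleR:
  "square_integrable f \<Longrightarrow> square_integrable (\<lambda>x. c *\<^sub>R f x)"
  by (auto simp: square_integrable_def power_mult_distrib)

lemma square_integrable_uminus:
  "square_integrable f \<Longrightarrow> square_integrable (\<lambda>x. - f x)"
  by (auto simp: square_integrable_def)

lemma square_integrable_diff:
  "square_integrable f \<Longrightarrow> square_integrable g \<Longrightarrow> square_integrable (\<lambda>x. f x - g x)"
  using square_integrable_add[of f "\<lambda>x. - g x"] by (simp add: square_integrable_uminus)

lemma integrable_inner_square_integrable:
  assumes "square_integrable f" "square_integrable g"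
  shows "integrable lborel (\<lambda>x. inner (f x) (g x))"
proof -
  have m: "(\<lambda>x. inner (f x) (g x)) \<in> borel_measurable lborel"
    using assms by (auto simp: square_integrable_def)
  have i: "integrable lborel (\<lambda>x. (norm (f x))\<^sup>2 + (norm (g x))\<^sup>2)"
    using assms by (auto simp: square_integrable_def)
  have b: "norm (inner (f x) (g x)) \<le> norm ((norm (f x))\<^sup>2 + (norm (g x))\<^sup>2)" for x
  proof -
    have "\<bar>inner (f x) (g x)\<bar> \<le> norm (f x) * norm (g x)" by (rule Cauchy_Schwarz_ineq2)
    also have "\<dots> \<le> (norm (f x))\<^sup>2 + (norm (g x))\<^sup>2"
      using sum_squares_bound[of "norm (f x)" "norm (g x)"]
        mult_nonneg_nonneg[OF norm_ge_zero[of "f x"] norm_ge_zero[of "g x"]] by linarith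
    finally show ?thesis by simp
  qed
  show ?thesis by (rule Bochner_Integration.integrable_bound[OF i]) (use m b in auto)
qed

quotient_type (overloaded) 'b l2 = "real^3 \<Rightarrow> 'b::euclidean_space" / partial: l2_rel
proof (rule part_equivpI)
  show "\<exists>f::real^3 \<Rightarrow> 'b. l2_rel f f"
    using square_integrable_zero by (auto simp: l2_rel_def)
  show "symp (l2_rel :: (real^3 \<Rightarrow> 'b) \<Rightarrow> _)"
    by (auto simp: symp_def l2_rel_def elim: AE_mp)
  show "transp (l2_rel :: (real^3 \<Rightarrow> 'b) \<Rightarrow> _)"
    by (auto simp: transp_def l2_rel_def elim: AE_mp)
qed

instantiation l2 :: (euclidean_space) real_vector
begin

lift_definition zero_l2 :: "'a l2" is "\<lambda>x. 0"
  by (simp add: l2_rel_def square_integrable_zero)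

lift_definition plus_l2 :: "'a l2 \<Rightarrow> 'a l2 \<Rightarrow> 'a l2" is "\<lambda>f g x. f x + g x"
  by (auto simp: l2_rel_def square_integrable_add)

lift_definition scaleR_l2 :: "real \<Rightarrow> 'a l2 \<Rightarrow> 'a l2" is "\<lambda>c f x. c *\<^sub>R f x"
  by (auto simp: l2_rel_def square_integrable_scaleR)

lift_definition uminus_l2 :: "'a l2 \<Rightarrow> 'a l2" is "\<lambda>f x. - f x"
  by (auto simp: l2_rel_def square_integrable_uminus)

lift_definition minus_l2 :: "'a l2 \<Rightarrow> 'a l2 \<Rightarrow> 'a l2" is "\<lambda>f g x. f x - g x"
  by (auto simp: l2_rel_def square_integrable_diff)

instance
proof
  fix a b c :: "'a l2" and r s :: real
  show "a + b + c = a + (b + c)"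
    by transfer (auto simp: l2_rel_def add.assoc intro!: square_integrable_add)
  show "a + b = b + a"
    by transfer (auto simp: l2_rel_def add.commute intro!: square_integrable_add)
  show "0 + a = a"
    by transfer (auto simp: l2_rel_def)
  show "- a + a = 0"
    by transfer (auto simp: l2_rel_def square_integrable_zero)
  show "a - b = a + - b"
    by transfer (auto simp: l2_rel_def square_integrable_diff)
  show "r *\<^sub>R (a + b) = r *\<^sub>R a + r *\<^sub>R b"
    by transfer (auto simp: l2_rel_def scaleR_add_right
        intro!: square_integrable_add square_integrable_scaleR)
  show "(r + s) *\<^sub>R a = r *\<^sub>R a + s *\<^sub>R a"
    by transfer (auto simp: l2_rel_def scaleR_add_left
        intro!: square_integrable_add square_integrable_scaleR)
  show "r *\<^sub>R s *\<^sub>R a = (r * s) *\<^sub>R a"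
    by transfer (auto simp: l2_rel_def intro!: square_integrable_scaleR)
  show "1 *\<^sub>R a = a"
    by transfer (auto simp: l2_rel_def)
qed

end

lift_definition l2_inner :: "'a::euclidean_space l2 \<Rightarrow> 'a l2 \<Rightarrow> real" is
  "\<lambda>f g. (LINT x|lborel. inner (f x) (g x))"
  by (rule integral_cong_AE) (auto simp: l2_rel_def square_integrable_def)

instantiation l2 :: (euclidean_space) real_inner
begin

definition inner_l2 :: "'a l2 \<Rightarrow> 'a l2 \<Rightarrow> real" where "inner_l2 = l2_inner"
definition norm_l2 :: "'a l2 \<Rightarrow> real" where "norm_l2 f = sqrt (l2_inner f f)"
definition sgn_l2 :: "'a l2 \<Rightarrow> 'a l2" where "sgn_l2 f = f /\<^sub>R sqrt (l2_inner f f)"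
definition dist_l2 :: "'a l2 \<Rightarrow> 'a l2 \<Rightarrow> real" where "dist_l2 f g = sqrt (l2_inner (f - g) (f - g))"
definition uniformity_l2 :: "('a l2 \<times> 'a l2) filter" where
  "uniformity_l2 = (INF e\<in>{0 <..}. principal {(f, g). sqrt (l2_inner (f - g) (f - g)) < e})"
definition open_l2 :: "'a l2 set \<Rightarrow> bool" where
  "open_l2 U \<longleftrightarrow> (\<forall>f\<in>U. eventually (\<lambda>(f', g). f' = f \<longrightarrow> g \<in> U)
     (INF e\<in>{0 <..}. principal {(f, g). sqrt (l2_inner (f - g) (f - g)) < e}))"

instance
proof
  fix a b c :: "'a l2" and r :: real
  show "sgn a = a /\<^sub>R norm a" by (simp add: sgn_l2_def norm_l2_def)
  show "dist a b = norm (a - b)" by (simp add: dist_l2_def norm_l2_def)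
  show u: "(uniformity :: ('a l2 \<times> 'a l2) filter) = (INF e\<in>{0 <..}. principal {(f, g). dist f g < e})"
    by (simp add: uniformity_l2_def dist_l2_def)
  show "open U \<longleftrightarrow> (\<forall>f\<in>U. eventually (\<lambda>(f', g). f' = f \<longrightarrow> g \<in> U) uniformity)"
    for U :: "'a l2 set" by (simp add: open_l2_def uniformity_l2_def)
  show "inner a b = inner b a"
    unfolding inner_l2_def by transfer (simp add: inner_commute)
  show "inner (a + b) c = inner a c + inner b c"
    unfolding inner_l2_def
    by transfer (simp add: l2_rel_def inner_add_left integrable_inner_square_integrable)
  show "inner (r *\<^sub>R a) b = r * inner a b"
    unfolding inner_l2_def by transfer simp
  show "0 \<le> inner a a"
    unfolding inner_l2_def by transfer simp
  show "inner a a = 0 \<longleftrightarrow> a = 0"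
    unfolding inner_l2_def
  proof transfer
    fix f :: "real^3 \<Rightarrow> 'a" assume f: "l2_rel f f"
    then have i: "integrable lborel (\<lambda>x. inner (f x) (f x))"
      by (simp add: l2_rel_def integrable_inner_square_integrable)
    have "(LINT x|lborel. inner (f x) (f x)) = 0 \<longleftrightarrow> (AE x in lborel. inner (f x) (f x) = 0)"
      by (rule integral_nonneg_eq_0_iff_AE[OF i]) simp
    then show "((LINT x|lborel. inner (f x) (f x)) = 0) = l2_rel f (\<lambda>x. 0)"
      using f by (simp add: l2_rel_def square_integrable_zero)
  qed
  show "norm a = sqrt (inner a a)" by (simp add: norm_l2_def inner_l2_def)
qed

end

text \<open>\<open>rep_l2 u\<close> is a representative of the class \<open>u\<close>; \<open>abs_l2 f\<close> is the class of \<open>f\<close>, meaningful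
  only for square-integrable \<open>f\<close>.\<close>

lemma square_integrable_rep_l2: "square_integrable (rep_l2 u)"
  using Quotient_rep_reflp[OF Quotient_l2] by (auto simp: l2_rel_def)

lemma abs_rep_l2 [simp]: "abs_l2 (rep_l2 u) = u"
  by (rule Quotient_abs_rep[OF Quotient_l2])

lemma rep_abs_l2: "square_integrable f \<Longrightarrow> AE x in lborel. rep_l2 (abs_l2 f) x = f x"
  using Quotient3_rep_abs[OF Quotient3_l2, of f] by (auto simp: l2_rel_def)

lemma inner_l2_eq: "inner u v = (LINT x|lborel. inner (rep_l2 u x) (rep_l2 v x))"
  by (simp add: inner_l2_def l2_inner.rep_eq)

definition component :: "3 \<Rightarrow> (real^3) l2 \<Rightarrow> real l2" where
  "component i u = abs_l2 (\<lambda>x. rep_l2 u x $ i)"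

text \<open>\<open>L\<^sup>2(\<Omega>)\<close> is identified with the fields on the whole space that vanish almost everywhere
  outside \<open>\<Omega>\<close> (extension by zero), so that \<^const>\<open>inner\<close> and \<^const>\<open>norm\<close> on it are those of
  \<open>L\<^sup>2(\<Omega>)\<close>.\<close>

definition L2 :: "(real^3) set \<Rightarrow> 'b::euclidean_space l2 set" where
  "L2 \<Omega> = {u. AE x in lborel. x \<notin> \<Omega> \<longrightarrow> rep_l2 u x = 0}"

definition L2_mean_zero :: "(real^3) set \<Rightarrow> real l2 set" where
  "L2_mean_zero \<Omega> = {q \<in> L2 \<Omega>. (LINT x:\<Omega>|lborel. rep_l2 q x) = 0}"

definition essentially_bounded :: "'b::euclidean_space l2 \<Rightarrow> bool" where
  "essentially_bounded u \<longleftrightarrow> (\<exists>M. AE x in lborel. norm (rep_l2 u x) \<le> M)"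

section \<open>Lipschitz polyhedra\<close>

text \<open>Near each boundary point \<open>\<Omega>\<close> is, in rotated coordinates, the strict subgraph of a
  Lipschitz function of the first two coordinates.\<close>

definition lipschitz_boundary :: "(real^3) set \<Rightarrow> bool" where
  "lipschitz_boundary \<Omega> \<longleftrightarrow>
     (\<forall>p \<in> frontier \<Omega>. \<exists>(T :: real^3 \<Rightarrow> real^3) (g :: real^2 \<Rightarrow> real) L U.
        orthogonal_transformation T \<and> lipschitz_on L UNIV g \<and> open U \<and> p \<in> U \<and>
        \<Omega> \<inter> U = {x \<in> U. T x $ 3 < g (vector [T x $ 1, T x $ 2])})"

definition lipschitz_polyhedron :: "(real^3) set \<Rightarrow> bool" where
  "lipschitz_polyhedron \<Omega> \<longleftrightarrow>
     open \<Omega> \<and> connected \<Omega> \<and> \<Omega> \<noteq> {} \<and> lipschitz_boundary \<Omega> \<and>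
     (\<exists>\<P>. finite \<P> \<and> (\<forall>P\<in>\<P>. polytope P) \<and> closure \<Omega> = \<Union>\<P>)"

section \<open>Test functions and weak derivatives\<close>

definition partial :: "3 \<Rightarrow> (real^3 \<Rightarrow> 'b::real_normed_vector) \<Rightarrow> real^3 \<Rightarrow> 'b" where
  "partial i f x = frechet_derivative f (at x) (axis i 1)"

fun continuously_diff :: "nat \<Rightarrow> (real^3 \<Rightarrow> 'b::real_normed_vector) \<Rightarrow> bool" where
  "continuously_diff 0 f \<longleftrightarrow> continuous_on UNIV f"
| "continuously_diff (Suc k) f \<longleftrightarrow>
     (\<forall>x. f differentiable (at x)) \<and> (\<forall>i. continuously_diff k (partial i f))"

text \<open>The space \<open>C\<^sub>c\<^sup>\<infinity>(\<Omega>)\<close>, its elements being extended by zero.\<close>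

definition test_function :: "(real^3) set \<Rightarrow> (real^3 \<Rightarrow> 'b::real_normed_vector) \<Rightarrow> bool" where
  "test_function \<Omega> \<phi> \<longleftrightarrow> (\<forall>k. continuously_diff k \<phi>) \<and>
     (\<exists>K. compact K \<and> K \<subseteq> \<Omega> \<and> (\<forall>x. x \<notin> K \<longrightarrow> \<phi> x = 0))"

definition classical_grad :: "(real^3 \<Rightarrow> real) \<Rightarrow> real^3 \<Rightarrow> real^3" where
  "classical_grad \<phi> x = (\<chi> i. partial i \<phi> x)"

definition classical_curl :: "(real^3 \<Rightarrow> real^3) \<Rightarrow> real^3 \<Rightarrow> real^3" where
  "classical_curl \<phi> x = vector
     [partial 2 \<phi> x $ 3 - partial 3 \<phi> x $ 2,
      partial 3 \<phi> x $ 1 - partial 1 \<phi> x $ 3,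
      partial 1 \<phi> x $ 2 - partial 2 \<phi> x $ 1]"

definition weak_grad :: "(real^3) set \<Rightarrow> real l2 \<Rightarrow> (real^3) l2 \<Rightarrow> bool" where
  "weak_grad \<Omega> u G \<longleftrightarrow> u \<in> L2 \<Omega> \<and> G \<in> L2 \<Omega> \<and>
     (\<forall>\<phi>. test_function \<Omega> \<phi> \<longrightarrow> (\<forall>i.
        (LINT x:\<Omega>|lborel. rep_l2 G x $ i * \<phi> x) = - (LINT x:\<Omega>|lborel. rep_l2 u x * partial i \<phi> x)))"

definition weak_div :: "(real^3) set \<Rightarrow> (real^3) l2 \<Rightarrow> real l2 \<Rightarrow> bool" where
  "weak_div \<Omega> u d \<longleftrightarrow> u \<in> L2 \<Omega> \<and> d \<in> L2 \<Omega> \<and>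
     (\<forall>\<phi>. test_function \<Omega> \<phi> \<longrightarrow>
        (LINT x:\<Omega>|lborel. rep_l2 d x * \<phi> x) =
        - (LINT x:\<Omega>|lborel. inner (rep_l2 u x) (classical_grad \<phi> x)))"

definition weak_curl :: "(real^3) set \<Rightarrow> (real^3) l2 \<Rightarrow> (real^3) l2 \<Rightarrow> bool" where
  "weak_curl \<Omega> u w \<longleftrightarrow> u \<in> L2 \<Omega> \<and> w \<in> L2 \<Omega> \<and>
     (\<forall>\<phi>. test_function \<Omega> \<phi> \<longrightarrow>
        (LINT x:\<Omega>|lborel. inner (rep_l2 w x) (\<phi> x)) =
        (LINT x:\<Omega>|lborel. inner (rep_l2 u x) (classical_curl \<phi> x)))"

text \<open>Weak derivatives are unique as classes, so the following descriptions are proper on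
  \<open>H\<^sup>1(\<Omega>)\<close>, \<open>H(div,\<Omega>)\<close> and \<open>H(curl,\<Omega>)\<close> respectively.\<close>

definition grad :: "(real^3) set \<Rightarrow> real l2 \<Rightarrow> (real^3) l2" where
  "grad \<Omega> u = (THE G. weak_grad \<Omega> u G)"

definition divergence :: "(real^3) set \<Rightarrow> (real^3) l2 \<Rightarrow> real l2" where
  "divergence \<Omega> u = (THE d. weak_div \<Omega> u d)"

definition curl :: "(real^3) set \<Rightarrow> (real^3) l2 \<Rightarrow> (real^3) l2" where
  "curl \<Omega> u = (THE w. weak_curl \<Omega> u w)"

text \<open>Row \<open>i\<close> of \<open>vgrad \<Omega> u\<close> is the gradient of the component \<open>u\<^sub>i\<close>; the norm on
  \<^typ>\<open>real^3^3\<close> is the Frobenius norm.\<close>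

definition vgrad :: "(real^3) set \<Rightarrow> (real^3) l2 \<Rightarrow> (real^3^3) l2" where
  "vgrad \<Omega> u = abs_l2 (\<lambda>x. \<chi> i. rep_l2 (grad \<Omega> (component i u)) x)"

section \<open>Sobolev spaces\<close>

definition H1 :: "(real^3) set \<Rightarrow> real l2 set" where
  "H1 \<Omega> = {u. \<exists>G. weak_grad \<Omega> u G}"

definition H_div :: "(real^3) set \<Rightarrow> (real^3) l2 set" where
  "H_div \<Omega> = {u. \<exists>d. weak_div \<Omega> u d}"

definition H_curl :: "(real^3) set \<Rightarrow> (real^3) l2 set" where
  "H_curl \<Omega> = {u. \<exists>w. weak_curl \<Omega> u w}"

definition H1_vec :: "(real^3) set \<Rightarrow> (real^3) l2 set" where
  "H1_vec \<Omega> = {u \<in> L2 \<Omega>. \<forall>i. component i u \<in> H1 \<Omega>}"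

text \<open>The closure of \<open>C\<^sub>c\<^sup>\<infinity>(\<Omega>)\<close> in \<open>H\<^sup>1(\<Omega>)\<close>.\<close>

definition H1_0 :: "(real^3) set \<Rightarrow> real l2 set" where
  "H1_0 \<Omega> = {u \<in> H1 \<Omega>. \<exists>\<phi> :: nat \<Rightarrow> real^3 \<Rightarrow> real.
     (\<forall>n. test_function \<Omega> (\<phi> n)) \<and>
     (\<lambda>n. abs_l2 (\<phi> n)) \<longlonglongrightarrow> u \<and>
     (\<lambda>n. abs_l2 (classical_grad (\<phi> n))) \<longlonglongrightarrow> grad \<Omega> u}"

definition H1_0_vec :: "(real^3) set \<Rightarrow> (real^3) l2 set" where
  "H1_0_vec \<Omega> = {u \<in> L2 \<Omega>. \<forall>i. component i u \<in> H1_0 \<Omega>}"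

text \<open>The normal trace of \<open>u \<in> H(div,\<Omega>)\<close> and the tangential trace of \<open>u \<in> H(curl,\<Omega>)\<close> are the
  functionals on the traces of \<open>H\<^sup>1\<close> functions given by Green's formulas
  \<open>\<langle>u \<cdot> n, \<psi>\<rangle> = (u, grad \<psi>) + (div u, \<psi>)\<close> and \<open>\<langle>n \<times> u, \<psi>\<rangle> = (curl u, \<psi>) - (u, curl \<psi>)\<close>;
  the spaces below are their kernels.\<close>

definition H0_div :: "(real^3) set \<Rightarrow> (real^3) l2 set" where
  "H0_div \<Omega> = {u \<in> H_div \<Omega>. \<forall>\<psi> \<in> H1 \<Omega>. inner u (grad \<Omega> \<psi>) + inner (divergence \<Omega> u) \<psi> = 0}"

definition H0_curl :: "(real^3) set \<Rightarrow> (real^3) l2 set" where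
  "H0_curl \<Omega> = {u \<in> H_curl \<Omega>. \<forall>\<psi> \<in> H1_vec \<Omega>. inner (curl \<Omega> u) \<psi> - inner u (curl \<Omega> \<psi>) = 0}"

section \<open>Discrete spaces and forms\<close>

definition finite_dim_subspace :: "'a::real_vector set \<Rightarrow> bool" where
  "finite_dim_subspace V \<longleftrightarrow> (\<exists>B. finite B \<and> V = span B)"

definition discrete_de_rham ::
  "(real^3) set \<Rightarrow> real l2 set \<Rightarrow> (real^3) l2 set \<Rightarrow> (real^3) l2 set \<Rightarrow> real l2 set \<Rightarrow> bool" where
  "discrete_de_rham \<Omega> Hg Hc Hd Lh \<longleftrightarrow>
     finite_dim_subspace Hg \<and> Hg \<subseteq> H1_0 \<Omega> \<and>
     finite_dim_subspace Hc \<and> Hc \<subseteq> H0_curl \<Omega> \<and>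
     finite_dim_subspace Hd \<and> Hd \<subseteq> H0_div \<Omega> \<and>
     finite_dim_subspace Lh \<and> Lh \<subseteq> L2 \<Omega> \<and>
     inj_on (grad \<Omega>) Hg \<and>
     grad \<Omega> ` Hg = {k \<in> Hc. curl \<Omega> k = 0} \<and>
     curl \<Omega> ` Hc = {B \<in> Hd. divergence \<Omega> B = 0} \<and>
     divergence \<Omega> ` Hd = Lh"

definition discrete_curl :: "(real^3) set \<Rightarrow> (real^3) l2 set \<Rightarrow> (real^3) l2 \<Rightarrow> (real^3) l2" where
  "discrete_curl \<Omega> Hc B = (THE j. j \<in> Hc \<and> (\<forall>k\<in>Hc. inner j k = inner B (curl \<Omega> k)))"

text \<open>The supremum is taken in the extended reals, so that no boundedness side condition is
  needed to make sense of it.\<close>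

definition inf_sup_condition :: "(real^3) set \<Rightarrow> (real^3) l2 set \<Rightarrow> real l2 set \<Rightarrow> bool" where
  "inf_sup_condition \<Omega> V Q \<longleftrightarrow> (\<exists>\<beta>>0. \<forall>q\<in>Q.
     ereal (\<beta> * norm q) \<le>
       (SUP v\<in>V - {0}. ereal (inner (divergence \<Omega> v) q / norm (vgrad \<Omega> v))))"

text \<open>Products of classes enter through representatives. The convection term uses that
  \<open>((w \<cdot> \<nabla>) u)\<^sub>i = (\<Sum>j. w\<^sub>j \<partial>\<^sub>j u\<^sub>i)\<close> is the Jacobian of \<open>u\<close> applied to \<open>w\<close>.\<close>

definition convection ::
  "(real^3) set \<Rightarrow> (real^3) l2 \<Rightarrow> (real^3) l2 \<Rightarrow> (real^3) l2 \<Rightarrow> real" where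
  "convection \<Omega> w u v =
     (LINT x:\<Omega>|lborel. inner (rep_l2 (vgrad \<Omega> u) x *v rep_l2 w x) (rep_l2 v x))"

definition triple_form ::
  "(real^3) set \<Rightarrow> (real^3) l2 \<Rightarrow> (real^3) l2 \<Rightarrow> (real^3) l2 \<Rightarrow> real" where
  "triple_form \<Omega> u v w =
     (LINT x:\<Omega>|lborel. inner (cross3 (rep_l2 u x) (rep_l2 v x)) (rep_l2 w x))"

definition a_form ::
  "(real^3) set \<Rightarrow> (real^3) l2 set \<Rightarrow> real \<Rightarrow> real \<Rightarrow> real \<Rightarrow> real \<Rightarrow> (real^3) l2 \<Rightarrow> (real^3) l2 \<Rightarrow>
   (real^3) l2 \<times> (real^3) l2 \<Rightarrow> (real^3) l2 \<times> (real^3) l2 \<Rightarrow> real" where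
  "a_form \<Omega> Hc Rey Rey_m S R_H um Bm = (\<lambda>(u, B) (v, C).
     inverse Rey * inner (vgrad \<Omega> u) (vgrad \<Omega> v)
     + convection \<Omega> um u v
     - S * triple_form \<Omega> (discrete_curl \<Omega> Hc B) Bm v
     + inner (divergence \<Omega> B) (divergence \<Omega> C)
     + inverse Rey_m * inner (discrete_curl \<Omega> Hc B) (discrete_curl \<Omega> Hc C)
     - triple_form \<Omega> u Bm (discrete_curl \<Omega> Hc C)
     + R_H * triple_form \<Omega> (discrete_curl \<Omega> Hc B) Bm (discrete_curl \<Omega> Hc C))"

definition b_form :: "(real^3) set \<Rightarrow> (real^3) l2 \<times> (real^3) l2 \<Rightarrow> real l2 \<Rightarrow> real" where
  "b_form \<Omega> = (\<lambda>(u, B) q. inner (divergence \<Omega> u) q)"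

definition X_norm :: "(real^3) set \<Rightarrow> (real^3) l2 set \<Rightarrow> (real^3) l2 \<times> (real^3) l2 \<Rightarrow> real" where
  "X_norm \<Omega> Hc = (\<lambda>(u, B).
     sqrt ((norm (vgrad \<Omega> u))\<^sup>2 + (norm (divergence \<Omega> B))\<^sup>2 + (norm (discrete_curl \<Omega> Hc B))\<^sup>2))"

text \<open>Dual space and dual norm of a subspace \<open>W\<close> carrying a norm \<open>N\<close>; only the values of a
  functional on \<open>W\<close> matter.\<close>

definition dual_space :: "'a::real_vector set \<Rightarrow> ('a \<Rightarrow> real) \<Rightarrow> ('a \<Rightarrow> real) set" where
  "dual_space W N = {h.
     (\<forall>x\<in>W. \<forall>y\<in>W. h (x + y) = h x + h y) \<and>
     (\<forall>c. \<forall>x\<in>W. h (c *\<^sub>R x) = c * h x) \<and>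
     (\<exists>K. \<forall>x\<in>W. \<bar>h x\<bar> \<le> K * N x)}"

definition dual_norm :: "'a set \<Rightarrow> ('a \<Rightarrow> real) \<Rightarrow> ('a \<Rightarrow> real) \<Rightarrow> real" where
  "dual_norm W N h = (SUP x\<in>{x\<in>W. N x \<le> 1}. \<bar>h x\<bar>)"

definition mixed_solution ::
  "'x set \<Rightarrow> 'q set \<Rightarrow> ('x \<Rightarrow> 'x \<Rightarrow> real) \<Rightarrow> ('x \<Rightarrow> 'q \<Rightarrow> real) \<Rightarrow>
   ('x \<Rightarrow> real) \<Rightarrow> ('q \<Rightarrow> real) \<Rightarrow> 'x \<times> 'q \<Rightarrow> bool" where
  "mixed_solution W Q a b h g = (\<lambda>(x, p). x \<in> W \<and> p \<in> Q \<and>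
     (\<forall>y\<in>W. \<forall>q\<in>Q. a x y + b y p = h y \<and> b x q = g q))"

end

theory Submission
  imports Defs
begin

text \<open>
  Testing with \<open>(u, S B)\<close> instead of \<open>(u, B)\<close> makes the Lorentz force cancel the induction term, the
  Hall term vanishes pointwise, and the convection term vanishes because \<open>div u\<^sup>- = 0\<close>; hence \<open>a\<close> is
  coercive up to this change of test function. Together with the inf-sup condition this gives
  the a priori bound as in Brezzi's theory, and existence follows from uniqueness by finite
  dimension. The norm \<open>\<parallel>\<cdot>\<parallel>\<^sub>X\<close> is definite by exactness of the discrete complex: \<open>div B = 0\<close> gives
  \<open>B = curl k\<close>, and then \<open>\<parallel>B\<parallel>\<^sup>2 = (B, curl k) = 0\<close> if the discrete weak curl of \<open>B\<close> vanishes.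

  The convection term makes sense because \<open>H\<^sup>1\<^sub>0\<close> embeds into \<open>L\<^sup>4\<close>, which follows from Ladyzhenskaya's
  inequality for test functions and Fatou's lemma. That inequality also replaces the Poincare
  inequality in showing that \<open>\<parallel>\<nabla>u\<parallel>\<close> is a norm.
\<close>

subsection \<open>Bilinear forms and mixed problems on finite-dimensional subspaces\<close>

text \<open>The discrete spaces are subsets of one type of classes, so linearity is always meant
  relative to a carrier set. The obstacle is the convection term: it is a Bochner integral of a
  product of three factors, and where such a product is not integrable the integral is 0 by
  convention, which could destroy bilinearity. With the gradient in L^2, it suffices that the other
  two factors are in L^4; whence the embedding. Vanishing of the convection term needs more, namely
  strong L^4 convergence of the approximating test functions. In contrast, no term of
  \<open>a\<close> is estimated to get its continuity: in finite dimension this follows by expanding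
  in a basis that is orthonormal for the inner product behind the X-norm. The constant therefore
  depends on the discrete spaces and on \<open>(um, Bm)\<close>, but not on \<open>h\<close> and
  \<open>g\<close>. The bump functions serve the fundamental lemma of the calculus of variations; it
  makes weak derivatives unique, so that the definite descriptions \<open>grad\<close>,
  \<open>divergence\<close> and \<open>curl\<close> can be evaluated and are linear.\<close>

definition lin_on :: "'a::real_vector set \<Rightarrow> ('a \<Rightarrow> 'b::real_vector) \<Rightarrow> bool" where
  "lin_on V f \<longleftrightarrow>
     (\<forall>x\<in>V. \<forall>y\<in>V. f (x + y) = f x + f y) \<and> (\<forall>c. \<forall>x\<in>V. f (c *\<^sub>R x) = c *\<^sub>R f x)"

definition bilin_on ::
  "'a::real_vector set \<Rightarrow> 'b::real_vector set \<Rightarrow> ('a \<Rightarrow> 'b \<Rightarrow> 'c::real_vector) \<Rightarrow> bool" where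
  "bilin_on V W f \<longleftrightarrow> (\<forall>x\<in>V. lin_on W (f x)) \<and> (\<forall>y\<in>W. lin_on V (\<lambda>x. f x y))"

lemma lin_onI:
  assumes "\<And>x y. x \<in> V \<Longrightarrow> y \<in> V \<Longrightarrow> f (x + y) = f x + f y"
    and "\<And>c x. x \<in> V \<Longrightarrow> f (c *\<^sub>R x) = c *\<^sub>R f x"
  shows "lin_on V f"
  using assms by (simp add: lin_on_def)

lemma lin_on_add: "lin_on V f \<Longrightarrow> x \<in> V \<Longrightarrow> y \<in> V \<Longrightarrow> f (x + y) = f x + f y"
  and lin_on_scaleR: "lin_on V f \<Longrightarrow> x \<in> V \<Longrightarrow> f (c *\<^sub>R x) = c *\<^sub>R f x"
  by (auto simp: lin_on_def)

lemma lin_on_zero: "lin_on V f \<Longrightarrow> x \<in> V \<Longrightarrow> f 0 = 0"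
  using lin_on_scaleR[of V f x 0] by simp

lemma lin_on_diff:
  assumes "lin_on V f" "subspace V" "x \<in> V" "y \<in> V"
  shows "f (x - y) = f x - f y"
  using lin_on_add[OF assms(1), of x "(-1) *\<^sub>R y"] lin_on_scaleR[OF assms(1), of y "-1"] assms
  by (simp add: subspace_neg)

lemma lin_on_sum:
  assumes "lin_on V f" "subspace V" "\<And>i. i \<in> I \<Longrightarrow> x i \<in> V"
  shows "f (\<Sum>i\<in>I. c i *\<^sub>R x i) = (\<Sum>i\<in>I. c i *\<^sub>R f (x i))"
proof -
  have z: "f 0 = 0" using assms by (meson lin_on_zero subspace_0)
  show ?thesis
  proof (cases "finite I")
    case True
    then show ?thesis using assms(3)
    proof (induction I rule: finite_induct)
      case (insert i I)
      have "(\<Sum>i\<in>I. c i *\<^sub>R x i) \<in> V"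
        using insert.prems assms(2) by (intro subspace_sum subspace_scale) auto
      then show ?case
        using insert assms(1,2) by (simp add: lin_on_add lin_on_scaleR subspace_scale)
    qed (simp add: z)
  qed (simp add: z)
qed

lemma bilin_onD:
  assumes "bilin_on V W f"
  shows "x \<in> V \<Longrightarrow> lin_on W (f x)" "y \<in> W \<Longrightarrow> lin_on V (\<lambda>x. f x y)"
  using assms by (auto simp: bilin_on_def)

section \<open>Orthonormal bases and linear problems in finite dimension\<close>

definition orthonormal_basis_on :: "'a::real_vector set \<Rightarrow> ('a \<Rightarrow> 'a \<Rightarrow> real) \<Rightarrow> 'a set \<Rightarrow> bool" where
  "orthonormal_basis_on V ip E \<longleftrightarrow> finite E \<and> E \<subseteq> V \<and>
     (\<forall>e\<in>E. \<forall>f\<in>E. ip e f = (if e = f then 1 else 0)) \<and>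
     (\<forall>x\<in>V. (\<Sum>e\<in>E. ip x e *\<^sub>R e) = x)"

lemma orthonormal_basis_onD:
  assumes "orthonormal_basis_on V ip E"
  shows "finite E" "E \<subseteq> V" "e \<in> E \<Longrightarrow> f \<in> E \<Longrightarrow> ip e f = (if e = f then 1 else 0)"
    "x \<in> V \<Longrightarrow> (\<Sum>e\<in>E. ip x e *\<^sub>R e) = x"
  using assms by (simp_all add: orthonormal_basis_on_def)

text \<open>Induction over a spanning set that may be dependent: a redundant \<open>b\<close> shows
  up as a vanishing residual and leaves \<open>E\<close> as it is. The form \<open>ip\<close> is
  general because the lemma serves both the ambient inner product and the one behind the
  X-norm.\<close>

lemma gram_schmidt_on:
  assumes "finite B" "bilin_on (span B) (span B) ip"
    and "\<And>x y. x \<in> span B \<Longrightarrow> y \<in> span B \<Longrightarrow> ip x y = ip y x"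
    and "\<And>x. x \<in> span B \<Longrightarrow> x \<noteq> 0 \<Longrightarrow> ip x x > (0::real)"
  shows "\<exists>E. orthonormal_basis_on (span B) ip E"
  using assms
proof (induction B rule: finite_induct)
  case empty
  then show ?case by (intro exI[of _ "{}"]) (auto simp: orthonormal_basis_on_def)
next
  case (insert b B)
  let ?S = "span (insert b B)"
  have sub: "span B \<subseteq> ?S" by (simp add: span_mono subset_insertI)
  have sp: "subspace ?S" by simp
  note bil = bilin_onD[OF insert.prems(1)]
  have "bilin_on (span B) (span B) ip"
    using insert.prems(1) sub unfolding bilin_on_def lin_on_def by blast
  moreover have "ip x y = ip y x" if "x \<in> span B" "y \<in> span B" for x y
    using that sub by (intro insert.prems(2)) auto
  moreover have "ip x x > 0" if "x \<in> span B" "x \<noteq> 0" for x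
    using that sub by (intro insert.prems(3)) auto
  ultimately obtain E where onb: "orthonormal_basis_on (span B) ip E"
    using insert.IH by meson
  note E = orthonormal_basis_onD(1,2)[OF onb] and on = orthonormal_basis_onD(3)[OF onb]
    and ex = orthonormal_basis_onD(4)[OF onb]
  have ES: "E \<subseteq> ?S" using E sub by blast
  have bS: "b \<in> ?S" by (simp add: span_base)
  \<comment> \<open>\<open>s\<close> is the orthogonal projection of \<open>b\<close> onto
    \<open>span B\<close> and \<open>r\<close> the residual; normalizing \<open>r\<close> gives the
    new basis vector \<open>e0\<close>.\<close>
  define s where "s = (\<Sum>e\<in>E. ip b e *\<^sub>R e)"
  define r where "r = b - s"
  have sB: "s \<in> span B" unfolding s_def using E by (intro span_sum span_scale) auto
  have rS: "r \<in> ?S" unfolding r_def using bS sB sub by (intro span_diff) auto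
  show ?case
  proof (cases "r = 0")
    case True
    then have "b \<in> span B" using sB r_def by simp
    then have "?S = span B" by (simp add: span_redundant)
    then show ?thesis using onb by auto
  next
    case False
    define n where "n = sqrt (ip r r)"
    have rr: "ip r r > 0" using False insert.prems(3) rS by blast
    then have n: "n > 0" "n * n = ip r r" by (auto simp: n_def)
    define e0 where "e0 = inverse n *\<^sub>R r"
    have e0S: "e0 \<in> ?S" using rS by (simp add: e0_def span_scale)
    have sE: "ip s e = ip b e" if "e \<in> E" for e
    proof -
      have "ip s e = (\<Sum>f\<in>E. ip b f *\<^sub>R ip f e)"
        unfolding s_def using that ES sp by (intro lin_on_sum[OF bil(2)]) auto
      also have "\<dots> = (\<Sum>f\<in>E. if f = e then ip b e else 0)"
        using that on by (intro sum.cong) auto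
      finally show ?thesis using E that by simp
    qed
    have rE: "ip r e = 0" if "e \<in> E" for e
      using sE[OF that] lin_on_diff[OF bil(2) sp bS, of e s] sB sub that ES by (auto simp: r_def)
    have e0E: "ip e0 e = 0" if "e \<in> E" for e
      using rE[OF that] lin_on_scaleR[OF bil(2) rS, of e] that ES by (auto simp: e0_def)
    have rr0: "ip r e0 = n"
      using lin_on_scaleR[OF bil(1) rS, OF rS] n by (simp add: e0_def field_simps)
    have e00: "ip e0 e0 = 1"
      using lin_on_scaleR[OF bil(2) rS, OF e0S] rr0 n by (simp add: e0_def)
    have e0n: "e0 \<notin> E" using e0E e00 by force
    have yE: "ip y e0 = 0" if "y \<in> span B" for y
    proof -
      have "ip y e0 = ip (\<Sum>e\<in>E. ip y e *\<^sub>R e) e0" using ex[OF that] by simp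
      also have "\<dots> = (\<Sum>e\<in>E. ip y e *\<^sub>R ip e e0)"
        using ES sp e0S by (intro lin_on_sum[OF bil(2)]) auto
      also have "\<dots> = 0"
        using insert.prems(2)[OF e0S] ES e0E by (intro sum.neutral) (metis subsetD scaleR_zero_right)
      finally show ?thesis .
    qed
    have be0: "ip b e0 = n"
      using lin_on_diff[OF bil(2)[OF e0S] sp bS, of s] sB sub rr0 yE[OF sB] by (auto simp: r_def)
    \<comment> \<open>For \<open>x = y + k *\<^sub>R b\<close> with \<open>y\<close> in
      \<open>span B\<close>, the coefficient at \<open>e0\<close> is \<open>k * n\<close>, since
      \<open>y\<close> is orthogonal to \<open>e0\<close> and \<open>ip b e0 = n\<close>. As
      \<open>n *\<^sub>R e0 = r\<close>, this term and the projection \<open>k *\<^sub>R s\<close>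
      add up to \<open>k *\<^sub>R b\<close>.\<close>
    have expand: "(\<Sum>e\<in>insert e0 E. ip x e *\<^sub>R e) = x" if x: "x \<in> ?S" for x
    proof -
      obtain k where k: "x - k *\<^sub>R b \<in> span B" using x by (auto simp: span_breakdown_eq)
      define y where "y = x - k *\<^sub>R b"
      have xy: "x = y + k *\<^sub>R b" and y: "y \<in> span B" using k by (auto simp: y_def)
      have ip: "ip x e = ip y e + k * ip b e" if "e \<in> ?S" for e
        using lin_on_add[OF bil(2)[OF that], of y "k *\<^sub>R b"] lin_on_scaleR[OF bil(2)[OF that] bS, of k]
          y sub bS by (auto simp: xy span_scale)
      have "(\<Sum>e\<in>insert e0 E. ip x e *\<^sub>R e) = (k * n) *\<^sub>R e0 + (\<Sum>e\<in>E. ip x e *\<^sub>R e)"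
        using E e0n e0S by (simp add: ip yE[OF y] be0)
      also have "(\<Sum>e\<in>E. ip x e *\<^sub>R e) = (\<Sum>e\<in>E. ip y e *\<^sub>R e + k *\<^sub>R (ip b e *\<^sub>R e))"
        using ES by (intro sum.cong) (auto simp: ip scaleR_add_left)
      also have "\<dots> = y + k *\<^sub>R s"
        using ex[OF y] by (simp add: sum.distrib s_def scaleR_sum_right)
      also have "(k * n) *\<^sub>R e0 + (y + k *\<^sub>R s) = x"
      proof -
        have "(k * n) *\<^sub>R e0 = k *\<^sub>R r" using n(1) by (simp add: e0_def)
        then show ?thesis by (simp add: xy r_def scaleR_diff_right)
      qed
      finally show ?thesis .
    qed
    show ?thesis
      unfolding orthonormal_basis_on_def
    proof (intro exI[of _ "insert e0 E"] conjI ballI)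
      show "insert e0 E \<subseteq> ?S" using ES e0S by simp
      show "ip e f = (if e = f then 1 else 0)" if "e \<in> insert e0 E" "f \<in> insert e0 E" for e f
        using that on e00 e0E e0n insert.prems(2)[OF e0S] ES by (metis insertE subsetD)
    qed (use E expand in auto)
  qed
qed

text \<open>In finite dimension injectivity implies surjectivity. An orthonormal basis represents
  the functional \<open>A z\<close> by a vector \<open>T z\<close> and \<open>F\<close> by
  \<open>w\<close>; \<open>nd\<close> says that \<open>T\<close> has trivial kernel on
  \<open>V\<close>, and a dimension count puts \<open>w\<close> into its range.\<close>

lemma bilin_on_nondegenerate_solvable:
  fixes A :: "'a::real_inner \<Rightarrow> 'a \<Rightarrow> real"
  assumes "finite_dim_subspace V" and A: "bilin_on V V A"
    and nd: "\<And>z. z \<in> V \<Longrightarrow> (\<And>y. y \<in> V \<Longrightarrow> A z y = 0) \<Longrightarrow> z = 0"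
    and F: "lin_on V F"
  shows "\<exists>z\<in>V. \<forall>y\<in>V. A z y = F y"
proof -
  obtain B0 where B0: "finite B0" "V = span B0"
    using assms(1) by (auto simp: finite_dim_subspace_def)
  \<comment> \<open>The dimension count at the end needs an independent spanning set.\<close>
  obtain B where B: "B \<subseteq> B0" "independent B" "B0 \<subseteq> span B"
    using maximal_independent_subset[of B0] by blast
  have V: "V = span B" "finite B"
    using B B0 by (auto intro: finite_subset simp: span_mono span_minimal subset_antisym)
  have sV: "subspace V" using V by simp
  have "bilin_on (span B) (span B) (inner :: 'a \<Rightarrow> 'a \<Rightarrow> real)"
    by (simp add: bilin_on_def lin_on_def inner_add_left inner_add_right)
  from gram_schmidt_on[OF V(2) this] obtain E where onb: "orthonormal_basis_on V inner E"
    using V(1) by (auto simp: inner_commute)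
  note E = orthonormal_basis_onD(1,2)[OF onb] and on = orthonormal_basis_onD(3)[OF onb]
    and ex = orthonormal_basis_onD(4)[OF onb]
  have inE: "inner (\<Sum>f\<in>E. c f *\<^sub>R f) e = c e" if "e \<in> E" for c e
  proof -
    have "inner (\<Sum>f\<in>E. c f *\<^sub>R f) e = (\<Sum>f\<in>E. if f = e then c e else 0)"
      unfolding inner_sum_left using that on by (intro sum.cong) auto
    then show ?thesis using E that by simp
  qed
  \<comment> \<open>Composing with the orthogonal projection \<open>P\<close> onto \<open>V\<close>
    makes \<open>T\<close> linear on the whole type, although \<open>A\<close> is bilinear only on
    \<open>V\<close>; the general facts on linear maps then apply.\<close>
  define P where "P z = (\<Sum>e\<in>E. inner z e *\<^sub>R e)" for z
  define T where "T z = (\<Sum>e\<in>E. A (P z) e *\<^sub>R e)" for z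
  have PV: "P z \<in> V" for z
    unfolding P_def using E sV by (intro subspace_sum subspace_scale) auto
  have TV: "T z \<in> V" for z
    unfolding T_def using E sV by (intro subspace_sum subspace_scale) auto
  have Pid: "P z = z" if "z \<in> V" for z using ex[OF that] by (simp add: P_def)
  have "linear P"
    unfolding P_def
    by (intro linearI) (auto simp: inner_simps scaleR_add_left sum.distrib scaleR_sum_right)
  then have P: "P (x + y) = P x + P y" "P (c *\<^sub>R x) = c *\<^sub>R P x" for x y c
    by (auto simp: linear_add linear_scale)
  have lT: "linear T"
  proof (rule linearI)
    fix x y c
    have "A (P (x + y)) e = A (P x) e + A (P y) e" "A (P (c *\<^sub>R x)) e = c * A (P x) e" if "e \<in> E" for e
      using that E(2) PV lin_on_add[OF bilin_onD(2)[OF A], of e "P x" "P y"]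
        lin_on_scaleR[OF bilin_onD(2)[OF A], of e "P x" c] by (auto simp: P)
    then show "T (x + y) = T x + T y" "T (c *\<^sub>R x) = c *\<^sub>R T x"
      by (simp_all add: T_def scaleR_add_left scaleR_sum_right sum.distrib)
  qed
  have Adet: "A z y = (\<Sum>e\<in>E. inner y e *\<^sub>R A z e)" if "z \<in> V" "y \<in> V" for z y
    using lin_on_sum[OF bilin_onD(1)[OF A that(1)] sV, of E "\<lambda>e. e" "inner y"] ex[OF that(2)] E
    by (simp add: subset_iff)
  have ker: "z = 0" if "z \<in> V" "T z = 0" for z
  proof (rule nd[OF that(1)])
    have "A z e = 0" if e: "e \<in> E" for e
      using inE[OF e, of "A (P z)"] \<open>T z = 0\<close> Pid[OF \<open>z \<in> V\<close>] by (simp add: T_def)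
    then show "A z y = 0" if "y \<in> V" for y using Adet[OF \<open>z \<in> V\<close> that] by simp
  qed
  have inj: "inj_on T V"
  proof (rule inj_onI)
    fix x y assume *: "x \<in> V" "y \<in> V" "T x = T y"
    then have "T (x - y) = 0" by (simp add: linear_diff[OF lT])
    then show "x = y" using ker[of "x - y"] * sV by (simp add: subspace_diff)
  qed
  have ind: "independent (T ` B)"
    using linear_independent_injective_image[OF lT B(2)] inj V by simp
  have cT: "card (T ` B) = card B"
    using inj V by (intro card_image inj_on_subset[OF inj]) (auto intro: span_base)
  define w where "w = (\<Sum>e\<in>E. F e *\<^sub>R e)"
  have wV: "w \<in> V" unfolding w_def using E sV by (intro subspace_sum subspace_scale) auto
  \<comment> \<open>Otherwise \<open>w\<close> and the images of \<open>B\<close> would be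
    \<open>card B + 1\<close> independent vectors in the span of \<open>B\<close>.\<close>
  have "w \<in> span (T ` B)"
  proof (rule ccontr)
    assume w: "w \<notin> span (T ` B)"
    then have "independent (insert w (T ` B))" using ind by (simp add: independent_insert)
    moreover have "insert w (T ` B) \<subseteq> span B" using wV TV V by auto
    ultimately have "card (insert w (T ` B)) \<le> card B"
      using independent_span_bound[OF V(2)] by blast
    moreover have "w \<notin> T ` B" using w by (rule contrapos_nn) (rule span_base)
    ultimately show False using V(2) cT by simp
  qed
  then have "w \<in> T ` V" using linear_span_image[OF lT, of B] V(1) by metis
  then obtain z where z: "z \<in> V" "T z = w" by blast
  have "A z e = F e" if e: "e \<in> E" for e
    using inE[OF e, of "A (P z)"] inE[OF e, of F] z Pid[OF z(1)] by (simp add: T_def w_def)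
  then have "A z y = F y" if "y \<in> V" for y
    using lin_on_sum[OF F sV, of E "\<lambda>e. e" "inner y"] ex[OF that] E Adet[OF z(1) that]
    by (simp add: subset_iff)
  then show ?thesis using z by blast
qed

lemma finite_dim_subspace_subspace: "finite_dim_subspace V \<Longrightarrow> subspace V"
  by (auto simp: finite_dim_subspace_def)

lemma finite_dim_subspace_Times:
  assumes "finite_dim_subspace V" "finite_dim_subspace W"
  shows "finite_dim_subspace (V \<times> W)"
proof -
  obtain A B where A: "finite A" "V = span A" and B: "finite B" "W = span B"
    using assms by (auto simp: finite_dim_subspace_def)
  let ?C = "(\<lambda>x. (x, 0)) ` A \<union> (\<lambda>y. (0, y)) ` B"
  have l: "linear (\<lambda>x::'a. (x, 0::'b))" "linear (\<lambda>y::'b. (0::'a, y))"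
    by (auto intro!: linearI)
  have "span ?C \<subseteq> V \<times> W"
  proof (rule span_minimal)
    show "subspace (V \<times> W)"
      using assms by (intro subspace_Times finite_dim_subspace_subspace)
    show "?C \<subseteq> V \<times> W" using A B by (auto intro: span_base span_zero)
  qed
  moreover have "V \<times> W \<subseteq> span ?C"
  proof clarify
    fix x y assume "x \<in> V" "y \<in> W"
    then have "(x, 0) \<in> span ((\<lambda>x. (x, 0::'b)) ` A)" "(0, y) \<in> span ((\<lambda>y. (0::'a, y)) ` B)"
      using A B by (auto simp: linear_span_image[OF l(1)] linear_span_image[OF l(2)])
    then have "(x, 0) \<in> span ?C" "(0, y) \<in> span ?C"
      by (meson Un_upper1 Un_upper2 span_mono subsetD)+
    then have "(x, 0) + (0, y) \<in> span ?C" by (rule span_add)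
    then show "(x, y) \<in> span ?C" by simp
  qed
  ultimately have "V \<times> W = span ?C" by blast
  then show ?thesis unfolding finite_dim_subspace_def using A(1) B(1)
    by (intro exI[of _ ?C]) simp
qed

section \<open>Dual norms, bounded forms and the abstract mixed problem\<close>

lemma dual_norm_bound:
  assumes h: "h \<in> dual_space W N" and W: "subspace W" and x: "x \<in> W"
    and N: "\<And>x. x \<in> W \<Longrightarrow> N x \<ge> 0" "\<And>x. x \<in> W \<Longrightarrow> N x = 0 \<Longrightarrow> x = 0"
      "\<And>c x. x \<in> W \<Longrightarrow> N (c *\<^sub>R x) = \<bar>c\<bar> * N x"
  shows "\<bar>h x\<bar> \<le> dual_norm W N h * N x" "dual_norm W N h \<ge> 0"
proof -
  obtain K where K: "\<And>x. x \<in> W \<Longrightarrow> \<bar>h x\<bar> \<le> K * N x"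
    and h1: "\<And>c x. x \<in> W \<Longrightarrow> h (c *\<^sub>R x) = c * h x"
    using h unfolding dual_space_def by blast
  \<comment> \<open>The real supremum in \<open>dual_norm\<close> says something only for sets
    bounded above. The constant \<open>K\<close> of \<open>dual_space\<close> supplies the bound,
    with an absolute value because \<open>K\<close> may be negative.\<close>
  have bdd: "bdd_above ((\<lambda>x. \<bar>h x\<bar>) ` {x \<in> W. N x \<le> 1})"
  proof (rule bdd_aboveI2)
    fix x assume x: "x \<in> {x \<in> W. N x \<le> 1}"
    then have "K * N x \<le> \<bar>K\<bar> * N x" using N(1)[of x] by (intro mult_right_mono) auto
    also have "\<dots> \<le> \<bar>K\<bar> * 1" using x by (intro mult_left_mono) auto
    finally show "\<bar>h x\<bar> \<le> \<bar>K\<bar>" using K[of x] x by auto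
  qed
  have le: "\<bar>h y\<bar> \<le> dual_norm W N h" if "y \<in> W" "N y \<le> 1" for y
    unfolding dual_norm_def using that by (intro cSUP_upper bdd) auto
  have 0: "0 \<in> W" using W by (rule subspace_0)
  have N0: "N 0 = 0" using N(3)[OF 0, of 0] by simp
  show "dual_norm W N h \<ge> 0" using le[OF 0] N0 by auto
  show "\<bar>h x\<bar> \<le> dual_norm W N h * N x"
  proof (cases "N x = 0")
    case True
    then have "x = 0" using N(2) x by blast
    then show ?thesis using h1[OF 0, of 0] N0 by simp
  next
    case False
    then have p: "N x > 0" using N(1)[OF x] by simp
    have "\<bar>h (inverse (N x) *\<^sub>R x)\<bar> \<le> dual_norm W N h"
      using p x W N(3)[OF x] by (intro le subspace_scale) auto
    then show ?thesis using p h1[OF x] by (simp add: abs_mult field_simps)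
  qed
qed

text \<open>In an \<open>ip\<close>-orthonormal basis every coordinate is at most
  \<open>sqrt (ip x x)\<close>, so the sum of the absolute matrix entries of \<open>f\<close> is an
  admissible constant.\<close>

lemma bilin_on_bounded:
  fixes f :: "'a::real_vector \<Rightarrow> 'a \<Rightarrow> real"
  assumes W: "finite_dim_subspace W" and f: "bilin_on W W f" and ip: "bilin_on W W ip"
    and sym: "\<And>x y. x \<in> W \<Longrightarrow> y \<in> W \<Longrightarrow> ip x y = ip y x"
    and pos: "\<And>x. x \<in> W \<Longrightarrow> x \<noteq> 0 \<Longrightarrow> ip x x > (0::real)"
  shows "\<exists>M\<ge>0. \<forall>x\<in>W. \<forall>y\<in>W. \<bar>f x y\<bar> \<le> M * sqrt (ip x x) * sqrt (ip y y)"
proof -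
  obtain B where B: "finite B" "W = span B" using W by (auto simp: finite_dim_subspace_def)
  obtain E where onb: "orthonormal_basis_on W ip E"
    using gram_schmidt_on[OF B(1), of ip] ip sym pos B(2) by blast
  note E = orthonormal_basis_onD(1,2)[OF onb] and on = orthonormal_basis_onD(3)[OF onb]
    and ex = orthonormal_basis_onD(4)[OF onb]
  have sW: "subspace W" using W by (rule finite_dim_subspace_subspace)
  have expand: "F x = (\<Sum>e\<in>E. ip x e * F e)" if "lin_on W F" "x \<in> W" for F :: "'a \<Rightarrow> real" and x
    using lin_on_sum[OF that(1) sW, of E "\<lambda>e. e" "ip x"] ex[OF that(2)] E by (auto simp: subset_iff)
  have coord: "\<bar>ip x e\<bar> \<le> sqrt (ip x x)" if "x \<in> W" "e \<in> E" for x e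
  proof -
    have "ip x x = (\<Sum>e\<in>E. ip x e * ip x e)"
      by (rule expand[OF bilin_onD(1)[OF ip that(1)] that(1)])
    also have "\<dots> \<ge> ip x e * ip x e" using that E by (intro member_le_sum) auto
    finally show ?thesis by (intro real_le_rsqrt) (simp add: power2_eq_square)
  qed
  define M where "M = (\<Sum>e\<in>E. \<Sum>e'\<in>E. \<bar>f e e'\<bar>)"
  have "\<bar>f x y\<bar> \<le> M * sqrt (ip x x) * sqrt (ip y y)" if "x \<in> W" "y \<in> W" for x y
  proof -
    have "f x y = (\<Sum>e\<in>E. ip x e * f e y)"
      by (rule expand[OF bilin_onD(2)[OF f that(2)] that(1)])
    also have "\<dots> = (\<Sum>e\<in>E. \<Sum>e'\<in>E. ip x e * ip y e' * f e e')"
      using E that by (intro sum.cong refl, subst expand[OF bilin_onD(1)[OF f], of _ y])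
        (auto simp: sum_distrib_left mult_ac)
    also have "\<bar>\<dots>\<bar> \<le> (\<Sum>e\<in>E. \<Sum>e'\<in>E. \<bar>ip x e * ip y e' * f e e'\<bar>)"
      by (intro order_trans[OF sum_abs] sum_mono) simp
    also have "\<dots> \<le> (\<Sum>e\<in>E. \<Sum>e'\<in>E. sqrt (ip x x) * sqrt (ip y y) * \<bar>f e e'\<bar>)"
      unfolding abs_mult using that coord order_trans[OF abs_ge_zero coord]
      by (intro sum_mono mult_mono) auto
    also have "\<dots> = M * sqrt (ip x x) * sqrt (ip y y)"
      by (simp add: M_def sum_distrib_left sum_distrib_right mult_ac)
    finally show ?thesis .
  qed
  moreover have "M \<ge> 0" by (simp add: M_def sum_nonneg)
  ultimately show ?thesis by blast
qed

text \<open>If \<open>n > T\<close>, then \<open>T\<^sup>2 \<le> T * n\<close> and a factor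
  \<open>n\<close> cancels; if not, the bound is trivial. This avoids solving the quadratic
  inequality.\<close>

lemma quadratic_a_priori_bound:
  fixes n T L k :: real
  assumes "k > 0" "L \<ge> 0" "T \<ge> 0" "n \<ge> 0" and le: "k * n\<^sup>2 \<le> T * L * n + T\<^sup>2"
  shows "n \<le> T * ((L + 1) / k + 1)"
proof (cases "n \<le> T")
  case True
  moreover have "T * 1 \<le> T * ((L + 1) / k + 1)" using assms by (intro mult_left_mono) auto
  ultimately show ?thesis by simp
next
  case False
  then have "n > 0" "T\<^sup>2 \<le> T * n" using assms by (auto simp: power2_eq_square intro: mult_left_mono)
  then have "(k * n) * n \<le> (T * (L + 1)) * n" using le by (simp add: algebra_simps power2_eq_square)
  then have "k * n \<le> T * (L + 1)" using \<open>n > 0\<close> by simp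
  then have "n \<le> T * (L + 1) / k" using assms by (simp add: field_simps)
  then show ?thesis using assms by (simp add: algebra_simps)
qed

text \<open>\<open>J\<close> is the change of test function; it has to preserve \<open>b\<close>, so
  that the second equation turns \<open>b (J x) p\<close> into \<open>g p\<close>. The inf-sup
  condition is taken in dual form: a bound on the functional \<open>b _ q\<close> in the norm
  \<open>N\<close> bounds \<open>q\<close>. A single a priori estimate does everything, since with
  zero data it shows that the saddle-point form is nondegenerate.\<close>

lemma mixed_problem_well_posed:
  fixes a :: "'x::real_inner \<Rightarrow> 'x \<Rightarrow> real" and b :: "'x \<Rightarrow> 'q::real_inner \<Rightarrow> real"
  assumes W: "finite_dim_subspace W" and Q: "finite_dim_subspace Q"
    and a: "bilin_on W W a" and b: "bilin_on W Q b" and ip: "bilin_on W W ip"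
    and sym: "\<And>x y. x \<in> W \<Longrightarrow> y \<in> W \<Longrightarrow> ip x y = ip y x"
    and pos: "\<And>x. x \<in> W \<Longrightarrow> x \<noteq> 0 \<Longrightarrow> ip x x > 0"
    and N_def: "\<And>x. N x = sqrt (ip x x)"
    and J: "\<And>x. x \<in> W \<Longrightarrow> J x \<in> W" "\<And>x q. x \<in> W \<Longrightarrow> q \<in> Q \<Longrightarrow> b (J x) q = b x q"
      "\<And>x. x \<in> W \<Longrightarrow> N (J x) \<le> m * N x"
    and coercive: "c > 0" "\<And>x. x \<in> W \<Longrightarrow> c * (N x)\<^sup>2 \<le> a x (J x)"
    and infsup: "\<beta> > 0"
      "\<And>q \<gamma>. q \<in> Q \<Longrightarrow> \<gamma> \<ge> 0 \<Longrightarrow> (\<And>y. y \<in> W \<Longrightarrow> b y q \<le> \<gamma> * N y) \<Longrightarrow> \<beta> * norm q \<le> \<gamma>"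
  shows "(\<forall>h \<in> dual_space W N. \<forall>g \<in> dual_space Q norm.
            \<exists>!(x, p). mixed_solution W Q a b h g (x, p)) \<and>
         (\<exists>C>0. \<forall>h \<in> dual_space W N. \<forall>g \<in> dual_space Q norm. \<forall>x p.
            mixed_solution W Q a b h g (x, p) \<longrightarrow>
            N x + norm p \<le> C * (dual_norm W N h + dual_norm Q norm g))"
proof -
  have sW: "subspace W" and sQ: "subspace Q"
    using W Q by (auto intro: finite_dim_subspace_subspace)
  have ip0: "ip 0 0 = 0"
    using lin_on_zero[OF bilin_onD(1)[OF ip]] subspace_0[OF sW] by blast
  have ip_nonneg: "ip x x \<ge> 0" if "x \<in> W" for x
    using pos[OF that] ip0 by (cases "x = 0") auto
  have N: "N x \<ge> 0" "N x = 0 \<Longrightarrow> x = 0" if "x \<in> W" for x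
    using pos[OF that] ip_nonneg[OF that] by (cases "x = 0"; auto simp: N_def)+
  have Nsc: "N (t *\<^sub>R x) = \<bar>t\<bar> * N x" if "x \<in> W" for t x
  proof -
    have "ip (t *\<^sub>R x) (t *\<^sub>R x) = t\<^sup>2 * ip x x"
      using lin_on_scaleR[OF bilin_onD(1)[OF ip, of "t *\<^sub>R x"] that]
        lin_on_scaleR[OF bilin_onD(2)[OF ip that] that] subspace_scale[OF sW that]
      by (simp add: power2_eq_square)
    then show ?thesis by (simp add: N_def real_sqrt_mult)
  qed
  have dW: "\<bar>h x\<bar> \<le> dual_norm W N h * N x" "dual_norm W N h \<ge> 0"
    if "h \<in> dual_space W N" "x \<in> W" for h x
    by (rule dual_norm_bound[OF that(1) sW that(2) N Nsc]; assumption)+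
  have dQ: "\<bar>g q\<bar> \<le> dual_norm Q norm g * norm q" "dual_norm Q norm g \<ge> 0"
    if "g \<in> dual_space Q norm" "q \<in> Q" for g q
    using dual_norm_bound[OF that(1) sQ that(2)] by auto
  obtain M where M: "M \<ge> 0" "\<And>x y. x \<in> W \<Longrightarrow> y \<in> W \<Longrightarrow> \<bar>a x y\<bar> \<le> M * N x * N y"
    using bilin_on_bounded[OF W a ip sym pos] N_def by auto
  \<comment> \<open>\<open>R\<close> is the factor produced by
    \<open>quadratic_a_priori_bound\<close> for \<open>k = \<beta> * c\<close>,
    \<open>L = \<beta> * \<bar>m\<bar> + M\<close> and \<open>T\<close> the sum of the two dual
    norms; the second summand of \<open>C\<close> comes from the pressure bound
    \<open>p1\<close>.\<close>
  define R where "R = (\<beta> * \<bar>m\<bar> + M + 1) / (\<beta> * c) + 1"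
  define C where "C = R + (1 + M * R) / \<beta>"
  have R: "R > 0" using coercive(1) infsup(1) M by (simp add: R_def add_nonneg_pos)
  have C: "C > 0" using R infsup(1) M by (simp add: C_def add_pos_nonneg)
  have est: "N x + norm p \<le> C * (dual_norm W N h + dual_norm Q norm g)"
    if h: "h \<in> dual_space W N" and g: "g \<in> dual_space Q norm"
      and sol: "mixed_solution W Q a b h g (x, p)" for h g x p
  proof -
    define H where "H = dual_norm W N h"
    define G where "G = dual_norm Q norm g"
    have x: "x \<in> W" and p: "p \<in> Q" and e1: "\<And>y. y \<in> W \<Longrightarrow> a x y + b y p = h y"
      and e2: "\<And>q. q \<in> Q \<Longrightarrow> b x q = g q"
      using sol subspace_0[OF sW] subspace_0[OF sQ] by (auto simp: mixed_solution_def)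
    have H: "H \<ge> 0" "\<And>y. y \<in> W \<Longrightarrow> \<bar>h y\<bar> \<le> H * N y"
      unfolding H_def using dW(2)[OF h x] dW(1)[OF h] by simp_all
    have G: "G \<ge> 0" "\<And>q. q \<in> Q \<Longrightarrow> \<bar>g q\<bar> \<le> G * norm q"
      unfolding G_def using dQ(2)[OF g p] dQ(1)[OF g] by simp_all
    \<comment> \<open>By the first equation \<open>b y p = h y - a x y\<close>, which is at most
      \<open>H + M * N x\<close> times \<open>N y\<close>.\<close>
    have p1: "\<beta> * norm p \<le> H + M * N x"
    proof (rule infsup(2)[OF p])
      show "H + M * N x \<ge> 0" using H M N(1)[OF x] by simp
      show "b y p \<le> (H + M * N x) * N y" if "y \<in> W" for y
        using e1[OF that] H(2)[OF that] M(2)[OF x that] by (simp add: algebra_simps)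
    qed
    have "c * (N x)\<^sup>2 \<le> h (J x) - b (J x) p" using coercive(2)[OF x] e1[OF J(1)[OF x]] by simp
    also have "b (J x) p = g p" using J(2)[OF x p] e2[OF p] by simp
    also have "h (J x) - g p \<le> H * N (J x) + G * norm p"
      using H(2)[OF J(1)[OF x]] G(2)[OF p] by simp
    also have "H * N (J x) \<le> H * (\<bar>m\<bar> * N x)"
      using J(3)[OF x] N(1)[OF x] H(1)
      by (intro mult_left_mono order_trans[OF J(3)[OF x]] mult_right_mono) auto
    finally have "c * (N x)\<^sup>2 \<le> H * (\<bar>m\<bar> * N x) + G * norm p" by simp
    \<comment> \<open>Multiplication by \<open>\<beta>\<close> produces
      \<open>\<beta> * norm p\<close>, to which \<open>p1\<close> applies as it stands.\<close>
    then have "\<beta> * (c * (N x)\<^sup>2) \<le> \<beta> * (H * (\<bar>m\<bar> * N x) + G * norm p)"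
      using infsup(1) by (intro mult_left_mono) auto
    also have "\<dots> = \<beta> * H * \<bar>m\<bar> * N x + G * (\<beta> * norm p)" by (simp add: algebra_simps)
    also have "\<dots> \<le> \<beta> * H * \<bar>m\<bar> * N x + G * (H + M * N x)"
      using p1 G(1) by (intro add_left_mono mult_left_mono)
    also have "\<dots> \<le> (H + G) * (\<beta> * \<bar>m\<bar> + M) * N x + (H + G)\<^sup>2"
    proof -
      have "0 \<le> H * M * N x + G * (\<beta> * \<bar>m\<bar>) * N x + H * H + G * G + H * G"
        using H(1) G(1) M(1) N(1)[OF x] infsup(1) by simp
      then show ?thesis by (simp add: algebra_simps power2_eq_square)
    qed
    finally have "(\<beta> * c) * (N x)\<^sup>2 \<le> (H + G) * (\<beta> * \<bar>m\<bar> + M) * N x + (H + G)\<^sup>2"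
      by (simp add: mult.assoc)
    then have n: "N x \<le> (H + G) * R"
      unfolding R_def using coercive(1) infsup(1) M(1) H(1) G(1) N(1)[OF x]
      by (intro quadratic_a_priori_bound) auto
    have "norm p \<le> (H + M * N x) / \<beta>" using p1 infsup(1) by (simp add: field_simps)
    also have "\<dots> \<le> (H + G + M * ((H + G) * R)) / \<beta>"
      using n M(1) G(1) infsup(1) by (intro divide_right_mono add_mono mult_left_mono) auto
    also have "\<dots> = (H + G) * ((1 + M * R) / \<beta>)" by (simp add: algebra_simps)
    finally show ?thesis using n by (simp add: C_def H_def G_def algebra_simps)
  qed
  have zero: "x = 0 \<and> p = 0" if "mixed_solution W Q a b (\<lambda>_. 0) (\<lambda>_. 0) (x, p)" for x p
  proof -
    have z: "(\<lambda>_. 0) \<in> dual_space W N" "(\<lambda>_. 0) \<in> dual_space Q norm"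
      by (auto simp: dual_space_def intro!: exI[of _ 0])
    \<comment> \<open>The supremum of the constant 0 is 0 only over a nonempty set; both unit balls
      contain 0.\<close>
    have "{x \<in> W. N x \<le> 1} \<noteq> {}" "{x \<in> Q. norm x \<le> 1} \<noteq> {}"
      using ip0 subspace_0[OF sW] subspace_0[OF sQ] by (auto simp: N_def intro!: exI[of _ 0])
    then have "dual_norm W N (\<lambda>_. 0) = 0" "dual_norm Q norm (\<lambda>_. 0) = 0"
      by (simp_all add: dual_norm_def)
    then have "N x + norm p \<le> 0" using est[OF z that] by simp
    moreover have "x \<in> W" using that by (simp add: mixed_solution_def)
    ultimately show ?thesis using N[of x] by (smt (verit) norm_ge_zero norm_eq_zero)
  qed
  have ex1: "\<exists>!(x, p). mixed_solution W Q a b h g (x, p)"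
    if h: "h \<in> dual_space W N" and g: "g \<in> dual_space Q norm" for h g
  proof -
    \<comment> \<open>Both equations as a single one on \<open>W \<times> Q\<close>;
      \<open>split\<close> recovers them by testing with \<open>(y, 0)\<close> and
      \<open>(0, q)\<close>.\<close>
    define A where "A = (\<lambda>z w. a (fst z) (fst w) + b (fst w) (snd z) + b (fst z) (snd w))"
    define F where "F = (\<lambda>w. h (fst w) + g (snd w))"
    have A: "bilin_on (W \<times> Q) (W \<times> Q) A"
      using a b unfolding bilin_on_def lin_on_def A_def by (auto simp: algebra_simps)
    have F: "lin_on (W \<times> Q) F"
      using h g unfolding lin_on_def dual_space_def F_def by (auto simp: algebra_simps)
    have b0: "b 0 q = 0" if "q \<in> Q" for q
      using lin_on_zero[OF bilin_onD(2)[OF b that]] subspace_0[OF sW] by blast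
    have b0': "b y 0 = 0" if "y \<in> W" for y
      using lin_on_zero[OF bilin_onD(1)[OF b that]] subspace_0[OF sQ] by blast
    have a0: "a x 0 = 0" if "x \<in> W" for x
      using lin_on_zero[OF bilin_onD(1)[OF a that]] subspace_0[OF sW] by blast
    have h0: "h 0 = 0" "g 0 = 0" using h g subspace_0[OF sW] subspace_0[OF sQ]
      by (auto simp: dual_space_def) (metis mult_zero_left scale_zero_left)+
    have split: "mixed_solution W Q a b h g (x, p)"
      if "(x, p) \<in> W \<times> Q" "\<forall>w\<in>W\<times>Q. A (x, p) w = h (fst w) + g (snd w)" "h 0 = 0" "g 0 = 0"
      for x p h g
    proof -
      have "a x y + b y p = h y" if "y \<in> W" for y
        using that \<open>(x, p) \<in> _\<close> \<open>\<forall>w\<in>_. _\<close>[rule_format, of "(y, 0)"] subspace_0[OF sQ] b0' \<open>g 0 = 0\<close>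
        by (simp add: A_def)
      moreover have "b x q = g q" if "q \<in> Q" for q
        using that \<open>(x, p) \<in> _\<close> \<open>\<forall>w\<in>_. _\<close>[rule_format, of "(0, q)"] subspace_0[OF sW] b0 a0 \<open>h 0 = 0\<close>
        by (simp add: A_def)
      ultimately show ?thesis using \<open>(x, p) \<in> _\<close> by (simp add: mixed_solution_def)
    qed
    have "\<exists>z\<in>W \<times> Q. \<forall>w\<in>W \<times> Q. A z w = F w"
    proof (rule bilin_on_nondegenerate_solvable[OF finite_dim_subspace_Times[OF W Q] A _ F])
      fix z assume z: "z \<in> W \<times> Q" "\<And>w. w \<in> W \<times> Q \<Longrightarrow> A z w = 0"
      then have "mixed_solution W Q a b (\<lambda>_. 0) (\<lambda>_. 0) (fst z, snd z)"
        by (intro split) auto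
      from zero[OF this] show "z = 0" by (simp add: prod_eq_iff)
    qed
    then obtain x p where xp: "(x, p) \<in> W \<times> Q" "\<forall>w\<in>W\<times>Q. A (x, p) w = F w" by auto
    then have s1: "mixed_solution W Q a b h g (x, p)" using h0 by (intro split) (auto simp: F_def)
    have "x' = x \<and> p' = p" if s2: "mixed_solution W Q a b h g (x', p')" for x' p'
    proof -
      have m: "x \<in> W" "x' \<in> W" "p \<in> Q" "p' \<in> Q" using s1 s2 by (auto simp: mixed_solution_def)
      have "mixed_solution W Q a b (\<lambda>_. 0) (\<lambda>_. 0) (x' - x, p' - p)"
        using s1 s2 lin_on_diff[OF bilin_onD(2)[OF a] sW m(2,1)]
          lin_on_diff[OF bilin_onD(2)[OF b] sW m(2,1)] lin_on_diff[OF bilin_onD(1)[OF b] sQ m(4,3)]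
          subspace_diff[OF sW m(2,1)] subspace_diff[OF sQ m(4,3)]
        by (simp add: mixed_solution_def) (metis (no_types, lifting) add_diff_add diff_self)
      from zero[OF this] show ?thesis by simp
    qed
    with s1 show ?thesis by auto
  qed
  from ex1 est C show ?thesis by blast
qed

subsection \<open>Smooth bump functions\<close>

lemma partial_eqI: "(f has_derivative D) (at x) \<Longrightarrow> partial i f x = D (axis i 1)"
  unfolding partial_def by (simp add: frechet_derivative_at[symmetric])

lemma has_derivative_partial:
  "f differentiable (at x) \<Longrightarrow> \<exists>D. (f has_derivative D) (at x) \<and> (\<forall>i. partial i f x = D (axis i 1))"
  unfolding partial_def using frechet_derivative_works by blast

lemma partial_add:
  assumes "f differentiable (at x)" "g differentiable (at x)"
  shows "partial i (\<lambda>x. f x + g x) x = partial i f x + partial i g x"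
proof -
  obtain F G where "(f has_derivative F) (at x)" "partial i f x = F (axis i 1)"
    "(g has_derivative G) (at x)" "partial i g x = G (axis i 1)"
    using assms has_derivative_partial by metis
  then show ?thesis by (simp add: partial_eqI[OF has_derivative_add])
qed

lemma partial_mult:
  fixes f g :: "real^3 \<Rightarrow> real"
  assumes "f differentiable (at x)" "g differentiable (at x)"
  shows "partial i (\<lambda>x. f x * g x) x = f x * partial i g x + partial i f x * g x"
proof -
  obtain F G where "(f has_derivative F) (at x)" "partial i f x = F (axis i 1)"
    "(g has_derivative G) (at x)" "partial i g x = G (axis i 1)"
    using assms has_derivative_partial by metis
  then show ?thesis by (simp add: partial_eqI[OF has_derivative_mult])
qed

lemma partial_bounded_linear:
  assumes "bounded_linear L" "f differentiable (at x)"
  shows "partial i (\<lambda>x. L (f x)) x = L (partial i f x)"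
proof -
  obtain F where "(f has_derivative F) (at x)" "partial i f x = F (axis i 1)"
    using assms has_derivative_partial by metis
  then show ?thesis
    by (simp add: partial_eqI[OF bounded_linear.has_derivative[OF assms(1)]])
qed

lemma continuously_diff_differentiable: "continuously_diff (Suc k) f \<Longrightarrow> f differentiable (at x)"
  by simp

lemma continuously_diff_Suc: "continuously_diff (Suc k) f \<Longrightarrow> continuously_diff k f"
proof (induction k arbitrary: f)
  case 0
  then show ?case
    by (auto intro!: continuous_at_imp_continuous_on differentiable_imp_continuous_within)
qed auto

lemma continuously_diff_const: "continuously_diff k (\<lambda>x. c)"
proof (induction k arbitrary: c)
  case (Suc k)
  have "partial i (\<lambda>x. c) = (\<lambda>x. 0)" for i by (rule ext) (auto intro!: partial_eqI)
  with Suc show ?case by simp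
qed simp

lemma continuously_diff_add:
  "continuously_diff k f \<Longrightarrow> continuously_diff k g \<Longrightarrow> continuously_diff k (\<lambda>x. f x + g x)"
proof (induction k arbitrary: f g)
  case 0
  then show ?case by (simp add: continuous_on_add)
next
  case (Suc k)
  then have "partial i (\<lambda>x. f x + g x) = (\<lambda>x. partial i f x + partial i g x)" for i
    by (intro ext partial_add) auto
  with Suc show ?case by simp
qed

lemma continuously_diff_bounded_linear:
  assumes L: "bounded_linear L"
  shows "continuously_diff k f \<Longrightarrow> continuously_diff k (\<lambda>x. L (f x))"
proof (induction k arbitrary: f)
  case 0
  then show ?case by (simp add: bounded_linear.continuous_on[OF L])
next
  case (Suc k)
  then have "partial i (\<lambda>x. L (f x)) = (\<lambda>x. L (partial i f x))" for i
    by (intro ext partial_bounded_linear[OF L]) auto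
  moreover have "(\<lambda>x. L (f x)) differentiable (at x)" for x
    using Suc.prems bounded_linear.has_derivative[OF L] unfolding differentiable_def
    by (metis continuously_diff_differentiable differentiable_def)
  ultimately show ?case using Suc by simp
qed

lemma continuously_diff_mult:
  fixes f g :: "real^3 \<Rightarrow> real"
  shows "continuously_diff k f \<Longrightarrow> continuously_diff k g \<Longrightarrow> continuously_diff k (\<lambda>x. f x * g x)"
proof (induction k arbitrary: f g)
  case 0
  then show ?case by (simp add: continuous_on_mult)
next
  case (Suc k)
  then have "partial i (\<lambda>x. f x * g x) = (\<lambda>x. f x * partial i g x + partial i f x * g x)" for i
    by (intro ext partial_mult) auto
  moreover have "continuously_diff k (\<lambda>x. f x * partial i g x + partial i f x * g x)" for i
    using Suc.prems continuously_diff_Suc[OF Suc.prems(1)] continuously_diff_Suc[OF Suc.prems(2)]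
    by (intro continuously_diff_add Suc.IH) auto
  ultimately show ?case using Suc.prems by simp
qed

lemma continuously_diff_prod:
  fixes f :: "'i \<Rightarrow> real^3 \<Rightarrow> real"
  assumes "\<And>i. i \<in> I \<Longrightarrow> continuously_diff k (f i)"
  shows "continuously_diff k (\<lambda>x. \<Prod>i\<in>I. f i x)"
proof (cases "finite I")
  case True
  then show ?thesis using assms
    by (induction I rule: finite_induct) (auto intro!: continuously_diff_const continuously_diff_mult)
qed (simp add: continuously_diff_const)

text \<open>The derivatives of the one-variable function are given as a whole sequence, and the
  induction treats all members at once: differentiating in direction \<open>j\<close> shifts
  \<open>G m\<close> to \<open>G (Suc m)\<close>, the other directions give 0.\<close>

lemma continuously_diff_component:
  fixes G :: "nat \<Rightarrow> real \<Rightarrow> real"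
  assumes G: "\<And>m t. (G m has_real_derivative G (Suc m) t) (at t)"
  shows "continuously_diff k (\<lambda>x. G m (x $ j))"
proof (induction k arbitrary: m)
  case 0
  have "continuous_on UNIV (G m)" for m
    using G by (auto intro!: continuous_at_imp_continuous_on DERIV_isCont)
  then have "continuous_on UNIV (\<lambda>x. G m (x $ j))"
    by (rule continuous_on_compose2) (auto intro!: continuous_intros)
  then show ?case by simp
next
  case (Suc k)
  have D: "((\<lambda>x. G m (x $ j)) has_derivative (\<lambda>h. G (Suc m) (x $ j) * h $ j)) (at x)" for x :: "real^3"
    using has_derivative_compose[OF bounded_linear_imp_has_derivative[OF bounded_linear_vec_nth]
        G[of m "x $ j", unfolded has_field_derivative_def]] .
  have "partial i (\<lambda>x. G m (x $ j)) = (if i = j then (\<lambda>x. G (Suc m) (x $ j)) else (\<lambda>x. 0))" for i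
    by (rule ext) (auto simp: partial_eqI[OF D] axis_def)
  then show ?case using Suc D
    by (auto simp: continuously_diff_const differentiable_def)
qed

section \<open>The function exp (-1/t) and bump functions on boxes\<close>

lemma poly_div_exp_tendsto_0:
  fixes p :: "real poly"
  shows "((\<lambda>s. poly p s / exp s) \<longlongrightarrow> 0) at_top"
proof -
  \<comment> \<open>The additional power \<open>s ^ k\<close> lets the induction absorb the factor
    \<open>s\<close> in the decomposition of \<open>pCons a p\<close> as \<open>a\<close> plus
    \<open>s\<close> times \<open>p\<close>.\<close>
  have "((\<lambda>s. s ^ k * poly p s / exp s) \<longlongrightarrow> 0) at_top" for k
  proof (induction p arbitrary: k)
    case (pCons a p)
    have "((\<lambda>s. a * (s ^ k / exp s) + s ^ Suc k * poly p s / exp s) \<longlongrightarrow> a * 0 + 0) at_top"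
      by (intro tendsto_intros tendsto_power_div_exp_0 pCons.IH)
    then show ?case by (simp add: algebra_simps add_divide_distrib)
  qed simp
  from this[of 0] show ?thesis by simp
qed

text \<open>The derivatives of \<open>exp (-1/t)\<close> have the form \<open>p (1/t) exp (-1/t)\<close> with \<open>p\<close> polynomial.\<close>

fun bump_poly :: "nat \<Rightarrow> real poly" where
  "bump_poly 0 = 1"
| "bump_poly (Suc m) = [:0, 0, 1:] * (bump_poly m - pderiv (bump_poly m))"

text \<open>\<open>bump m\<close> is the m-th derivative of exp (-1/t) extended by 0 to the negative
  half-line. Indexing by the order is the format that \<open>continuously_diff_component\<close>
  expects.\<close>

definition bump :: "nat \<Rightarrow> real \<Rightarrow> real" where
  "bump m t = (if t > 0 then poly (bump_poly m) (inverse t) / exp (inverse t) else 0)"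

text \<open>With s = 1/t, the derivative of p(s) exp (-s) is s^2 (p(s) - p'(s)) exp (-s), which is
  the recursion of \<open>bump_poly\<close>. At 0 the difference quotient is s p(s) exp (-s) on the
  right, which tends to 0, and it is 0 on the left.\<close>

lemma bump_has_derivative: "(bump m has_real_derivative bump (Suc m) t) (at t)"
proof -
  consider "t > 0" | "t < 0" | "t = 0" by linarith
  then show ?thesis
  proof cases
    case 1
    let ?p = "poly (bump_poly m)" and ?q = "poly (pderiv (bump_poly m))"
    have "((\<lambda>t. ?p (inverse t) * exp (- inverse t)) has_real_derivative
        (?q (inverse t) * (- (inverse t * inverse t))) * exp (- inverse t) +
        ?p (inverse t) * (exp (- inverse t) * (inverse t * inverse t))) (at t)"
      using 1 by (auto intro!: derivative_eq_intros DERIV_chain2[OF poly_DERIV] simp: power2_eq_square)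
    also have "(?q (inverse t) * (- (inverse t * inverse t))) * exp (- inverse t) +
        ?p (inverse t) * (exp (- inverse t) * (inverse t * inverse t)) = bump (Suc m) t"
      using 1 by (simp add: bump_def exp_minus divide_inverse algebra_simps)
    finally show ?thesis
      by (rule has_field_derivative_transform_within_open[of _ _ _ "{0<..}"])
        (use 1 in \<open>auto simp: bump_def exp_minus divide_inverse\<close>)
  next
    case 2
    have "((\<lambda>t. 0) has_real_derivative bump (Suc m) t) (at t)" using 2 by (simp add: bump_def)
    then show ?thesis
      by (rule has_field_derivative_transform_within_open[of _ _ _ "{..<0}"])
        (use 2 in \<open>auto simp: bump_def\<close>)
  next
    case 3
    have "((\<lambda>t. poly ([:0, 1:] * bump_poly m) (inverse t) / exp (inverse t)) \<longlongrightarrow> 0) (at_right 0)"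
      by (rule filterlim_compose[OF poly_div_exp_tendsto_0 filterlim_inverse_at_top_right])
    then have r: "((\<lambda>t. bump m t / t) \<longlongrightarrow> 0) (at_right 0)"
      by (rule Lim_transform_eventually)
        (auto simp: eventually_at_filter bump_def divide_inverse mult_ac intro!: always_eventually)
    have "((\<lambda>t. 0) \<longlongrightarrow> 0) (at_left (0::real))" by simp
    then have l: "((\<lambda>t. bump m t / t) \<longlongrightarrow> 0) (at_left 0)"
      by (rule Lim_transform_eventually)
        (auto simp: eventually_at_filter bump_def intro!: always_eventually)
    have "((\<lambda>t. bump m t / t) \<longlongrightarrow> 0) (at 0)" using l r by (simp add: filterlim_split_at)
    then show ?thesis using 3 by (simp add: has_field_derivative_iff bump_def)
  qed
qed

lemma bump_0_bounds: "0 \<le> bump 0 t" "bump 0 t \<le> 1"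
  by (auto simp: bump_def divide_simps)

lemma bump_0_tendsto_1:
  assumes "t > 0"
  shows "(\<lambda>n. bump 0 (real (Suc n) * t)) \<longlonglongrightarrow> 1"
proof -
  have "filterlim (\<lambda>n. t * real (Suc n)) at_top sequentially"
    using assms filterlim_tendsto_pos_mult_at_top[OF tendsto_const assms
        filterlim_compose[OF filterlim_real_sequentially filterlim_Suc]] by (simp add: mult_ac)
  then have "(\<lambda>n. inverse (t * real (Suc n))) \<longlonglongrightarrow> 0"
    by (rule filterlim_compose[OF tendsto_inverse_0_at_top[OF filterlim_ident]])
  then have "(\<lambda>n. exp (- inverse (t * real (Suc n)))) \<longlonglongrightarrow> exp (- 0)"
    by (intro tendsto_intros)
  moreover have "bump 0 (real (Suc n) * t) = exp (- inverse (t * real (Suc n)))" for n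
    using assms by (simp add: bump_def exp_minus divide_inverse mult_ac del: of_nat_Suc)
  ultimately show ?thesis by simp
qed

text \<open>Smooth approximations of the indicator of the open box: each coordinate contributes one
  factor per face, and \<open>Suc n\<close> steepens the factors, because \<open>bump 0\<close>
  tends to 1 at infinity.\<close>

definition box_bump :: "real^3 \<Rightarrow> real^3 \<Rightarrow> nat \<Rightarrow> real^3 \<Rightarrow> real" where
  "box_bump a b n x =
     (\<Prod>j\<in>UNIV. bump 0 (real (Suc n) * (x $ j - a $ j)) * bump 0 (real (Suc n) * (b $ j - x $ j)))"

text \<open>Puts affine substitutions into the format of \<open>continuously_diff_component\<close>;
  the two faces of a box need slopes of opposite sign.\<close>

lemma bump_affine_has_derivative:
  "((\<lambda>t. c ^ m * bump m (c * t + d)) has_real_derivative c ^ Suc m * bump (Suc m) (c * t + d)) (at t)"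
  by (auto intro!: derivative_eq_intros DERIV_chain2[OF bump_has_derivative])

lemma box_bump_continuously_diff: "continuously_diff k (box_bump a b n)"
proof -
  have 1: "continuously_diff k (\<lambda>x. bump 0 (real (Suc n) * (x $ j - a $ j)))" for j
    using continuously_diff_component[where G = "\<lambda>m t. (real (Suc n)) ^ m * bump m ((real (Suc n)) * t + (- real (Suc n) * a $ j))",
        OF bump_affine_has_derivative, of k 0 j]
    by (simp add: algebra_simps)
  have 2: "continuously_diff k (\<lambda>x. bump 0 (real (Suc n) * (b $ j - x $ j)))" for j
    using continuously_diff_component[where G = "\<lambda>m t. (- real (Suc n)) ^ m * bump m ((- real (Suc n)) * t + (real (Suc n) * b $ j))",
        OF bump_affine_has_derivative, of k 0 j]
    by (simp add: algebra_simps)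
  show ?thesis
    unfolding box_bump_def by (intro continuously_diff_prod continuously_diff_mult 1 2)
qed

lemma box_bump_bounds: "0 \<le> box_bump a b n x" "box_bump a b n x \<le> 1"
  unfolding box_bump_def
  by (auto intro!: prod_nonneg prod_le_1 mult_nonneg_nonneg mult_le_one simp: bump_0_bounds simp del: of_nat_Suc)

lemma box_bump_outside: "x \<notin> box a b \<Longrightarrow> box_bump a b n x = 0"
proof -
  assume "x \<notin> box a b"
  then obtain j where "x $ j \<le> a $ j \<or> b $ j \<le> x $ j" by (auto simp: mem_box_cart not_less)
  then have "bump 0 (real (Suc n) * (x $ j - a $ j)) * bump 0 (real (Suc n) * (b $ j - x $ j)) = 0"
    by (auto simp: bump_def zero_less_mult_iff simp del: of_nat_Suc)
  then show ?thesis unfolding box_bump_def by (intro prod_zero) auto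
qed

lemma box_bump_tendsto: "(\<lambda>n. box_bump a b n x) \<longlonglongrightarrow> indicator (box a b) x"
proof (cases "x \<in> box a b")
  case True
  then have "(\<lambda>n. box_bump a b n x) \<longlonglongrightarrow> (\<Prod>j\<in>(UNIV::3 set). 1 * 1)"
    unfolding box_bump_def
    by (intro tendsto_prod tendsto_mult bump_0_tendsto_1) (auto simp: mem_box_cart)
  with True show ?thesis by simp
qed (simp add: box_bump_outside)

text \<open>The compact set witnessing the support condition is the closed box, hence the inclusion
  of \<open>cbox a b\<close> rather than of \<open>box a b\<close>.\<close>

lemma test_function_box_bump: "cbox a b \<subseteq> \<Omega> \<Longrightarrow> test_function \<Omega> (box_bump a b n)"
  unfolding test_function_def using box_subset_cbox[of a b] box_bump_outside[of _ a b n]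
  by (auto intro!: box_bump_continuously_diff exI[of _ "cbox a b"])

subsection \<open>The fundamental lemma of the calculus of variations\<close>

text \<open>The elementary bound of t by t^2 + 1 suffices, because the constant 1 is integrable on a
  set of finite measure.\<close>

lemma square_integrable_times_indicator:
  assumes f: "square_integrable f" and A: "A \<in> sets lborel" "emeasure lborel A < \<infinity>"
  shows "integrable lborel (\<lambda>x. indicator A x *\<^sub>R f x)"
proof -
  have i: "integrable lborel (\<lambda>x. (norm (f x))\<^sup>2 + indicator A x)"
    using f A by (auto simp: square_integrable_def)
  have m: "(\<lambda>x. indicator A x *\<^sub>R f x) \<in> borel_measurable lborel"
    using f A by (auto simp: square_integrable_def)
  have "norm (f x) \<le> (norm (f x))\<^sup>2 + 1" for x
    using sum_squares_bound[of "norm (f x)" 1] norm_ge_zero[of "f x"] by (smt (verit) power_one)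
  then show ?thesis
    by (intro Bochner_Integration.integrable_bound[OF i m]) (auto simp: indicator_def)
qed

text \<open>Dominated convergence along the bump functions, which lie between 0 and the indicator of
  the box and converge to it.\<close>

lemma integral_box_eq_0:
  fixes f :: "real^3 \<Rightarrow> real"
  assumes f: "square_integrable f" and sub: "cbox a b \<subseteq> \<Omega>"
    and orth: "\<And>\<phi>. test_function \<Omega> \<phi> \<Longrightarrow> (LINT x|lborel. f x * \<phi> x) = 0"
  shows "(LINT x|lborel. f x * indicator (box a b) x) = 0"
proof -
  have m[measurable]: "f \<in> borel_measurable borel" using f by (simp add: square_integrable_def)
  have mb[measurable]: "box_bump a b n \<in> borel_measurable borel" for n
    using box_bump_continuously_diff[of 0 a b n] by (auto intro: borel_measurable_continuous_onI)
  have "integrable lborel (\<lambda>x. indicator (box a b) x *\<^sub>R f x)"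
    using f by (intro square_integrable_times_indicator) (auto simp: emeasure_lborel_box_eq)
  then have w: "integrable lborel (\<lambda>x. \<bar>f x * indicator (box a b) x\<bar>)"
    by (simp add: mult.commute)
  have "(\<lambda>n. LINT x|lborel. f x * box_bump a b n x) \<longlonglongrightarrow> (LINT x|lborel. f x * indicator (box a b) x)"
  proof (rule integral_dominated_convergence[OF _ _ w])
    show "AE x in lborel. (\<lambda>n. f x * box_bump a b n x) \<longlonglongrightarrow> f x * indicator (box a b) x"
      by (intro AE_I2 tendsto_intros box_bump_tendsto)
    show "AE x in lborel. norm (f x * box_bump a b n x) \<le> \<bar>f x * indicator (box a b) x\<bar>" for n
      using box_bump_bounds[of a b n] box_bump_outside[of _ a b n]
      by (intro AE_I2) (auto simp: indicator_def abs_mult mult_left_le)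
  qed auto
  moreover have "(LINT x|lborel. f x * box_bump a b n x) = 0" for n
    by (intro orth test_function_box_bump sub)
  ultimately show ?thesis by (simp add: LIMSEQ_const_iff)
qed

text \<open>A Dynkin argument: boxes are an intersection-stable generator of the Borel sets, so
  vanishing integrals over boxes extend to all Borel sets, which forces the integrand to vanish
  almost everywhere. Cutting \<open>f\<close> off to the box makes it integrable.\<close>

lemma AE_zero_on_box:
  fixes f :: "real^3 \<Rightarrow> real"
  assumes f: "square_integrable f" and sub: "cbox a b \<subseteq> \<Omega>"
    and orth: "\<And>\<phi>. test_function \<Omega> \<phi> \<Longrightarrow> (LINT x|lborel. f x * \<phi> x) = 0"
  shows "AE x in lborel. x \<in> box a b \<longrightarrow> f x = 0"
proof -
  define g where "g x = f x * indicator (box a b) x" for x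
  have gi: "integrable lborel g"
    using square_integrable_times_indicator[OF f, of "box a b"]
    by (simp add: g_def[abs_def] emeasure_lborel_box_eq mult.commute)
  have box0: "(LINT x:box c d|lborel. g x) = 0" for c d
  proof -
    obtain a' b' where ab: "box c d \<inter> box a b = box a' b'" by (rule that[OF box_Int_box])
    have "(LINT x:box c d|lborel. g x) = (LINT x|lborel. f x * indicator (box a' b') x)"
      unfolding set_lebesgue_integral_def g_def ab[symmetric]
      by (intro Bochner_Integration.integral_cong) (auto simp: indicator_def)
    \<comment> \<open>For an empty intersection the corners \<open>a'\<close> and \<open>b'\<close>
      may lie anywhere; for a nonempty one the closed box is the closure of the open one and stays
      inside \<open>cbox a b\<close>.\<close>
    also have "\<dots> = 0"
    proof (cases "box a' b' = {}")
      case False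
      have "closure (box a' b') \<subseteq> cbox a b"
        unfolding ab[symmetric] using box_subset_cbox by (intro closure_minimal) auto
      then have "cbox a' b' \<subseteq> cbox a b" using False by simp
      then show ?thesis using sub by (intro integral_box_eq_0[OF f _ orth]) auto
    qed simp
    finally show ?thesis .
  qed
  \<comment> \<open>The integral over the whole space is needed for complements in the
    induction.\<close>
  have all0: "(LINT x|lborel. g x) = 0"
    using box0[of a b] unfolding set_lebesgue_integral_def g_def
    by (simp add: indicator_inter_arith[symmetric] mult.commute mult.left_commute)
  have A0: "(LINT x:A|lborel. g x) = 0" if A: "A \<in> sets lborel" for A
  proof -
    have si: "set_integrable lborel B g" if "B \<in> sets borel" for B
      using integrable_mult_indicator[OF _ gi, of B] that by (simp add: set_integrable_def)
    let ?E = "range (\<lambda>(a, b). box a b :: (real^3) set)"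
    have borel: "sets borel = sigma_sets UNIV ?E" by (simp add: borel_eq_box)
    have "Int_stable ?E" by (auto simp: Int_stable_def box_Int_box)
    moreover have "?E \<subseteq> Pow UNIV" by simp
    moreover have "A \<in> sigma_sets UNIV ?E" using A borel by simp
    ultimately show ?thesis
    proof (induction rule: sigma_sets_induct_disjoint)
      fix A assume A: "A \<in> sigma_sets UNIV ?E" "(LINT x:A|lborel. g x) = 0"
      have "A \<in> sets borel" "UNIV - A \<in> sets borel"
        using A(1) sets.compl_sets[of A borel] by (simp_all add: borel)
      then have "(LINT x:UNIV|lborel. g x) = (LINT x:A|lborel. g x) + (LINT x:UNIV - A|lborel. g x)"
        using set_integral_Un[of A "UNIV - A" lborel g] si[of A] si[of "UNIV - A"] by simp
      then show "(LINT x:UNIV - A|lborel. g x) = 0"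
        using A(2) all0 by (simp add: set_lebesgue_integral_def)
    next
      fix A :: "nat \<Rightarrow> (real^3) set"
      assume A: "disjoint_family A" "range A \<subseteq> sigma_sets UNIV ?E" "\<And>i. (LINT x:A i|lborel. g x) = 0"
      have "A i \<in> sets borel" for i using A(2) borel by auto
      then have "(LINT x:(\<Union>i. A i)|lborel. g x) = (\<Sum>i. (LINT x:A i|lborel. g x))"
        using A(1) by (intro lebesgue_integral_countable_add si) (auto simp: disjoint_family_on_def)
      then show "(LINT x:(\<Union>i. A i)|lborel. g x) = 0" using A(3) by simp
    qed (auto simp: box0 set_lebesgue_integral_def[of _ "{}"])
  qed
  have "AE x in lborel. g x = 0" using gi A0 by (rule sigma_finite_measure.density_zero[OF lborel.sigma_finite_measure_axioms])
  then show ?thesis by eventually_elim (auto simp: g_def)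
qed

text \<open>The null set depends on the box, so the cover of \<open>\<Omega>\<close> by boxes is
  first reduced to a countable one.\<close>

lemma AE_zero_on_open:
  fixes f :: "real^3 \<Rightarrow> real"
  assumes "open \<Omega>" and f: "square_integrable f"
    and orth: "\<And>\<phi>. test_function \<Omega> \<phi> \<Longrightarrow> (LINT x|lborel. f x * \<phi> x) = 0"
  shows "AE x in lborel. x \<in> \<Omega> \<longrightarrow> f x = 0"
proof -
  let ?F = "{box a b | a b. cbox a b \<subseteq> \<Omega>}"
  have "\<Union>?F = \<Omega>"
  proof (intro subset_antisym subsetI)
    fix x assume "x \<in> \<Omega>"
    then obtain e where e: "e > 0" "cball x e \<subseteq> \<Omega>" using \<open>open \<Omega>\<close> open_contains_cball by blast
    obtain a b where ab: "x \<in> box a b" "box a b \<subseteq> ball x e" using rational_boxes[OF e(1)] by blast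
    then have "closure (box a b) \<subseteq> cball x e"
      by (intro closure_minimal closed_cball order_trans[OF _ ball_subset_cball])
    then have "cbox a b \<subseteq> cball x e" using ab(1) by (subst (asm) closure_box) auto
    then show "x \<in> \<Union>?F" using e ab by blast
  qed (use box_subset_cbox in blast)
  moreover obtain F' where F': "F' \<subseteq> ?F" "countable F'" "\<Union>F' = \<Union>?F"
    by (rule Lindelof[of ?F]) (auto simp: open_box)
  moreover have "AE x in lborel. \<forall>B\<in>F'. x \<in> B \<longrightarrow> f x = 0"
    unfolding AE_ball_countable[OF F'(2)] using F'(1) AE_zero_on_box[OF f _ orth] by blast
  ultimately show ?thesis by (auto elim!: AE_mp)
qed

section \<open>Closure properties of test functions\<close>

lemma test_function_outside: "test_function \<Omega> \<phi> \<Longrightarrow> x \<notin> \<Omega> \<Longrightarrow> \<phi> x = 0"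
  by (auto simp: test_function_def)

lemma test_function_continuous: "test_function \<Omega> \<phi> \<Longrightarrow> continuous_on UNIV \<phi>"
  unfolding test_function_def using continuously_diff.simps(1) by blast

lemma test_function_differentiable: "test_function \<Omega> \<phi> \<Longrightarrow> \<phi> differentiable (at x)"
  unfolding test_function_def using continuously_diff.simps(2) by blast

lemma square_integrable_compact_support:
  assumes "continuous_on UNIV f" "compact K" "\<And>x. x \<notin> K \<Longrightarrow> f x = 0"
  shows "square_integrable f"
proof -
  have "integrable lborel (\<lambda>x. indicator K x *\<^sub>R (norm (f x))\<^sup>2)"
    using assms by (intro borel_integrable_compact continuous_intros continuous_on_subset[OF assms(1)]) auto
  also have "(\<lambda>x. indicator K x *\<^sub>R (norm (f x))\<^sup>2) = (\<lambda>x. (norm (f x))\<^sup>2)"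
    using assms(3) by (intro ext) (auto split: split_indicator)
  finally show ?thesis
    using assms(1) by (auto simp: square_integrable_def intro: borel_measurable_continuous_onI)
qed

lemma test_function_square_integrable: "test_function \<Omega> \<phi> \<Longrightarrow> square_integrable \<phi>"
  using test_function_continuous
  by (auto simp: test_function_def intro!: square_integrable_compact_support)

lemma test_function_partial:
  assumes "test_function \<Omega> \<phi>"
  shows "test_function \<Omega> (partial i \<phi>)"
proof -
  obtain K where K: "compact K" "K \<subseteq> \<Omega>" "\<And>x. x \<notin> K \<Longrightarrow> \<phi> x = 0"
    using assms by (auto simp: test_function_def)
  have "partial i \<phi> x = 0" if "x \<notin> K" for x
  proof -
    have "((\<lambda>x. 0) has_derivative (\<lambda>h. 0)) (at x)" by simp
    then have "(\<phi> has_derivative (\<lambda>h. 0)) (at x)"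
      by (rule has_derivative_transform_within_open[of _ _ _ _ "- K"])
        (use that K in \<open>auto intro: compact_imp_closed\<close>)
    then show ?thesis by (simp add: partial_eqI)
  qed
  with K assms show ?thesis unfolding test_function_def
    by (metis continuously_diff.simps(2))
qed

lemma test_function_bounded_linear:
  assumes "bounded_linear L" "test_function \<Omega> \<phi>"
  shows "test_function \<Omega> (\<lambda>x. L (\<phi> x))"
  using assms(2) bounded_linear.linear[OF assms(1)]
  by (auto simp: test_function_def linear_0 intro: continuously_diff_bounded_linear[OF assms(1)])

lemma test_function_scaleR_const: "test_function \<Omega> \<phi> \<Longrightarrow> test_function \<Omega> (\<lambda>x. \<phi> x *\<^sub>R c)"
  by (rule test_function_bounded_linear[OF bounded_linear_scaleR_left])

lemma test_function_add:
  assumes "test_function \<Omega> f" "test_function \<Omega> g"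
  shows "test_function \<Omega> (\<lambda>x. f x + g x)"
proof -
  obtain K K' where "compact K" "K \<subseteq> \<Omega>" "\<And>x. x \<notin> K \<Longrightarrow> f x = 0"
    "compact K'" "K' \<subseteq> \<Omega>" "\<And>x. x \<notin> K' \<Longrightarrow> g x = 0"
    using assms by (auto simp: test_function_def)
  then have "compact (K \<union> K') \<and> K \<union> K' \<subseteq> \<Omega> \<and> (\<forall>x. x \<notin> K \<union> K' \<longrightarrow> f x + g x = 0)"
    by (auto intro: compact_Un)
  with assms show ?thesis
    unfolding test_function_def by (blast intro: continuously_diff_add)
qed

lemma test_function_mult:
  fixes f g :: "real^3 \<Rightarrow> real"
  shows "test_function \<Omega> f \<Longrightarrow> test_function \<Omega> g \<Longrightarrow> test_function \<Omega> (\<lambda>x. f x * g x)"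
  unfolding test_function_def by (metis continuously_diff_mult mult_zero_left)

section \<open>Computing with classes through their representatives\<close>

lemma l2_eqI: "(AE x in lborel. rep_l2 u x = rep_l2 v x) \<Longrightarrow> u = v"
  by (metis Quotient_rel_abs[OF Quotient_l2] abs_rep_l2 l2_rel_def square_integrable_rep_l2)

lemma abs_l2_cong_AE:
  "square_integrable f \<Longrightarrow> square_integrable g \<Longrightarrow> (AE x in lborel. f x = g x) \<Longrightarrow> abs_l2 f = abs_l2 g"
  by (metis Quotient_rel_abs[OF Quotient_l2] l2_rel_def)

lemma borel_measurable_rep_l2 [measurable]: "rep_l2 u \<in> borel_measurable borel"
  using square_integrable_rep_l2[of u] by (simp add: square_integrable_def)

lemma rep_l2_add: "AE x in lborel. rep_l2 (u + v) x = rep_l2 u x + rep_l2 v x"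
  using rep_abs_l2[OF square_integrable_add[OF square_integrable_rep_l2 square_integrable_rep_l2], of u v]
  by (simp add: plus_l2_def)

lemma rep_l2_scaleR: "AE x in lborel. rep_l2 (c *\<^sub>R u) x = c *\<^sub>R rep_l2 u x"
  using rep_abs_l2[OF square_integrable_scaleR[OF square_integrable_rep_l2], of c u]
  by (simp add: scaleR_l2_def)

lemma rep_l2_zero: "AE x in lborel. rep_l2 0 x = 0"
  using rep_abs_l2[OF square_integrable_zero] by (simp add: zero_l2_def)

lemma rep_l2_diff: "AE x in lborel. rep_l2 (u - v) x = rep_l2 u x - rep_l2 v x"
  using rep_abs_l2[OF square_integrable_diff[OF square_integrable_rep_l2 square_integrable_rep_l2], of u v]
  by (simp add: minus_l2_def)

lemma abs_l2_add:
  "square_integrable f \<Longrightarrow> square_integrable g \<Longrightarrow> abs_l2 (\<lambda>x. f x + g x) = abs_l2 f + abs_l2 g"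
  by (rule l2_eqI)
    (use rep_abs_l2[of f] rep_abs_l2[of g] rep_abs_l2[OF square_integrable_add, of f g]
      rep_l2_add[of "abs_l2 f" "abs_l2 g"] in \<open>auto elim!: AE_mp\<close>)

lemma abs_l2_diff:
  "square_integrable f \<Longrightarrow> square_integrable g \<Longrightarrow> abs_l2 (\<lambda>x. f x - g x) = abs_l2 f - abs_l2 g"
  by (rule l2_eqI)
    (use rep_abs_l2[of f] rep_abs_l2[of g] rep_abs_l2[OF square_integrable_diff, of f g]
      rep_l2_diff[of "abs_l2 f" "abs_l2 g"] in \<open>auto elim!: AE_mp\<close>)

lemma inner_abs_l2:
  assumes "square_integrable g"
  shows "inner u (abs_l2 g) = (LINT x|lborel. inner (rep_l2 u x) (g x))"
  unfolding inner_l2_eq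
  by (intro integral_cong_AE)
    (use rep_abs_l2[OF assms] assms in \<open>auto simp: square_integrable_def elim!: AE_mp\<close>)

lemma norm_abs_l2:
  assumes "square_integrable g"
  shows "(norm (abs_l2 g))\<^sup>2 = (LINT x|lborel. (norm (g x))\<^sup>2)"
  unfolding power2_norm_eq_inner inner_l2_eq
  by (intro integral_cong_AE)
    (use rep_abs_l2[OF assms] assms in \<open>auto simp: square_integrable_def power2_norm_eq_inner elim!: AE_mp\<close>)

lemma norm_l2_eq: "(norm u)\<^sup>2 = (LINT x|lborel. (norm (rep_l2 u x))\<^sup>2)"
  using norm_abs_l2[OF square_integrable_rep_l2, of u] by simp

text \<open>A field vanishing outside \<open>\<Omega>\<close> does not see the restriction of the
  integral. This is how the integrals defining weak derivatives become inner products with classes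
  of test functions.\<close>

lemma set_integral_inner_eq:
  assumes "square_integrable g" "\<And>x. x \<notin> \<Omega> \<Longrightarrow> g x = 0"
  shows "(LINT x:\<Omega>|lborel. inner (rep_l2 u x) (g x)) = inner u (abs_l2 g)"
  unfolding inner_abs_l2[OF assms(1)] set_lebesgue_integral_def
  by (intro Bochner_Integration.integral_cong) (auto simp: indicator_def assms(2))

lemma subspace_L2: "subspace (L2 \<Omega>)"
proof (rule subspaceI)
  show "0 \<in> L2 \<Omega>" using rep_l2_zero by (auto simp: L2_def elim!: AE_mp)
  show "u + v \<in> L2 \<Omega>" if "u \<in> L2 \<Omega>" "v \<in> L2 \<Omega>" for u v :: "'a l2"
    using that rep_l2_add[of u v] unfolding L2_def by (auto elim!: AE_mp)
  show "c *\<^sub>R u \<in> L2 \<Omega>" if "u \<in> L2 \<Omega>" for c and u :: "'a l2"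
    using that rep_l2_scaleR[of c u] unfolding L2_def by (auto elim!: AE_mp)
qed

text \<open>Outside \<open>\<Omega>\<close> the class vanishes by membership in
  \<open>L2 \<Omega>\<close>, inside by the fundamental lemma applied to each coordinate. Uniqueness
  of all three weak derivatives rests on this.\<close>

lemma L2_eq_zeroI:
  fixes w :: "'b::euclidean_space l2"
  assumes "open \<Omega>" "w \<in> L2 \<Omega>"
    and orth: "\<And>b \<phi>. b \<in> Basis \<Longrightarrow> test_function \<Omega> \<phi> \<Longrightarrow> inner w (abs_l2 (\<lambda>x. \<phi> x *\<^sub>R b)) = 0"
  shows "w = 0"
proof -
  have "AE x in lborel. x \<in> \<Omega> \<longrightarrow> inner (rep_l2 w x) b = 0" if b: "b \<in> Basis" for b
  proof (rule AE_zero_on_open[OF assms(1)])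
    have "integrable lborel (\<lambda>x. (norm (rep_l2 w x))\<^sup>2)"
      using square_integrable_rep_l2[of w] by (simp add: square_integrable_def)
    then show "square_integrable (\<lambda>x. inner (rep_l2 w x) b)"
      unfolding square_integrable_def using Basis_le_norm[OF b]
      by (auto intro!: Bochner_Integration.integrable_bound[where g = "\<lambda>x. (inner (rep_l2 w x) b)\<^sup>2"]
          power_mono simp: abs_le_square_iff[symmetric])
    fix \<phi> :: "real^3 \<Rightarrow> real" assume \<phi>: "test_function \<Omega> \<phi>"
    show "(LINT x|lborel. inner (rep_l2 w x) b * \<phi> x) = 0"
      using orth[OF b \<phi>] inner_abs_l2[OF test_function_square_integrable[OF test_function_scaleR_const[OF \<phi>]], of w b]
      by (simp add: mult.commute)
  qed
  then have "AE x in lborel. \<forall>b\<in>Basis. x \<in> \<Omega> \<longrightarrow> inner (rep_l2 w x) b = 0"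
    by (subst AE_finite_all) auto
  moreover have "AE x in lborel. x \<notin> \<Omega> \<longrightarrow> rep_l2 w x = 0" using assms(2) by (simp add: L2_def)
  ultimately have "AE x in lborel. rep_l2 w x = rep_l2 0 x"
    using rep_l2_zero[where 'a = 'b]
  proof eventually_elim
    case (elim x)
    then show ?case using euclidean_all_zero_iff[of "rep_l2 w x"] by (cases "x \<in> \<Omega>") auto
  qed
  then show ?thesis by (rule l2_eqI)
qed

subsection \<open>Weak derivatives\<close>

lemma square_integrable_bounded_linear:
  assumes "bounded_linear L" "square_integrable f"
  shows "square_integrable (\<lambda>x. L (f x))"
proof -
  obtain K where K: "\<And>x. norm (L x) \<le> norm x * K" using bounded_linear.bounded[OF assms(1)] by blast
  have "continuous_on UNIV L" by (simp add: bounded_linear.continuous_on[OF assms(1)])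
  then have L: "L \<in> borel_measurable borel" by (rule borel_measurable_continuous_onI)
  have "f \<in> borel_measurable lborel" using assms(2) by (simp add: square_integrable_def)
  then have m: "(\<lambda>x. L (f x)) \<in> borel_measurable lborel" using L by (rule measurable_compose)
  have i: "integrable lborel (\<lambda>x. K\<^sup>2 * (norm (f x))\<^sup>2)"
    using assms(2) by (simp add: square_integrable_def)
  have "integrable lborel (\<lambda>x. (norm (L (f x)))\<^sup>2)"
  proof (rule Bochner_Integration.integrable_bound[OF i])
    show "AE x in lborel. norm ((norm (L (f x)))\<^sup>2) \<le> norm (K\<^sup>2 * (norm (f x))\<^sup>2)"
      using power_mono[OF K norm_ge_zero, of _ 2]
      by (intro AE_I2) (simp add: power_mult_distrib mult.commute)
  qed (use m in auto)
  with m show ?thesis by (simp add: square_integrable_def)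
qed

lemma square_integrable_sum:
  "(\<And>i. i \<in> I \<Longrightarrow> square_integrable (f i)) \<Longrightarrow> square_integrable (\<lambda>x. \<Sum>i\<in>I. f i x)"
  by (induction I rule: infinite_finite_induct) (auto intro: square_integrable_zero square_integrable_add)

lemma test_function_sum:
  "(\<And>i. i \<in> I \<Longrightarrow> test_function \<Omega> (f i)) \<Longrightarrow> test_function \<Omega> (\<lambda>x. \<Sum>i\<in>I. f i x)"
proof (induction I rule: infinite_finite_induct)
  case (insert i I)
  then show ?case by (simp add: test_function_add)
qed (auto simp: test_function_def continuously_diff_const intro: exI[of _ "{}"])

lemma classical_grad_eq: "classical_grad \<phi> = (\<lambda>x. \<Sum>i\<in>UNIV. partial i \<phi> x *\<^sub>R axis i 1)"
  unfolding classical_grad_def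
  by (auto simp: fun_eq_iff vec_eq_iff axis_def if_distrib cong: if_cong)

lemma test_function_classical_grad: "test_function \<Omega> \<phi> \<Longrightarrow> test_function \<Omega> (classical_grad \<phi>)"
  unfolding classical_grad_eq
  by (intro test_function_sum test_function_scaleR_const test_function_partial)

lemma test_function_classical_curl:
  assumes "test_function \<Omega> \<phi>"
  shows "test_function \<Omega> (classical_curl \<phi>)"
proof -
  have t: "test_function \<Omega> (\<lambda>x. partial i \<phi> x $ j)" for i j
    by (intro test_function_bounded_linear[OF bounded_linear_vec_nth] test_function_partial assms)
  have d: "test_function \<Omega> (\<lambda>x. partial i \<phi> x $ j - partial k \<phi> x $ l)" for i j k l
    using test_function_add[OF t[of i j] test_function_bounded_linear[OF bounded_linear_minus[OF bounded_linear_ident] t[of k l]]]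
    by simp
  have "classical_curl \<phi> = (\<lambda>x. (partial 2 \<phi> x $ 3 - partial 3 \<phi> x $ 2) *\<^sub>R axis 1 1 +
      (partial 3 \<phi> x $ 1 - partial 1 \<phi> x $ 3) *\<^sub>R axis 2 1 +
      (partial 1 \<phi> x $ 2 - partial 2 \<phi> x $ 1) *\<^sub>R axis 3 1)"
    by (auto simp: fun_eq_iff classical_curl_def vec_eq_iff forall_3 axis_def)
  then show ?thesis by (simp add: test_function_add test_function_scaleR_const d)
qed

lemma set_integral_test_function:
  "test_function \<Omega> g \<Longrightarrow> (LINT x:\<Omega>|lborel. inner (rep_l2 u x) (g x)) = inner u (abs_l2 g)"
  by (rule set_integral_inner_eq[OF test_function_square_integrable test_function_outside])

text \<open>In this form, and in the analogous ones for divergence and curl, linearity and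
  uniqueness are inner product algebra without any integrals.\<close>

lemma weak_grad_iff:
  "weak_grad \<Omega> u G \<longleftrightarrow> u \<in> L2 \<Omega> \<and> G \<in> L2 \<Omega> \<and> (\<forall>\<phi>. test_function \<Omega> \<phi> \<longrightarrow> (\<forall>i.
     inner G (abs_l2 (\<lambda>x. \<phi> x *\<^sub>R axis i 1)) = - inner u (abs_l2 (partial i \<phi>))))"
proof -
  have "(LINT x:\<Omega>|lborel. rep_l2 G x $ i * \<phi> x) = inner G (abs_l2 (\<lambda>x. \<phi> x *\<^sub>R axis i 1))"
    "(LINT x:\<Omega>|lborel. rep_l2 u x * partial i \<phi> x) = inner u (abs_l2 (partial i \<phi>))"
    if "test_function \<Omega> \<phi>" for \<phi> i
    using set_integral_test_function[OF test_function_scaleR_const[OF that], of G "axis i 1"]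
      set_integral_test_function[OF test_function_partial[OF that], of u i]
    by (simp_all add: inner_axis mult.commute)
  then show ?thesis unfolding weak_grad_def by auto
qed

lemma weak_div_iff:
  "weak_div \<Omega> u d \<longleftrightarrow> u \<in> L2 \<Omega> \<and> d \<in> L2 \<Omega> \<and> (\<forall>\<phi>. test_function \<Omega> \<phi> \<longrightarrow>
     inner d (abs_l2 \<phi>) = - inner u (abs_l2 (classical_grad \<phi>)))"
proof -
  have "(LINT x:\<Omega>|lborel. rep_l2 d x * \<phi> x) = inner d (abs_l2 \<phi>)"
    "(LINT x:\<Omega>|lborel. inner (rep_l2 u x) (classical_grad \<phi> x)) = inner u (abs_l2 (classical_grad \<phi>))"
    if "test_function \<Omega> \<phi>" for \<phi>
    using set_integral_test_function[OF that, of d]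
      set_integral_test_function[OF test_function_classical_grad[OF that], of u]
    by simp_all
  then show ?thesis unfolding weak_div_def by auto
qed

lemma weak_curl_iff:
  "weak_curl \<Omega> u w \<longleftrightarrow> u \<in> L2 \<Omega> \<and> w \<in> L2 \<Omega> \<and> (\<forall>\<phi>. test_function \<Omega> \<phi> \<longrightarrow>
     inner w (abs_l2 \<phi>) = inner u (abs_l2 (classical_curl \<phi>)))"
proof -
  have "(LINT x:\<Omega>|lborel. inner (rep_l2 w x) (\<phi> x)) = inner w (abs_l2 \<phi>)"
    "(LINT x:\<Omega>|lborel. inner (rep_l2 u x) (classical_curl \<phi> x)) = inner u (abs_l2 (classical_curl \<phi>))"
    if "test_function \<Omega> \<phi>" for \<phi>
    using set_integral_test_function[OF that, of w]
      set_integral_test_function[OF test_function_classical_curl[OF that], of u]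
    by simp_all
  then show ?thesis unfolding weak_curl_def by auto
qed

lemmas L2_add = subspace_add[OF subspace_L2]
  and L2_scaleR = subspace_scale[OF subspace_L2]
  and L2_zero = subspace_0[OF subspace_L2]

lemma weak_grad_linear:
  "weak_grad \<Omega> 0 0"
  "weak_grad \<Omega> u G \<Longrightarrow> weak_grad \<Omega> v H \<Longrightarrow> weak_grad \<Omega> (u + v) (G + H)"
  "weak_grad \<Omega> u G \<Longrightarrow> weak_grad \<Omega> (c *\<^sub>R u) (c *\<^sub>R G)"
  by (auto simp: weak_grad_iff L2_add L2_scaleR L2_zero inner_simps)

lemma weak_div_linear:
  "weak_div \<Omega> 0 0"
  "weak_div \<Omega> u d \<Longrightarrow> weak_div \<Omega> v e \<Longrightarrow> weak_div \<Omega> (u + v) (d + e)"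
  "weak_div \<Omega> u d \<Longrightarrow> weak_div \<Omega> (c *\<^sub>R u) (c *\<^sub>R d)"
  by (auto simp: weak_div_iff L2_add L2_scaleR L2_zero inner_simps)

lemma weak_curl_linear:
  "weak_curl \<Omega> 0 0"
  "weak_curl \<Omega> u w \<Longrightarrow> weak_curl \<Omega> v z \<Longrightarrow> weak_curl \<Omega> (u + v) (w + z)"
  "weak_curl \<Omega> u w \<Longrightarrow> weak_curl \<Omega> (c *\<^sub>R u) (c *\<^sub>R w)"
  by (auto simp: weak_curl_iff L2_add L2_scaleR L2_zero inner_simps)

lemma weak_grad_unique:
  assumes "open \<Omega>" "weak_grad \<Omega> u G" "weak_grad \<Omega> u H"
  shows "G = H"
proof -
  have "G - H = 0"
  proof (rule L2_eq_zeroI[OF assms(1)])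
    fix b :: "real^3" and \<phi> :: "real^3 \<Rightarrow> real" assume b: "b \<in> Basis" and \<phi>: "test_function \<Omega> \<phi>"
    obtain i where "b = axis i 1" using b by (auto simp: Basis_vec_def)
    then show "inner (G - H) (abs_l2 (\<lambda>x. \<phi> x *\<^sub>R b)) = 0"
      using assms(2,3) \<phi> by (simp add: weak_grad_iff inner_diff_left)
  qed (use assms in \<open>auto simp: weak_grad_iff intro: subspace_diff[OF subspace_L2]\<close>)
  then show ?thesis by simp
qed

lemma weak_div_unique:
  assumes "open \<Omega>" "weak_div \<Omega> u d" "weak_div \<Omega> u e"
  shows "d = e"
proof -
  have "d - e = 0"
    using assms by (intro L2_eq_zeroI[OF assms(1)])
      (auto simp: weak_div_iff inner_diff_left intro: subspace_diff[OF subspace_L2])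
  then show ?thesis by simp
qed

lemma weak_curl_unique:
  assumes "open \<Omega>" "weak_curl \<Omega> u w" "weak_curl \<Omega> u z"
  shows "w = z"
proof -
  have "w - z = 0"
    using assms by (intro L2_eq_zeroI[OF assms(1)])
      (auto simp: weak_curl_iff inner_diff_left test_function_scaleR_const intro: subspace_diff[OF subspace_L2])
  then show ?thesis by simp
qed

lemma grad_eqI: "open \<Omega> \<Longrightarrow> weak_grad \<Omega> u G \<Longrightarrow> grad \<Omega> u = G"
  unfolding grad_def by (rule the_equality) (auto intro: weak_grad_unique)

lemma divergence_eqI: "open \<Omega> \<Longrightarrow> weak_div \<Omega> u d \<Longrightarrow> divergence \<Omega> u = d"
  unfolding divergence_def by (rule the_equality) (auto intro: weak_div_unique)

lemma curl_eqI: "open \<Omega> \<Longrightarrow> weak_curl \<Omega> u w \<Longrightarrow> curl \<Omega> u = w"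
  unfolding curl_def by (rule the_equality) (auto intro: weak_curl_unique)

lemma weak_grad_grad: "open \<Omega> \<Longrightarrow> u \<in> H1 \<Omega> \<Longrightarrow> weak_grad \<Omega> u (grad \<Omega> u)"
  by (auto simp: H1_def grad_eqI)

lemma weak_div_divergence: "open \<Omega> \<Longrightarrow> u \<in> H_div \<Omega> \<Longrightarrow> weak_div \<Omega> u (divergence \<Omega> u)"
  by (auto simp: H_div_def divergence_eqI)

lemma weak_curl_curl: "open \<Omega> \<Longrightarrow> u \<in> H_curl \<Omega> \<Longrightarrow> weak_curl \<Omega> u (curl \<Omega> u)"
  by (auto simp: H_curl_def curl_eqI)

lemma lin_on_grad: "open \<Omega> \<Longrightarrow> lin_on (H1 \<Omega>) (grad \<Omega>)"
  by (intro lin_onI grad_eqI weak_grad_linear weak_grad_grad)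

lemma lin_on_divergence: "open \<Omega> \<Longrightarrow> lin_on (H_div \<Omega>) (divergence \<Omega>)"
  by (intro lin_onI divergence_eqI weak_div_linear weak_div_divergence)

lemma lin_on_curl: "open \<Omega> \<Longrightarrow> lin_on (H_curl \<Omega>) (curl \<Omega>)"
  by (intro lin_onI curl_eqI weak_curl_linear weak_curl_curl)

lemma lin_on_subset: "lin_on V f \<Longrightarrow> W \<subseteq> V \<Longrightarrow> lin_on W f"
  unfolding lin_on_def by blast

section \<open>Components, divergence and Jacobian of vector fields\<close>

lemma square_integrable_component: "square_integrable (\<lambda>x. rep_l2 u x $ i)"
  by (rule square_integrable_bounded_linear[OF bounded_linear_vec_nth square_integrable_rep_l2])

lemma borel_measurable_rep_l2_nth [measurable]: "(\<lambda>x. rep_l2 u x $ i) \<in> borel_measurable borel"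
  using square_integrable_component[of u i] by (simp add: square_integrable_def)

lemma rep_l2_component: "AE x in lborel. rep_l2 (component i u) x = rep_l2 u x $ i"
  unfolding component_def by (rule rep_abs_l2[OF square_integrable_component])

lemma component_add: "component i (u + v) = component i u + component i v"
  by (rule l2_eqI)
    (use rep_l2_component[of i u] rep_l2_component[of i v] rep_l2_component[of i "u + v"]
      rep_l2_add[of u v] rep_l2_add[of "component i u" "component i v"] in \<open>auto elim!: AE_mp\<close>)

lemma component_scaleR: "component i (c *\<^sub>R u) = c *\<^sub>R component i u"
  by (rule l2_eqI)
    (use rep_l2_component[of i u] rep_l2_component[of i "c *\<^sub>R u"]
      rep_l2_scaleR[of c u] rep_l2_scaleR[of c "component i u"] in \<open>auto elim!: AE_mp\<close>)

text \<open>Taking the i-th component is adjoint to multiplying a scalar field by the i-th unit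
  vector.\<close>

lemma inner_component:
  assumes "square_integrable g"
  shows "inner (component i u) (abs_l2 g) = inner u (abs_l2 (\<lambda>x. g x *\<^sub>R axis i 1))"
proof -
  have "square_integrable (\<lambda>x. g x *\<^sub>R (axis i 1 :: real^3))"
    by (rule square_integrable_bounded_linear[OF bounded_linear_scaleR_left assms])
  moreover have "(LINT x|lborel. rep_l2 (component i u) x * g x) = (LINT x|lborel. rep_l2 u x $ i * g x)"
    by (intro integral_cong_AE)
      (use rep_l2_component[of i u] assms in \<open>auto simp: square_integrable_def elim!: AE_mp\<close>)
  ultimately show ?thesis
    using assms by (simp add: inner_abs_l2 inner_axis mult.commute)
qed

lemma component_L2: "u \<in> L2 \<Omega> \<Longrightarrow> component i u \<in> L2 \<Omega>"
  using rep_l2_component[of i u] unfolding L2_def by (auto elim!: AE_mp)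

lemma inner_classical_grad:
  assumes \<phi>: "test_function \<Omega> \<phi>"
  shows "inner u (abs_l2 (classical_grad \<phi>)) = (\<Sum>i\<in>UNIV. inner (component i u) (abs_l2 (partial i \<phi>)))"
proof -
  have p: "square_integrable (partial i \<phi>)" for i
    by (rule test_function_square_integrable[OF test_function_partial[OF \<phi>]])
  have "abs_l2 (classical_grad \<phi>) = (\<Sum>i\<in>UNIV. abs_l2 (\<lambda>x. partial i \<phi> x *\<^sub>R axis i 1))"
    unfolding classical_grad_eq sum_3
    by (simp add: abs_l2_add square_integrable_add square_integrable_bounded_linear[OF bounded_linear_scaleR_left p])
  then show ?thesis using p by (simp add: inner_sum_right inner_component)
qed

text \<open>The divergence is the trace of the Jacobian. This places the velocity space inside
  \<open>H_div \<Omega>\<close>, where \<open>divergence \<Omega>\<close> is a proper description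
  and linear.\<close>

lemma H1_vec_weak_div:
  assumes "open \<Omega>" "u \<in> H1_vec \<Omega>"
  shows "weak_div \<Omega> u (\<Sum>i\<in>UNIV. component i (grad \<Omega> (component i u)))"
  unfolding weak_div_iff
proof (intro conjI allI impI)
  have G: "weak_grad \<Omega> (component i u) (grad \<Omega> (component i u))" for i
    using assms by (auto simp: H1_vec_def intro: weak_grad_grad)
  show "u \<in> L2 \<Omega>" using assms by (simp add: H1_vec_def)
  show "(\<Sum>i\<in>UNIV. component i (grad \<Omega> (component i u))) \<in> L2 \<Omega>"
    using G by (intro subspace_sum[OF subspace_L2] component_L2) (auto simp: weak_grad_iff)
  fix \<phi> :: "real^3 \<Rightarrow> real" assume \<phi>: "test_function \<Omega> \<phi>"
  show "inner (\<Sum>i\<in>UNIV. component i (grad \<Omega> (component i u))) (abs_l2 \<phi>) =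
    - inner u (abs_l2 (classical_grad \<phi>))"
    using G \<phi> test_function_square_integrable[OF \<phi>]
    by (simp add: inner_sum_left inner_component inner_classical_grad weak_grad_iff sum_negf)
qed

lemma H1_vec_subset_H_div: "open \<Omega> \<Longrightarrow> H1_vec \<Omega> \<subseteq> H_div \<Omega>"
  using H1_vec_weak_div unfolding H_div_def by blast

lemma square_integrable_vec:
  fixes F :: "3 \<Rightarrow> real^3 \<Rightarrow> 'b::euclidean_space"
  assumes "\<And>i. square_integrable (F i)"
  shows "square_integrable (\<lambda>x. \<chi> i. F i x)"
proof -
  have "linear (axis i :: 'b \<Rightarrow> 'b^3)" for i
    by (intro linearI) (auto simp: vec_eq_iff axis_def)
  then have "square_integrable (\<lambda>x. \<Sum>i\<in>UNIV. (axis i (F i x) :: 'b^3))"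
    using assms by (intro square_integrable_sum square_integrable_bounded_linear[of "axis _"])
      (simp_all only: linear_conv_bounded_linear)
  moreover have "(\<lambda>x. \<Sum>i\<in>UNIV. (axis i (F i x) :: 'b^3)) = (\<lambda>x. \<chi> i. F i x)"
    by (auto simp: fun_eq_iff vec_eq_iff axis_def)
  ultimately show ?thesis by simp
qed

lemma rep_l2_vgrad: "AE x in lborel. rep_l2 (vgrad \<Omega> u) x = (\<chi> i. rep_l2 (grad \<Omega> (component i u)) x)"
  unfolding vgrad_def by (rule rep_abs_l2[OF square_integrable_vec[OF square_integrable_rep_l2]])

lemma lin_on_vgrad:
  assumes "open \<Omega>"
  shows "lin_on (H1_vec \<Omega>) (vgrad \<Omega>)"
proof (rule lin_onI)
  fix u v assume uv: "u \<in> H1_vec \<Omega>" "v \<in> H1_vec \<Omega>"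
  then have "grad \<Omega> (component i (u + v)) = grad \<Omega> (component i u) + grad \<Omega> (component i v)" for i
    using lin_on_add[OF lin_on_grad[OF assms], of "component i u" "component i v"]
    by (simp add: component_add H1_vec_def)
  moreover have "AE x in lborel. \<forall>i. rep_l2 (grad \<Omega> (component i u) + grad \<Omega> (component i v)) x =
      rep_l2 (grad \<Omega> (component i u)) x + rep_l2 (grad \<Omega> (component i v)) x"
    unfolding AE_all_countable by (intro allI rep_l2_add)
  ultimately show "vgrad \<Omega> (u + v) = vgrad \<Omega> u + vgrad \<Omega> v"
    by (intro l2_eqI) (use rep_l2_add[of "vgrad \<Omega> u" "vgrad \<Omega> v"] rep_l2_vgrad[of \<Omega> u]
        rep_l2_vgrad[of \<Omega> v] rep_l2_vgrad[of \<Omega> "u + v"] in \<open>auto simp: vec_eq_iff elim!: AE_mp\<close>)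
next
  fix c u assume u: "u \<in> H1_vec \<Omega>"
  then have "grad \<Omega> (component i (c *\<^sub>R u)) = c *\<^sub>R grad \<Omega> (component i u)" for i
    using lin_on_scaleR[OF lin_on_grad[OF assms], of "component i u" c]
    by (simp add: component_scaleR H1_vec_def)
  moreover have "AE x in lborel. \<forall>i. rep_l2 (c *\<^sub>R grad \<Omega> (component i u)) x =
      c *\<^sub>R rep_l2 (grad \<Omega> (component i u)) x"
    unfolding AE_all_countable by (intro allI rep_l2_scaleR)
  ultimately show "vgrad \<Omega> (c *\<^sub>R u) = c *\<^sub>R vgrad \<Omega> u"
    by (intro l2_eqI) (use rep_l2_scaleR[of c "vgrad \<Omega> u"] rep_l2_vgrad[of \<Omega> u]
        rep_l2_vgrad[of \<Omega> "c *\<^sub>R u"] in \<open>auto simp: vec_eq_iff elim!: AE_mp\<close>)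
qed

lemma vgrad_eq_0D:
  assumes "vgrad \<Omega> u = 0"
  shows "grad \<Omega> (component i u) = 0"
proof (rule l2_eqI)
  show "AE x in lborel. rep_l2 (grad \<Omega> (component i u)) x = rep_l2 0 x"
    using rep_l2_vgrad[of \<Omega> u] rep_l2_zero[where 'a = "real^3"] rep_l2_zero[where 'a = "real^3^3"]
    unfolding assms by eventually_elim (simp add: vec_eq_iff)
qed

subsection \<open>Ladyzhenskaya's inequality\<close>

abbreviation vec3 :: "real \<Rightarrow> real \<Rightarrow> real \<Rightarrow> real^3" where
  "vec3 x y z \<equiv> vector [x, y, z]"

lemma Basis_real_3: "(Basis :: (real^3) set) = {axis 1 1, axis 2 1, axis 3 1}"
  unfolding Basis_vec_def UNIV_3 by auto

lemma vec3_eq: "vec3 x y z = x *\<^sub>R axis 1 1 + y *\<^sub>R axis 2 1 + z *\<^sub>R axis 3 1"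
  by (simp add: vec_eq_iff forall_3 axis_def)

lemma borel_measurable_vec3 [measurable (raw)]:
  assumes "f \<in> borel_measurable M" "g \<in> borel_measurable M" "h \<in> borel_measurable M"
  shows "(\<lambda>w. vec3 (f w) (g w) (h w)) \<in> borel_measurable M"
  unfolding vec3_eq using assms by measurable

text \<open>Lebesgue measure is determined by its values on boxes. The variable \<open>z\<close>
  comes first so that the two inner integrals of \<open>nn_integral_real_3\<close> run over the
  planes of Ladyzhenskaya's argument.\<close>

lemma lborel_real_3: "lborel = distr (lborel \<Otimes>\<^sub>M (lborel \<Otimes>\<^sub>M lborel)) borel (\<lambda>(z, y, x). vec3 x y z)"
proof (rule lborel_eqI)
  fix l u :: "real^3" assume le: "\<And>b. b \<in> Basis \<Longrightarrow> l \<bullet> b \<le> u \<bullet> b"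
  have le': "l $ i \<le> u $ i" for i using le[of "axis i 1"] by (simp add: inner_axis)
  let ?M = "lborel \<Otimes>\<^sub>M (lborel \<Otimes>\<^sub>M lborel) :: (real \<times> real \<times> real) measure"
  have "(\<lambda>(z, y, x). vec3 x y z) -` box l u \<inter> space ?M =
      {l $ 3 <..< u $ 3} \<times> ({l $ 2 <..< u $ 2} \<times> {l $ 1 <..< u $ 1})"
    by (auto simp: mem_box_cart forall_3 space_pair_measure)
  moreover have "emeasure ?M ({l $ 3 <..< u $ 3} \<times> ({l $ 2 <..< u $ 2} \<times> {l $ 1 <..< u $ 1})) =
      ennreal (u $ 3 - l $ 3) * (ennreal (u $ 2 - l $ 2) * ennreal (u $ 1 - l $ 1))"
    using le' by (subst lborel_pair.emeasure_pair_measure_Times lborel.emeasure_pair_measure_Times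
        | simp add: lborel_prod)+
  ultimately have "emeasure (distr ?M borel (\<lambda>(z, y, x). vec3 x y z)) (box l u) =
      ennreal (u $ 3 - l $ 3) * (ennreal (u $ 2 - l $ 2) * ennreal (u $ 1 - l $ 1))"
    by (subst emeasure_distr) auto
  also have "\<dots> = (\<Prod>b\<in>Basis. (u - l) \<bullet> b)"
    using le' by (simp add: Basis_real_3 axis_eq_axis inner_axis inner_diff_left ennreal_mult'' mult_ac)
  finally show "emeasure (distr ?M borel (\<lambda>(z, y, x). vec3 x y z)) (box l u) = (\<Prod>b\<in>Basis. (u - l) \<bullet> b)" .
qed simp

lemma nn_integral_real_3:
  assumes [measurable]: "f \<in> borel_measurable borel"
  shows "(\<integral>\<^sup>+v. f v \<partial>lborel) = (\<integral>\<^sup>+z. \<integral>\<^sup>+y. \<integral>\<^sup>+x. f (vec3 x y z) \<partial>lborel \<partial>lborel \<partial>lborel)"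
proof -
  have "(\<integral>\<^sup>+v. f v \<partial>lborel) = (\<integral>\<^sup>+w. (case w of (z, y, x) \<Rightarrow> f (vec3 x y z)) \<partial>(lborel \<Otimes>\<^sub>M (lborel \<Otimes>\<^sub>M lborel)))"
    by (subst lborel_real_3, subst nn_integral_distr) (auto intro!: nn_integral_cong)
  also have "\<dots> = (\<integral>\<^sup>+z. \<integral>\<^sup>+w. (case w of (y, x) \<Rightarrow> f (vec3 x y z)) \<partial>(lborel \<Otimes>\<^sub>M lborel) \<partial>lborel)"
  proof -
    have "sigma_finite_measure (lborel \<Otimes>\<^sub>M lborel :: (real \<times> real) measure)"
      by (simp add: lborel_prod lborel.sigma_finite_measure_axioms)
    from sigma_finite_measure.nn_integral_fst[OF this,
        of "\<lambda>w. case w of (z, y, x) \<Rightarrow> f (vec3 x y z)" lborel]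
    show ?thesis by simp
  qed
  also have "\<dots> = (\<integral>\<^sup>+z. \<integral>\<^sup>+y. \<integral>\<^sup>+x. f (vec3 x y z) \<partial>lborel \<partial>lborel \<partial>lborel)"
    by (intro nn_integral_cong, subst lborel.nn_integral_fst[symmetric]) auto
  finally show ?thesis .
qed

text \<open>The fundamental theorem of calculus for the square of \<open>\<psi>\<close>, starting
  from the zero \<open>a\<close>. The integral is enlarged to the whole line so that the bound no
  longer depends on \<open>t\<close>.\<close>

lemma power2_le_nn_integral:
  fixes \<psi> \<psi>' :: "real \<Rightarrow> real"
  assumes D: "\<And>t. (\<psi> has_real_derivative \<psi>' t) (at t)" and c: "continuous_on UNIV \<psi>'"
    and z: "a \<le> t" "\<psi> a = 0"
  shows "(ennreal \<bar>\<psi> t\<bar>)\<^sup>2 \<le> 2 * (\<integral>\<^sup>+s. ennreal \<bar>\<psi> s\<bar> * ennreal \<bar>\<psi>' s\<bar> \<partial>lborel)"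
proof -
  let ?f = "\<lambda>s. 2 * (\<psi> s * \<psi>' s)"
  have "isCont \<psi> s" "isCont \<psi>' s" for s
    using D c by (auto intro: DERIV_isCont simp: continuous_on_eq_continuous_at)
  then have fc: "isCont ?f s" for s by (intro continuous_intros)
  have "((\<lambda>t. (\<psi> t)\<^sup>2) has_real_derivative ?f s) (at s)" for s
    using D[of s] by (auto intro!: derivative_eq_intros)
  from has_bochner_integral_FTC_Icc_real[OF z(1) this fc]
  have I: "integrable lborel (\<lambda>s. ?f s * indicator {a..t} s)"
    "(\<integral>s. ?f s * indicator {a..t} s \<partial>lborel) = (\<psi> t)\<^sup>2"
    using z(2) by (auto simp: has_bochner_integral_iff)
  have "(ennreal \<bar>\<psi> t\<bar>)\<^sup>2 = ennreal (norm (\<integral>s. ?f s * indicator {a..t} s \<partial>lborel))"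
    by (simp add: I(2) ennreal_power)
  also have "\<dots> \<le> (\<integral>\<^sup>+s. norm (?f s * indicator {a..t} s) \<partial>lborel)"
    by (rule integral_norm_bound_ennreal[OF I(1)])
  also have "\<dots> \<le> (\<integral>\<^sup>+s. 2 * (ennreal \<bar>\<psi> s\<bar> * ennreal \<bar>\<psi>' s\<bar>) \<partial>lborel)"
  proof (rule nn_integral_mono)
    fix s
    have "norm (?f s * indicator {a..t} s) \<le> 2 * (\<bar>\<psi> s\<bar> * \<bar>\<psi>' s\<bar>)"
      by (simp add: indicator_def abs_mult)
    then have "ennreal (norm (?f s * indicator {a..t} s)) \<le> ennreal (2 * (\<bar>\<psi> s\<bar> * \<bar>\<psi>' s\<bar>))"
      by (rule ennreal_leI)
    then show "ennreal (norm (?f s * indicator {a..t} s)) \<le> 2 * (ennreal \<bar>\<psi> s\<bar> * ennreal \<bar>\<psi>' s\<bar>)"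
      by (simp add: ennreal_mult)
  qed
  also have "\<dots> = 2 * (\<integral>\<^sup>+s. ennreal \<bar>\<psi> s\<bar> * ennreal \<bar>\<psi>' s\<bar> \<partial>lborel)"
  proof (rule nn_integral_cmult)
    have "\<psi> \<in> borel_measurable borel" "\<psi>' \<in> borel_measurable borel"
      using c D by (auto intro!: borel_measurable_continuous_onI continuous_at_imp_continuous_on DERIV_isCont)
    then show "(\<lambda>s. ennreal \<bar>\<psi> s\<bar> * ennreal \<bar>\<psi>' s\<bar>) \<in> borel_measurable lborel" by measurable
  qed
  finally show ?thesis .
qed

lemma Cauchy_Schwarz_nn_integral_2:
  fixes f g :: "real \<Rightarrow> real \<Rightarrow> ennreal"
  assumes [measurable]: "case_prod f \<in> borel_measurable (lborel \<Otimes>\<^sub>M lborel)"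
    "case_prod g \<in> borel_measurable (lborel \<Otimes>\<^sub>M lborel)"
  shows "(\<integral>\<^sup>+y. \<integral>\<^sup>+x. f y x * g y x \<partial>lborel \<partial>lborel)\<^sup>2 \<le>
    (\<integral>\<^sup>+y. \<integral>\<^sup>+x. (f y x)\<^sup>2 \<partial>lborel \<partial>lborel) * (\<integral>\<^sup>+y. \<integral>\<^sup>+x. (g y x)\<^sup>2 \<partial>lborel \<partial>lborel)"
proof -
  have it: "(\<integral>\<^sup>+y. \<integral>\<^sup>+x. h y x \<partial>lborel \<partial>lborel) = integral\<^sup>N (lborel \<Otimes>\<^sub>M lborel) (case_prod h)"
    if "case_prod h \<in> borel_measurable (lborel \<Otimes>\<^sub>M lborel)" for h :: "real \<Rightarrow> real \<Rightarrow> ennreal"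
    using lborel.nn_integral_fst[OF that] by simp
  show ?thesis
    using Cauchy_Schwarz_nn_integral[OF assms]
    by (simp add: it[of "\<lambda>y x. f y x * g y x"] it[of "\<lambda>y x. (f y x)\<^sup>2"] it[of "\<lambda>y x. (g y x)\<^sup>2"] split_def)
qed

text \<open>Yields measurability of a curried function at any three measurable arguments, hence of
  sections and of permuted variables.\<close>

lemma measurable_uncurry3:
  fixes h :: "real \<Rightarrow> real \<Rightarrow> real \<Rightarrow> ennreal"
  assumes "(\<lambda>(x, y, z). h x y z) \<in> borel_measurable (borel \<Otimes>\<^sub>M (borel \<Otimes>\<^sub>M borel))"
    and "a \<in> borel_measurable M" "b \<in> borel_measurable M" "c \<in> borel_measurable M"
  shows "(\<lambda>w. h (a w) (b w) (c w)) \<in> borel_measurable M"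
  using measurable_compose[OF measurable_Pair[OF assms(2) measurable_Pair[OF assms(3,4)]] assms(1)]
  by simp

text \<open>Ladyzhenskaya's argument: in each plane \<open>z = const\<close> one factor \<open>f\<^sup>2\<close> is bounded by a function
  of \<open>y\<close> and the other by a function of \<open>x\<close>, while the plane integrals of \<open>f\<^sup>2\<close> are bounded
  uniformly in \<open>z\<close>.\<close>

lemma Ladyzhenskaya_ennreal:
  fixes f d1 d2 d3 :: "real \<Rightarrow> real \<Rightarrow> real \<Rightarrow> ennreal"
  assumes m[measurable]:
    "(\<lambda>(x, y, z). f x y z) \<in> borel_measurable (borel \<Otimes>\<^sub>M (borel \<Otimes>\<^sub>M borel))"
    "(\<lambda>(x, y, z). d1 x y z) \<in> borel_measurable (borel \<Otimes>\<^sub>M (borel \<Otimes>\<^sub>M borel))"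
    "(\<lambda>(x, y, z). d2 x y z) \<in> borel_measurable (borel \<Otimes>\<^sub>M (borel \<Otimes>\<^sub>M borel))"
    "(\<lambda>(x, y, z). d3 x y z) \<in> borel_measurable (borel \<Otimes>\<^sub>M (borel \<Otimes>\<^sub>M borel))"
    and b1: "\<And>x y z. (f x y z)\<^sup>2 \<le> 2 * (\<integral>\<^sup>+s. f s y z * d1 s y z \<partial>lborel)"
    and b2: "\<And>x y z. (f x y z)\<^sup>2 \<le> 2 * (\<integral>\<^sup>+s. f x s z * d2 x s z \<partial>lborel)"
    and b3: "\<And>x y z. (f x y z)\<^sup>2 \<le> 2 * (\<integral>\<^sup>+s. f x y s * d3 x y s \<partial>lborel)"
  shows "(\<integral>\<^sup>+z. \<integral>\<^sup>+y. \<integral>\<^sup>+x. 2 * (f x y z)^4 \<partial>lborel \<partial>lborel \<partial>lborel) \<le>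
    8 * (\<integral>\<^sup>+z. \<integral>\<^sup>+y. \<integral>\<^sup>+x. f x y z * d3 x y z \<partial>lborel \<partial>lborel \<partial>lborel) *
    (\<integral>\<^sup>+z. \<integral>\<^sup>+y. \<integral>\<^sup>+x. (d1 x y z)\<^sup>2 + (d2 x y z)\<^sup>2 \<partial>lborel \<partial>lborel \<partial>lborel)"
proof -
  note [measurable (raw)] = m[THEN measurable_uncurry3]
  define I where "I h z = (\<integral>\<^sup>+y. \<integral>\<^sup>+x. h x y z \<partial>lborel \<partial>lborel)"
    for h :: "real \<Rightarrow> real \<Rightarrow> real \<Rightarrow> ennreal" and z
  define G1 where "G1 = I (\<lambda>x y z. f x y z * d1 x y z)"
  define G2 where "G2 = I (\<lambda>x y z. f x y z * d2 x y z)"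
  define A where "A = I (\<lambda>x y z. (f x y z)\<^sup>2)"
  define B1 where "B1 = I (\<lambda>x y z. (d1 x y z)\<^sup>2)"
  define B2 where "B2 = I (\<lambda>x y z. (d2 x y z)\<^sup>2)"
  define K where "K = (\<integral>\<^sup>+z. I (\<lambda>x y z. f x y z * d3 x y z) z \<partial>lborel)"
  \<comment> \<open>The right-hand side of \<open>b3\<close> does not depend on \<open>z\<close>, so
    integrating it over \<open>x\<close> and \<open>y\<close> gives one constant for all
    planes.\<close>
  have A: "A z \<le> 2 * K" for z
  proof -
    have "A z \<le> (\<integral>\<^sup>+y. \<integral>\<^sup>+x. 2 * (\<integral>\<^sup>+s. f x y s * d3 x y s \<partial>lborel) \<partial>lborel \<partial>lborel)"
      unfolding A_def I_def by (intro nn_integral_mono b3)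
    also have "\<dots> = 2 * (\<integral>\<^sup>+y. \<integral>\<^sup>+x. \<integral>\<^sup>+s. f x y s * d3 x y s \<partial>lborel \<partial>lborel \<partial>lborel)"
      by (simp add: nn_integral_cmult)
    also have "(\<integral>\<^sup>+y. \<integral>\<^sup>+x. \<integral>\<^sup>+s. f x y s * d3 x y s \<partial>lborel \<partial>lborel \<partial>lborel) =
        (\<integral>\<^sup>+y. \<integral>\<^sup>+s. \<integral>\<^sup>+x. f x y s * d3 x y s \<partial>lborel \<partial>lborel \<partial>lborel)"
      by (intro nn_integral_cong lborel_pair.Fubini') measurable
    also have "\<dots> = K"
      unfolding K_def I_def by (rule lborel_pair.Fubini') measurable
    finally show ?thesis .
  qed
  have slice: "I (\<lambda>x y z. 2 * (f x y z)^4) z \<le> 8 * K * (B1 z + B2 z)" for z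
  proof -
    have "I (\<lambda>x y z. 2 * (f x y z)^4) z \<le> (\<integral>\<^sup>+y. \<integral>\<^sup>+x. 2 *
        ((2 * (\<integral>\<^sup>+s. f s y z * d1 s y z \<partial>lborel)) * (2 * (\<integral>\<^sup>+s. f x s z * d2 x s z \<partial>lborel))) \<partial>lborel \<partial>lborel)"
      unfolding I_def
    proof (intro nn_integral_mono mult_left_mono)
      fix x y
      have "(f x y z)^4 = (f x y z)\<^sup>2 * (f x y z)\<^sup>2" by (simp flip: power_add)
      also have "\<dots> \<le> (2 * (\<integral>\<^sup>+s. f s y z * d1 s y z \<partial>lborel)) * (2 * (\<integral>\<^sup>+s. f x s z * d2 x s z \<partial>lborel))"
        by (intro mult_mono b1 b2) auto
      finally show "(f x y z)^4 \<le> \<dots>" .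
    qed simp
    also have "\<dots> = 8 * (G1 z * (\<integral>\<^sup>+x. \<integral>\<^sup>+s. f x s z * d2 x s z \<partial>lborel \<partial>lborel))"
      unfolding G1_def I_def by (simp add: nn_integral_cmult nn_integral_multc mult_ac)
    also have "(\<integral>\<^sup>+x. \<integral>\<^sup>+s. f x s z * d2 x s z \<partial>lborel \<partial>lborel) = G2 z"
      unfolding G2_def I_def by (rule lborel_pair.Fubini') measurable
    \<comment> \<open>The factor 2 carried in front of the fourth power completes the double
      product, which saves a division in \<open>ennreal\<close>. Cauchy-Schwarz then bounds the
      square of \<open>G1 z\<close> by \<open>A z * B1 z\<close>, and likewise for
      \<open>G2 z\<close>.\<close>
    also have "8 * (G1 z * G2 z) = 4 * (2 * G1 z * G2 z)" by (simp add: mult_ac)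
    also have "\<dots> \<le> 4 * ((G1 z)\<^sup>2 + (G2 z)\<^sup>2)"
      by (intro mult_left_mono sum_of_squares_ge_ennreal) simp
    also have "\<dots> \<le> 4 * (A z * B1 z + A z * B2 z)"
      unfolding G1_def G2_def A_def B1_def B2_def I_def
      by (intro mult_left_mono add_mono Cauchy_Schwarz_nn_integral_2) auto
    also have "\<dots> \<le> 4 * (2 * K * B1 z + 2 * K * B2 z)"
      by (intro mult_left_mono add_mono mult_right_mono A) auto
    also have "\<dots> = 8 * K * (B1 z + B2 z)" by (simp add: algebra_simps)
    finally show ?thesis .
  qed
  have "(\<integral>\<^sup>+z. I (\<lambda>x y z. 2 * (f x y z)^4) z \<partial>lborel) \<le> (\<integral>\<^sup>+z. 8 * K * (B1 z + B2 z) \<partial>lborel)"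
    by (intro nn_integral_mono slice)
  also have "\<dots> = 8 * K * (\<integral>\<^sup>+z. B1 z + B2 z \<partial>lborel)"
    unfolding B1_def B2_def I_def by (rule nn_integral_cmult) measurable
  also have "(\<integral>\<^sup>+z. B1 z + B2 z \<partial>lborel) = (\<integral>\<^sup>+z. I (\<lambda>x y z. (d1 x y z)\<^sup>2 + (d2 x y z)\<^sup>2) z \<partial>lborel)"
    unfolding B1_def B2_def I_def by (simp add: nn_integral_add)
  finally show ?thesis by (simp add: I_def K_def)
qed

lemma test_function_line:
  fixes \<phi> :: "real^3 \<Rightarrow> real"
  assumes \<phi>: "test_function \<Omega> \<phi>"
  shows "(ennreal \<bar>\<phi> (c + t *\<^sub>R axis i 1)\<bar>)\<^sup>2 \<le>
    2 * (\<integral>\<^sup>+s. ennreal \<bar>\<phi> (c + s *\<^sub>R axis i 1)\<bar> * ennreal \<bar>partial i \<phi> (c + s *\<^sub>R axis i 1)\<bar> \<partial>lborel)"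
proof -
  obtain K where K: "compact K" "\<And>x. x \<notin> K \<Longrightarrow> \<phi> x = 0"
    using \<phi> by (auto simp: test_function_def)
  obtain R where R: "\<And>x. x \<in> K \<Longrightarrow> norm x \<le> R"
    using compact_imp_bounded[OF K(1)] by (auto simp: bounded_iff)
  \<comment> \<open>A parameter larger in modulus than \<open>\<bar>R\<bar> + norm c\<close> leaves
    the ball around the support; the minimum puts this zero of \<open>\<phi>\<close> to the left of
    \<open>t\<close>.\<close>
  define a where "a = min t (- (\<bar>R\<bar> + 1 + norm c))"
  have "\<bar>a\<bar> \<ge> \<bar>R\<bar> + 1 + norm c" using norm_ge_zero[of c] unfolding a_def by linarith
  moreover have "\<bar>a\<bar> \<le> norm (c + a *\<^sub>R axis i 1) + norm c"
    using norm_triangle_ineq4[of "c + a *\<^sub>R axis i 1" c] by simp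
  ultimately have "c + a *\<^sub>R axis i 1 \<notin> K" using R[of "c + a *\<^sub>R axis i 1"] by linarith
  then have a: "a \<le> t" "\<phi> (c + a *\<^sub>R axis i 1) = 0" using K by (auto simp: a_def)
  have D: "((\<lambda>s. \<phi> (c + s *\<^sub>R axis i 1)) has_real_derivative partial i \<phi> (c + s *\<^sub>R axis i 1)) (at s)" for s
  proof -
    obtain D where D: "(\<phi> has_derivative D) (at (c + s *\<^sub>R axis i 1))"
      "partial i \<phi> (c + s *\<^sub>R axis i 1) = D (axis i 1)"
      using has_derivative_partial[OF test_function_differentiable[OF \<phi>]] by blast
    have "((\<lambda>s. c + s *\<^sub>R axis i 1) has_derivative (\<lambda>h. h *\<^sub>R axis i 1)) (at s)"
      by (auto intro!: derivative_eq_intros)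
    from has_derivative_compose[OF this D(1)] show ?thesis
      using linear_scale[OF has_derivative_linear[OF D(1)]]
      by (simp add: has_field_derivative_def D(2) mult_commute_abs)
  qed
  have "continuous_on UNIV (\<lambda>s. partial i \<phi> (c + s *\<^sub>R axis i 1))"
    by (rule continuous_on_compose2[OF test_function_continuous[OF test_function_partial[OF \<phi>]]])
      (auto intro!: continuous_intros)
  from power2_le_nn_integral[OF D this a] show ?thesis .
qed

text \<open>The classical right-hand side is a multiple of ||phi|| ||grad phi||^3; here the product
  of \<open>\<phi>\<close> and its third derivative is bounded more crudely by
  \<open>n0 + n1\<close>. What matters later is a continuous bound in the two norms that vanishes
  with \<open>n1\<close>.\<close>

lemma Ladyzhenskaya:
  fixes \<phi> :: "real^3 \<Rightarrow> real"
  assumes \<phi>: "test_function \<Omega> \<phi>"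
  defines "n0 \<equiv> (norm (abs_l2 \<phi>))\<^sup>2" and "n1 \<equiv> (norm (abs_l2 (classical_grad \<phi>)))\<^sup>2"
  shows "(\<integral>\<^sup>+x. ennreal ((\<phi> x)^4) \<partial>lborel) \<le> ennreal (4 * (n0 + n1) * n1)"
proof -
  have c: "continuous_on UNIV \<phi>" "continuous_on UNIV (partial i \<phi>)" for i
    using test_function_continuous test_function_partial \<phi> by blast+
  have [measurable]: "\<phi> \<in> borel_measurable borel" "partial i \<phi> \<in> borel_measurable borel" for i
    using c by (auto intro: borel_measurable_continuous_onI)
  have si: "square_integrable \<phi>" "square_integrable (classical_grad \<phi>)"
    using \<phi> test_function_square_integrable test_function_classical_grad by blast+
  then have i: "integrable lborel (\<lambda>x. (\<phi> x)\<^sup>2)" "integrable lborel (\<lambda>x. (norm (classical_grad \<phi> x))\<^sup>2)"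
    by (auto simp: square_integrable_def)
  have N: "(norm (classical_grad \<phi> x))\<^sup>2 = (partial 1 \<phi> x)\<^sup>2 + (partial 2 \<phi> x)\<^sup>2 + (partial 3 \<phi> x)\<^sup>2" for x
    unfolding power2_norm_eq_inner inner_vec_def sum_3 classical_grad_def by (simp add: power2_eq_square)
  have n0: "(\<integral>\<^sup>+x. ennreal ((\<phi> x)\<^sup>2) \<partial>lborel) = ennreal n0"
    unfolding n0_def norm_abs_l2[OF si(1)] using i(1) by (simp add: nn_integral_eq_integral)
  have n1: "(\<integral>\<^sup>+x. ennreal ((norm (classical_grad \<phi> x))\<^sup>2) \<partial>lborel) = ennreal n1"
    unfolding n1_def norm_abs_l2[OF si(2)] using i(2) by (simp add: nn_integral_eq_integral)
  let ?P = "\<lambda>i x. ennreal \<bar>partial i \<phi> x\<bar>" and ?F = "\<lambda>x. ennreal \<bar>\<phi> x\<bar>"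
  have line: "vec3 x y z = (vec3 0 y z) + x *\<^sub>R axis 1 1" "vec3 x y z = (vec3 x 0 z) + y *\<^sub>R axis 2 1"
    "vec3 x y z = (vec3 x y 0) + z *\<^sub>R axis 3 1" for x y z
    by (simp_all add: vec3_eq)
  have "(\<integral>\<^sup>+z. \<integral>\<^sup>+y. \<integral>\<^sup>+x. 2 * (?F (vec3 x y z))^4 \<partial>lborel \<partial>lborel \<partial>lborel) \<le>
    8 * (\<integral>\<^sup>+z. \<integral>\<^sup>+y. \<integral>\<^sup>+x. ?F (vec3 x y z) * ?P 3 (vec3 x y z) \<partial>lborel \<partial>lborel \<partial>lborel) *
    (\<integral>\<^sup>+z. \<integral>\<^sup>+y. \<integral>\<^sup>+x. (?P 1 (vec3 x y z))\<^sup>2 + (?P 2 (vec3 x y z))\<^sup>2 \<partial>lborel \<partial>lborel \<partial>lborel)"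
  proof (rule Ladyzhenskaya_ennreal)
    show "(?F (vec3 x y z))\<^sup>2 \<le> 2 * (\<integral>\<^sup>+s. ?F (vec3 s y z) * ?P 1 (vec3 s y z) \<partial>lborel)" for x y z
      using test_function_line[OF \<phi>, of "vec3 0 y z" x 1] unfolding line(1)[symmetric] .
    show "(?F (vec3 x y z))\<^sup>2 \<le> 2 * (\<integral>\<^sup>+s. ?F (vec3 x s z) * ?P 2 (vec3 x s z) \<partial>lborel)" for x y z
      using test_function_line[OF \<phi>, of "vec3 x 0 z" y 2] unfolding line(2)[symmetric] .
    show "(?F (vec3 x y z))\<^sup>2 \<le> 2 * (\<integral>\<^sup>+s. ?F (vec3 x y s) * ?P 3 (vec3 x y s) \<partial>lborel)" for x y z
      using test_function_line[OF \<phi>, of "vec3 x y 0" z 3] unfolding line(3)[symmetric] .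
  qed measurable
  then have main: "(\<integral>\<^sup>+x. 2 * (?F x)^4 \<partial>lborel) \<le>
      8 * (\<integral>\<^sup>+x. ?F x * ?P 3 x \<partial>lborel) * (\<integral>\<^sup>+x. (?P 1 x)\<^sup>2 + (?P 2 x)\<^sup>2 \<partial>lborel)"
    by (simp add: nn_integral_real_3)
  have "(\<integral>\<^sup>+x. ?F x * ?P 3 x \<partial>lborel) \<le> (\<integral>\<^sup>+x. ennreal ((\<phi> x)\<^sup>2) + ennreal ((norm (classical_grad \<phi> x))\<^sup>2) \<partial>lborel)"
  proof (rule nn_integral_mono)
    fix x
    have "\<bar>\<phi> x\<bar> * \<bar>partial 3 \<phi> x\<bar> \<le> (\<phi> x)\<^sup>2 + (partial 3 \<phi> x)\<^sup>2"
      using sum_squares_bound[of "\<bar>\<phi> x\<bar>" "\<bar>partial 3 \<phi> x\<bar>"] mult_nonneg_nonneg[OF abs_ge_zero abs_ge_zero, of "\<phi> x" "partial 3 \<phi> x"]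
      unfolding power2_abs by linarith
    also have "\<dots> \<le> (\<phi> x)\<^sup>2 + (norm (classical_grad \<phi> x))\<^sup>2" by (simp add: N)
    finally have "ennreal (\<bar>\<phi> x\<bar> * \<bar>partial 3 \<phi> x\<bar>) \<le> ennreal ((\<phi> x)\<^sup>2 + (norm (classical_grad \<phi> x))\<^sup>2)"
      by (rule ennreal_leI)
    then show "?F x * ?P 3 x \<le> ennreal ((\<phi> x)\<^sup>2) + ennreal ((norm (classical_grad \<phi> x))\<^sup>2)"
      by (simp add: ennreal_mult)
  qed
  also have "\<dots> = ennreal (n0 + n1)"
    using si(2) by (subst nn_integral_add)
      (auto simp: n0 n1 square_integrable_def n0_def n1_def)
  finally have b1: "(\<integral>\<^sup>+x. ?F x * ?P 3 x \<partial>lborel) \<le> ennreal (n0 + n1)" .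
  have "(\<integral>\<^sup>+x. (?P 1 x)\<^sup>2 + (?P 2 x)\<^sup>2 \<partial>lborel) \<le> (\<integral>\<^sup>+x. ennreal ((norm (classical_grad \<phi> x))\<^sup>2) \<partial>lborel)"
    by (intro nn_integral_mono) (auto simp: N ennreal_power simp flip: ennreal_plus intro!: ennreal_leI)
  then have b2: "(\<integral>\<^sup>+x. (?P 1 x)\<^sup>2 + (?P 2 x)\<^sup>2 \<partial>lborel) \<le> ennreal n1" by (simp only: n1)
  have "(\<integral>\<^sup>+x. 2 * (?F x)^4 \<partial>lborel) \<le> 8 * ennreal (n0 + n1) * ennreal n1"
    by (rule order_trans[OF main]) (intro mult_mono mult_left_mono b1 b2; simp)
  moreover have "(\<integral>\<^sup>+x. 2 * (?F x)^4 \<partial>lborel) = 2 * (\<integral>\<^sup>+x. ennreal ((\<phi> x)^4) \<partial>lborel)"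
    by (subst nn_integral_cmult) (auto simp: ennreal_power power_even_abs)
  moreover have "8 * ennreal (n0 + n1) * ennreal n1 = 2 * ennreal (4 * (n0 + n1) * n1)"
  proof -
    have *: "8 * ennreal a * ennreal b = 2 * ennreal (4 * a * b)" if "a \<ge> 0" "b \<ge> 0" for a b
      using that by (simp add: ennreal_mult flip: mult.assoc)
    show ?thesis unfolding n0_def n1_def by (rule *) simp_all
  qed
  ultimately have "2 * (\<integral>\<^sup>+x. ennreal ((\<phi> x)^4) \<partial>lborel) \<le> 2 * ennreal (4 * (n0 + n1) * n1)"
    by simp
  then show ?thesis by (subst (asm) ennreal_mult_le_mult_iff) auto
qed

subsection \<open>Products of functions in \<open>L\<^sup>4\<close>\<close>

text \<open>As a set of classes of square-integrable functions, this is the intersection of L^2 and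
  L^4.\<close>

definition L4 :: "real l2 set" where
  "L4 = {s. integrable lborel (\<lambda>x. (rep_l2 s x)^4)}"

text \<open>The fourth power of the L^4 norm, meaningful only on \<open>L4\<close>.\<close>

definition l4_power :: "real l2 \<Rightarrow> real" where
  "l4_power s = (LINT x|lborel. (rep_l2 s x)^4)"

definition l2_mult :: "real l2 \<Rightarrow> real l2 \<Rightarrow> real l2" where
  "l2_mult s t = abs_l2 (\<lambda>x. rep_l2 s x * rep_l2 t x)"

lemma power4_add_le: "(a + b)^4 \<le> 8 * (a^4 + b^4)" for a b :: real
proof -
  have "(a + b)\<^sup>2 \<le> 2 * (a\<^sup>2 + b\<^sup>2)" using sum_squares_bound[of a b] by (simp add: power2_sum)
  then have "((a + b)\<^sup>2)\<^sup>2 \<le> (2 * (a\<^sup>2 + b\<^sup>2))\<^sup>2" by (rule power_mono) simp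
  moreover have "(a\<^sup>2 + b\<^sup>2)\<^sup>2 \<le> 2 * ((a\<^sup>2)\<^sup>2 + (b\<^sup>2)\<^sup>2)"
    using sum_squares_bound[of "a\<^sup>2" "b\<^sup>2"] by (simp add: power2_sum)
  moreover have "(2 * (a\<^sup>2 + b\<^sup>2))\<^sup>2 = 4 * (a\<^sup>2 + b\<^sup>2)\<^sup>2"
    by (rule trans[OF power_mult_distrib]) simp
  ultimately have "((a + b)\<^sup>2)\<^sup>2 \<le> 8 * ((a\<^sup>2)\<^sup>2 + (b\<^sup>2)\<^sup>2)" by linarith
  then show ?thesis by (simp flip: power_mult)
qed

lemma L4_cong_AE:
  assumes "AE x in lborel. rep_l2 s x = f x" "f \<in> borel_measurable borel"
  shows "s \<in> L4 \<longleftrightarrow> integrable lborel (\<lambda>x. (f x)^4)"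
  unfolding L4_def mem_Collect_eq
  by (rule integrable_cong_AE) (use assms in \<open>auto elim!: AE_mp\<close>)

lemma subspace_L4: "subspace L4"
proof (rule subspaceI)
  show "0 \<in> L4" using L4_cong_AE[OF rep_l2_zero] by simp
next
  fix s t assume st: "s \<in> L4" "t \<in> L4"
  have "integrable lborel (\<lambda>x. 8 * ((rep_l2 s x)^4 + (rep_l2 t x)^4))"
    using st by (auto simp: L4_def)
  then have "integrable lborel (\<lambda>x. (rep_l2 s x + rep_l2 t x)^4)"
  proof (rule Bochner_Integration.integrable_bound)
    show "AE x in lborel. norm ((rep_l2 s x + rep_l2 t x)^4) \<le> norm (8 * ((rep_l2 s x)^4 + (rep_l2 t x)^4))"
    proof (rule AE_I2)
      fix x
      show "norm ((rep_l2 s x + rep_l2 t x)^4) \<le> norm (8 * ((rep_l2 s x)^4 + (rep_l2 t x)^4))"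
        using power4_add_le[of "rep_l2 s x" "rep_l2 t x"] by simp
    qed
  qed auto
  then show "s + t \<in> L4" using L4_cong_AE[OF rep_l2_add] by simp
next
  fix c s assume "s \<in> L4"
  then show "c *\<^sub>R s \<in> L4"
    using L4_cong_AE[OF rep_l2_scaleR, of c s] by (auto simp: L4_def power_mult_distrib)
qed

lemma square_integrable_mult:
  assumes "s \<in> L4" "t \<in> L4"
  shows "square_integrable (\<lambda>x. rep_l2 s x * rep_l2 t x)"
proof -
  have "integrable lborel (\<lambda>x. (rep_l2 s x)^4 + (rep_l2 t x)^4)"
    using assms by (auto simp: L4_def)
  then have "integrable lborel (\<lambda>x. (rep_l2 s x * rep_l2 t x)\<^sup>2)"
  proof (rule Bochner_Integration.integrable_bound)
    have "(a * b)\<^sup>2 \<le> a^4 + b^4" for a b :: real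
    proof -
      have "2 * a\<^sup>2 * b\<^sup>2 \<le> (a\<^sup>2)\<^sup>2 + (b\<^sup>2)\<^sup>2" by (rule sum_squares_bound)
      moreover have "0 \<le> a\<^sup>2 * b\<^sup>2" by simp
      ultimately have "a\<^sup>2 * b\<^sup>2 \<le> (a\<^sup>2)\<^sup>2 + (b\<^sup>2)\<^sup>2" by linarith
      then show ?thesis by (simp add: power_mult_distrib flip: power_mult)
    qed
    then show "AE x in lborel. norm ((rep_l2 s x * rep_l2 t x)\<^sup>2) \<le> norm ((rep_l2 s x)^4 + (rep_l2 t x)^4)"
      by (intro AE_I2) auto
  qed auto
  then show ?thesis by (simp add: square_integrable_def)
qed

lemma rep_l2_mult:
  "s \<in> L4 \<Longrightarrow> t \<in> L4 \<Longrightarrow> AE x in lborel. rep_l2 (l2_mult s t) x = rep_l2 s x * rep_l2 t x"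
  unfolding l2_mult_def by (rule rep_abs_l2[OF square_integrable_mult])

lemma l2_mult_add_right:
  assumes "s \<in> L4" "t \<in> L4" "t' \<in> L4"
  shows "l2_mult s (t + t') = l2_mult s t + l2_mult s t'"
  by (rule l2_eqI)
    (use rep_l2_mult[OF assms(1,2)] rep_l2_mult[OF assms(1,3)] rep_l2_add[of t t']
      rep_l2_mult[OF assms(1) subspace_add[OF subspace_L4 assms(2,3)]]
      rep_l2_add[of "l2_mult s t" "l2_mult s t'"] in \<open>auto simp: distrib_left elim!: AE_mp\<close>)

lemma l2_mult_scaleR_right:
  assumes "s \<in> L4" "t \<in> L4"
  shows "l2_mult s (c *\<^sub>R t) = c *\<^sub>R l2_mult s t"
  by (rule l2_eqI)
    (use rep_l2_mult[OF assms] rep_l2_scaleR[of c t]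
      rep_l2_mult[OF assms(1) subspace_scale[OF subspace_L4 assms(2), of c]]
      rep_l2_scaleR[of c "l2_mult s t"] in \<open>auto elim!: AE_mp\<close>)

lemma lin_on_l2_mult: "s \<in> L4 \<Longrightarrow> lin_on L4 (l2_mult s)"
  by (intro lin_onI l2_mult_add_right l2_mult_scaleR_right)

lemma l4_power_nonneg: "0 \<le> l4_power s"
  by (simp add: l4_power_def)

lemma nn_integral_l4_power:
  "s \<in> L4 \<Longrightarrow> (\<integral>\<^sup>+x. ennreal ((rep_l2 s x)^4) \<partial>lborel) = ennreal (l4_power s)"
  unfolding l4_power_def L4_def by (intro nn_integral_eq_integral) auto

text \<open>Cauchy-Schwarz for the squares of the two factors; the fourth power avoids roots. It
  makes multiplication by an element of \<open>L4\<close> continuous from L^4 to L^2.\<close>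

lemma norm_l2_mult_le:
  assumes s: "s \<in> L4" and t: "t \<in> L4"
  shows "(norm (l2_mult s t))^4 \<le> l4_power s * l4_power t"
proof -
  let ?I = "\<integral>\<^sup>+x. ennreal ((rep_l2 s x)\<^sup>2) * ennreal ((rep_l2 t x)\<^sup>2) \<partial>lborel"
  have "ennreal ((norm (l2_mult s t))\<^sup>2) = (\<integral>\<^sup>+x. ennreal ((rep_l2 s x * rep_l2 t x)\<^sup>2) \<partial>lborel)"
    using square_integrable_mult[OF s t] unfolding l2_mult_def norm_abs_l2[OF square_integrable_mult[OF s t]]
    by (subst nn_integral_eq_integral) (auto simp: square_integrable_def)
  also have "\<dots> = ?I" by (simp add: power_mult_distrib ennreal_mult)
  finally have I: "ennreal ((norm (l2_mult s t))\<^sup>2) = ?I" .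
  have "(?I)\<^sup>2 \<le> (\<integral>\<^sup>+x. (ennreal ((rep_l2 s x)\<^sup>2))\<^sup>2 \<partial>lborel) * (\<integral>\<^sup>+x. (ennreal ((rep_l2 t x)\<^sup>2))\<^sup>2 \<partial>lborel)"
    by (rule Cauchy_Schwarz_nn_integral) auto
  also have "\<dots> = ennreal (l4_power s) * ennreal (l4_power t)"
    by (simp add: nn_integral_l4_power[OF s, symmetric] nn_integral_l4_power[OF t, symmetric]
        ennreal_power flip: power_mult)
  finally have "ennreal (((norm (l2_mult s t))\<^sup>2)\<^sup>2) \<le> ennreal (l4_power s * l4_power t)"
    by (simp add: I[symmetric] ennreal_power ennreal_mult l4_power_nonneg)
  then show ?thesis
    by (simp add: l4_power_nonneg flip: power_mult)
qed

text \<open>The square of a test function is again a test function, hence square-integrable.\<close>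

lemma test_function_L4:
  assumes "test_function \<Omega> \<phi>"
  shows "abs_l2 \<phi> \<in> L4"
proof -
  have "square_integrable (\<lambda>x. \<phi> x * \<phi> x)"
    by (rule test_function_square_integrable[OF test_function_mult[OF assms assms]])
  then have "integrable lborel (\<lambda>x. (\<phi> x)^4)"
    by (simp add: square_integrable_def power2_eq_square power4_eq_xxxx mult.assoc)
  moreover have "\<phi> \<in> borel_measurable borel"
    using test_function_square_integrable[OF assms] by (simp add: square_integrable_def)
  ultimately show ?thesis
    using L4_cong_AE[OF rep_abs_l2[OF test_function_square_integrable[OF assms]]] by blast
qed

text \<open>L^2 convergence gives convergence almost everywhere along a subsequence; that is enough
  for Fatou's lemma, and the right-hand sides of Ladyzhenskaya's inequality converge along
  it.\<close>

lemma l4_power_limit_le: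
  assumes \<phi>: "\<And>n::nat. test_function \<Omega> (\<phi> n)"
    and u: "(\<lambda>n. abs_l2 (\<phi> n)) \<longlonglongrightarrow> u" and G: "(\<lambda>n. abs_l2 (classical_grad (\<phi> n))) \<longlonglongrightarrow> G"
  shows "u \<in> L4" "l4_power u \<le> 4 * ((norm u)\<^sup>2 + (norm G)\<^sup>2) * (norm G)\<^sup>2"
proof -
  let ?c = "\<lambda>a b. 4 * ((norm a)\<^sup>2 + (norm b)\<^sup>2) * (norm b)\<^sup>2"
  have si: "square_integrable (\<phi> n)" for n by (rule test_function_square_integrable[OF \<phi>])
  then have [measurable]: "\<phi> n \<in> borel_measurable borel" for n by (simp add: square_integrable_def)
  have sd: "square_integrable (\<lambda>x. \<phi> n x - rep_l2 u x)" for n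
    by (intro square_integrable_diff si square_integrable_rep_l2)
  have "(norm (abs_l2 (\<phi> n) - u))\<^sup>2 = (LINT x|lborel. norm ((\<phi> n x - rep_l2 u x)\<^sup>2))" for n
    using norm_abs_l2[OF sd[of n]] abs_l2_diff[OF si square_integrable_rep_l2, of n u] by simp
  moreover have "(\<lambda>n. (norm (abs_l2 (\<phi> n) - u))\<^sup>2) \<longlonglongrightarrow> 0"
    using tendsto_power[OF tendsto_norm_zero[OF LIM_zero[OF u]], of 2] by simp
  ultimately have "(\<lambda>n. LINT x|lborel. norm ((\<phi> n x - rep_l2 u x)\<^sup>2)) \<longlonglongrightarrow> 0" by simp
  with sd obtain r where r: "strict_mono r"
    "AE x in lborel. (\<lambda>n. (\<phi> (r n) x - rep_l2 u x)\<^sup>2) \<longlonglongrightarrow> 0"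
    using tendsto_L1_AE_subseq[of lborel "\<lambda>n x. (\<phi> n x - rep_l2 u x)\<^sup>2"]
    by (auto simp: square_integrable_def)
  have "AE x in lborel. ennreal ((rep_l2 u x)^4) = liminf (\<lambda>n. ennreal ((\<phi> (r n) x)^4))"
    using r(2)
  proof eventually_elim
    case (elim x)
    then have "(\<lambda>n. sqrt ((\<phi> (r n) x - rep_l2 u x)\<^sup>2)) \<longlonglongrightarrow> sqrt 0" by (rule tendsto_real_sqrt)
    then have "(\<lambda>n. \<phi> (r n) x - rep_l2 u x) \<longlonglongrightarrow> 0" by (simp add: tendsto_rabs_zero_iff)
    then have "(\<lambda>n. \<phi> (r n) x) \<longlonglongrightarrow> rep_l2 u x" by (rule LIM_zero_cancel)
    then have "(\<lambda>n. ennreal ((\<phi> (r n) x)^4)) \<longlonglongrightarrow> ennreal ((rep_l2 u x)^4)"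
      by (intro tendsto_intros)
    then show ?case by (intro lim_imp_Liminf[symmetric]) simp
  qed
  then have "(\<integral>\<^sup>+x. ennreal ((rep_l2 u x)^4) \<partial>lborel) = (\<integral>\<^sup>+x. liminf (\<lambda>n. ennreal ((\<phi> (r n) x)^4)) \<partial>lborel)"
    by (rule nn_integral_cong_AE)
  also have "\<dots> \<le> liminf (\<lambda>n. \<integral>\<^sup>+x. ennreal ((\<phi> (r n) x)^4) \<partial>lborel)"
    by (rule nn_integral_liminf) measurable
  also have "\<dots> \<le> liminf (\<lambda>n. ennreal (?c (abs_l2 (\<phi> (r n))) (abs_l2 (classical_grad (\<phi> (r n))))))"
    by (intro Liminf_mono always_eventually allI Ladyzhenskaya[OF \<phi>])
  also have "\<dots> = ennreal (?c u G)"
    using LIMSEQ_subseq_LIMSEQ[OF u r(1)] LIMSEQ_subseq_LIMSEQ[OF G r(1)]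
    by (intro lim_imp_Liminf tendsto_intros) (auto simp: o_def)
  finally have le: "(\<integral>\<^sup>+x. ennreal ((rep_l2 u x)^4) \<partial>lborel) \<le> ennreal (?c u G)" .
  show L4: "u \<in> L4"
    unfolding L4_def mem_Collect_eq
    by (rule integrableI_bounded) (use le in \<open>auto simp: le_less_trans\<close>)
  show "l4_power u \<le> ?c u G"
    using le unfolding nn_integral_l4_power[OF L4] by (subst (asm) ennreal_le_iff) auto
qed

lemma classical_grad_diff:
  assumes "test_function \<Omega> \<phi>" "test_function \<Omega> \<psi>"
  shows "test_function \<Omega> (\<lambda>x. \<phi> x - \<psi> x)"
    "classical_grad (\<lambda>x. \<phi> x - \<psi> x) = (\<lambda>x. classical_grad \<phi> x - classical_grad \<psi> x)"
proof -
  have m: "test_function \<Omega> (\<lambda>x. - \<psi> x)"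
    by (rule test_function_bounded_linear[OF bounded_linear_minus[OF bounded_linear_ident] assms(2)])
  then show "test_function \<Omega> (\<lambda>x. \<phi> x - \<psi> x)"
    using test_function_add[OF assms(1) m] by simp
  have "partial i (\<lambda>x. \<phi> x - \<psi> x) x = partial i \<phi> x - partial i \<psi> x" for i x
    using partial_add[OF test_function_differentiable[OF assms(1)] test_function_differentiable[OF m], of i x]
      partial_bounded_linear[OF bounded_linear_minus[OF bounded_linear_ident] test_function_differentiable[OF assms(2)], of i x]
    by simp
  then show "classical_grad (\<lambda>x. \<phi> x - \<psi> x) = (\<lambda>x. classical_grad \<phi> x - classical_grad \<psi> x)"
    by (simp add: fun_eq_iff classical_grad_def vec_eq_iff)
qed

text \<open>Fatou's lemma alone only bounds the limit. Strong convergence follows by applying that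
  bound to the differences of \<open>\<phi> n\<close> and \<open>\<phi> m\<close>, with
  \<open>n\<close> fixed and \<open>m\<close> tending to infinity.\<close>

lemma l4_power_diff_tendsto_0:
  assumes \<phi>: "\<And>n::nat. test_function \<Omega> (\<phi> n)"
    and u: "(\<lambda>n. abs_l2 (\<phi> n)) \<longlonglongrightarrow> u" and G: "(\<lambda>n. abs_l2 (classical_grad (\<phi> n))) \<longlonglongrightarrow> G"
  shows "(\<lambda>n. l4_power (abs_l2 (\<phi> n) - u)) \<longlonglongrightarrow> 0"
proof (rule tendsto_sandwich[OF _ _ tendsto_const])
  let ?c = "\<lambda>a b. 4 * ((norm a)\<^sup>2 + (norm b)\<^sup>2) * (norm b)\<^sup>2"
  let ?b = "\<lambda>n. ?c (abs_l2 (\<phi> n) - u) (abs_l2 (classical_grad (\<phi> n)) - G)"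
  have si: "square_integrable (\<phi> n)" "square_integrable (classical_grad (\<phi> n))" for n
    using test_function_square_integrable test_function_classical_grad \<phi> by blast+
  have "l4_power (abs_l2 (\<phi> n) - u) \<le> ?b n" for n
  proof (rule l4_power_limit_le(2))
    show "test_function \<Omega> (\<lambda>x. \<phi> n x - \<phi> m x)" for m by (rule classical_grad_diff[OF \<phi> \<phi>])
    show "(\<lambda>m. abs_l2 (\<lambda>x. \<phi> n x - \<phi> m x)) \<longlonglongrightarrow> abs_l2 (\<phi> n) - u"
      unfolding abs_l2_diff[OF si(1) si(1)] by (intro tendsto_intros u)
    show "(\<lambda>m. abs_l2 (classical_grad (\<lambda>x. \<phi> n x - \<phi> m x))) \<longlonglongrightarrow> abs_l2 (classical_grad (\<phi> n)) - G"
      unfolding classical_grad_diff(2)[OF \<phi> \<phi>] abs_l2_diff[OF si(2) si(2)] by (intro tendsto_intros G)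
  qed
  then show "\<forall>\<^sub>F n in sequentially. l4_power (abs_l2 (\<phi> n) - u) \<le> ?b n" by simp
  have "?b \<longlonglongrightarrow> ?c (u - u) (G - G)" by (intro tendsto_intros u G)
  then show "?b \<longlonglongrightarrow> 0" by simp
qed (simp add: l4_power_nonneg)

lemma H1_0_subset_L4: "H1_0 \<Omega> \<subseteq> L4"
  unfolding H1_0_def using l4_power_limit_le(1) by blast

text \<open>The bound in \<open>l4_power_limit_le\<close> contains the gradient norm as a factor, so
  the fourth-power integral vanishes.\<close>

lemma H1_0_eq_zeroI:
  assumes "u \<in> H1_0 \<Omega>" "grad \<Omega> u = 0"
  shows "u = 0"
proof -
  obtain \<phi> :: "nat \<Rightarrow> real^3 \<Rightarrow> real" where "\<And>n. test_function \<Omega> (\<phi> n)"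
    "(\<lambda>n. abs_l2 (\<phi> n)) \<longlonglongrightarrow> u" "(\<lambda>n. abs_l2 (classical_grad (\<phi> n))) \<longlonglongrightarrow> 0"
    using assms by (auto simp: H1_0_def)
  from l4_power_limit_le[OF this] have u: "u \<in> L4" "l4_power u \<le> 0" by simp_all
  then have "l4_power u = 0" using l4_power_nonneg[of u] by simp
  then have "AE x in lborel. (rep_l2 u x)^4 = 0"
    using u(1) unfolding l4_power_def L4_def by (subst (asm) integral_nonneg_eq_0_iff_AE) auto
  then have "AE x in lborel. rep_l2 u x = rep_l2 0 x"
    using rep_l2_zero[where 'a = real] by eventually_elim simp
  then show ?thesis by (rule l2_eqI)
qed

subsection \<open>The convection and triple product forms\<close>

lemma borel_measurable_vec_nth [measurable (raw)]:
  fixes f :: "'a \<Rightarrow> ('b::euclidean_space)^'n"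
  assumes "f \<in> borel_measurable M"
  shows "(\<lambda>x. f x $ i) \<in> borel_measurable M"
proof -
  have "(\<lambda>v::'b^'n. v $ i) \<in> borel_measurable borel"
    by (intro borel_measurable_continuous_onI continuous_intros)
  from measurable_compose[OF assms this] show ?thesis .
qed

lemma component_abs_l2:
  assumes "square_integrable f"
  shows "component i (abs_l2 f) = abs_l2 (\<lambda>x. f x $ i)"
  unfolding component_def
  by (intro abs_l2_cong_AE square_integrable_component square_integrable_bounded_linear[OF bounded_linear_vec_nth assms])
    (use rep_abs_l2[OF assms] in \<open>auto elim!: AE_mp\<close>)

lemma norm_component_le: "norm (component i u) \<le> norm u"
proof -
  have i: "integrable lborel (\<lambda>x. (norm (rep_l2 u x $ i))\<^sup>2)" "integrable lborel (\<lambda>x. (norm (rep_l2 u x))\<^sup>2)"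
    using square_integrable_component[of u i] square_integrable_rep_l2[of u]
    unfolding square_integrable_def by blast+
  have "(norm (component i u))\<^sup>2 = (LINT x|lborel. (norm (rep_l2 u x $ i))\<^sup>2)"
    unfolding component_def by (rule norm_abs_l2[OF square_integrable_component])
  also have "\<dots> \<le> (LINT x|lborel. (norm (rep_l2 u x))\<^sup>2)"
    by (intro integral_mono i power_mono norm_ge_zero Finite_Cartesian_Product.norm_nth_le)
  also have "\<dots> = (norm u)\<^sup>2" by (simp add: norm_l2_eq)
  finally show ?thesis by (rule power2_le_imp_le) simp
qed

lemma tendsto_component:
  assumes "(f \<longlongrightarrow> u) F"
  shows "((\<lambda>n. component i (f n)) \<longlongrightarrow> component i u) F"
proof -
  have "bounded_linear (component i)"
    using norm_component_le by (intro bounded_linear_intro[where K = 1])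
      (auto simp: component_add component_scaleR)
  from bounded_linear.tendsto[OF this assms] show ?thesis .
qed

lemma l2_mult_tendsto:
  assumes w: "w \<in> L4" and f: "\<And>n. f n \<in> L4" and s: "s \<in> L4"
    and lim: "(\<lambda>n::nat. l4_power (f n - s)) \<longlonglongrightarrow> 0"
  shows "(\<lambda>n. l2_mult w (f n)) \<longlonglongrightarrow> l2_mult w s"
proof -
  have "(\<lambda>n. (norm (l2_mult w (f n) - l2_mult w s))^4) \<longlonglongrightarrow> 0"
  proof (rule tendsto_sandwich[OF _ _ tendsto_const])
    have "(norm (l2_mult w (f n) - l2_mult w s))^4 \<le> l4_power w * l4_power (f n - s)" for n
      using norm_l2_mult_le[OF w subspace_diff[OF subspace_L4 f s], of n]
      by (simp add: lin_on_diff[OF lin_on_l2_mult[OF w] subspace_L4 f s])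
    then show "\<forall>\<^sub>F n in sequentially. (norm (l2_mult w (f n) - l2_mult w s))^4 \<le> l4_power w * l4_power (f n - s)"
      by simp
    show "(\<lambda>n. l4_power w * l4_power (f n - s)) \<longlonglongrightarrow> 0"
      using tendsto_mult[OF tendsto_const lim, of "l4_power w"] by simp
  qed simp
  from tendsto_real_root[OF this, of 4]
  have "(\<lambda>n. norm (l2_mult w (f n) - l2_mult w s)) \<longlonglongrightarrow> 0"
    by (simp add: real_root_power_cancel)
  then show ?thesis by (simp add: tendsto_norm_zero_iff LIM_zero_iff)
qed

text \<open>Test \<open>div w = 0\<close> with \<open>\<phi>\<^sup>2\<close> for test functions \<open>\<phi>\<close> approximating \<open>s\<close>.\<close>

lemma solenoidal_transport_eq_0:
  assumes w: "weak_div \<Omega> w 0" "\<And>j. component j w \<in> L4" and s: "s \<in> H1_0 \<Omega>"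
  shows "(\<Sum>j\<in>UNIV. inner (component j (grad \<Omega> s)) (l2_mult (component j w) s)) = 0"
proof -
  obtain \<phi> :: "nat \<Rightarrow> real^3 \<Rightarrow> real" where \<phi>: "\<And>n. test_function \<Omega> (\<phi> n)"
    and l: "(\<lambda>n. abs_l2 (\<phi> n)) \<longlonglongrightarrow> s" "(\<lambda>n. abs_l2 (classical_grad (\<phi> n))) \<longlonglongrightarrow> grad \<Omega> s"
    using s by (auto simp: H1_0_def)
  let ?F = "\<lambda>n. abs_l2 (\<phi> n)"
  let ?S = "\<lambda>n. \<Sum>j\<in>UNIV. inner (component j (abs_l2 (classical_grad (\<phi> n)))) (l2_mult (component j w) (?F n))"
  have "s \<in> L4" using s H1_0_subset_L4 by blast
  \<comment> \<open>Strong L^4 convergence of the test functions makes their products with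
    \<open>component j w\<close> converge in L^2, so the inner products with the converging
    gradients pass to the limit.\<close>
  then have "?S \<longlonglongrightarrow> (\<Sum>j\<in>UNIV. inner (component j (grad \<Omega> s)) (l2_mult (component j w) s))"
    by (intro tendsto_sum tendsto_inner tendsto_component l l2_mult_tendsto w(2)
        test_function_L4[OF \<phi>] l4_power_diff_tendsto_0[OF \<phi> l])
  moreover have "?S n = 0" for n
  proof -
    note t = \<phi>[of n]
    have si: "square_integrable (\<phi> n)" "square_integrable (classical_grad (\<phi> n))"
      "square_integrable (partial j (\<phi> n))" for j
      using test_function_square_integrable test_function_classical_grad test_function_partial t by blast+
    then have [measurable]: "\<phi> n \<in> borel_measurable borel" "partial j (\<phi> n) \<in> borel_measurable borel" for j
      by (auto simp: square_integrable_def)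
    have p: "partial j (\<lambda>x. \<phi> n x * \<phi> n x) = (\<lambda>x. \<phi> n x * partial j (\<phi> n) x + partial j (\<phi> n) x * \<phi> n x)" for j
      by (rule ext) (rule partial_mult[OF test_function_differentiable[OF t] test_function_differentiable[OF t]])
    \<comment> \<open>By the product rule the derivative of the square is twice the product, hence
      the division by 2. Summed over \<open>j\<close> this is half the pairing of \<open>w\<close>
      with the gradient of a test function, to which the weak divergence of \<open>w\<close>
      applies.\<close>
    have "inner (component j (abs_l2 (classical_grad (\<phi> n)))) (l2_mult (component j w) (?F n)) =
        inner (component j w) (abs_l2 (partial j (\<lambda>x. \<phi> n x * \<phi> n x))) / 2" for j
    proof -
      have "component j (abs_l2 (classical_grad (\<phi> n))) = abs_l2 (partial j (\<phi> n))"
        unfolding component_abs_l2[OF si(2)] by (simp add: classical_grad_def)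
      then have "inner (component j (abs_l2 (classical_grad (\<phi> n)))) (l2_mult (component j w) (?F n)) =
          (LINT x|lborel. rep_l2 (l2_mult (component j w) (?F n)) x * partial j (\<phi> n) x)"
        using inner_abs_l2[OF si(3)[of j], of "l2_mult (component j w) (?F n)"] by (simp add: inner_commute)
      also have "\<dots> = (LINT x|lborel. rep_l2 (component j w) x * (partial j (\<lambda>x. \<phi> n x * \<phi> n x) x) / 2)"
        by (intro integral_cong_AE)
          (use rep_l2_mult[OF w(2)[of j] test_function_L4[OF t]] rep_abs_l2[OF si(1)] in
            \<open>auto simp: p mult_ac elim!: AE_mp\<close>)
      also have "\<dots> = inner (component j w) (abs_l2 (partial j (\<lambda>x. \<phi> n x * \<phi> n x))) / 2"
        using inner_abs_l2[OF test_function_square_integrable[OF test_function_partial[OF test_function_mult[OF t t]]], of "component j w" j]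
        by simp
      finally show ?thesis .
    qed
    then have "?S n = inner w (abs_l2 (classical_grad (\<lambda>x. \<phi> n x * \<phi> n x))) / 2"
      by (simp only: inner_classical_grad[OF test_function_mult[OF t t]] sum_divide_distrib)
    also have "\<dots> = 0" using w(1) test_function_mult[OF t t] by (simp add: weak_div_iff)
    finally show ?thesis .
  qed
  ultimately show ?thesis by (simp add: LIMSEQ_const_iff)
qed

lemma H1_0_vecD:
  assumes "u \<in> H1_0_vec \<Omega>"
  shows "u \<in> L2 \<Omega>" "component i u \<in> H1_0 \<Omega>" "component i u \<in> L4" "u \<in> H1_vec \<Omega>"
proof -
  show u: "u \<in> L2 \<Omega>" "component i u \<in> H1_0 \<Omega>" for i using assms by (auto simp: H1_0_vec_def)
  then show "component i u \<in> L4" for i using H1_0_subset_L4 by blast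
  show "u \<in> H1_vec \<Omega>" using u by (simp add: H1_vec_def H1_0_def)
qed

text \<open>The derivative of \<open>u\<close> is paired with the product of the components of
  \<open>w\<close> and \<open>v\<close>, which is in L^2 for factors in L^4. Bilinearity is then
  inherited from inner products; the restriction to \<open>\<Omega>\<close> disappears because
  \<open>v\<close> vanishes outside.\<close>

lemma convection_eq:
  assumes w: "\<And>j. component j w \<in> L4" and v: "v \<in> L2 \<Omega>" "\<And>i. component i v \<in> L4"
    and \<Omega>: "open \<Omega>"
  shows "convection \<Omega> w u v = (\<Sum>i\<in>UNIV. \<Sum>j\<in>UNIV.
    inner (component j (grad \<Omega> (component i u))) (l2_mult (component j w) (component i v)))"
proof -
  let ?g = "\<lambda>i j. component j (grad \<Omega> (component i u))" and ?p = "\<lambda>i j. l2_mult (component j w) (component i v)"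
  have [measurable]: "\<Omega> \<in> sets borel" using \<Omega> by simp
  have "convection \<Omega> w u v =
      (LINT x|lborel. indicator \<Omega> x * (\<Sum>i\<in>UNIV. \<Sum>j\<in>UNIV. rep_l2 (vgrad \<Omega> u) x $ i $ j * rep_l2 w x $ j * rep_l2 v x $ i))"
    unfolding convection_def set_lebesgue_integral_def
    by (simp add: inner_vec_def matrix_vector_mult_def sum_distrib_right)
  also have "\<dots> = (LINT x|lborel. (\<Sum>i\<in>UNIV. \<Sum>j\<in>UNIV. inner (rep_l2 (?g i j) x) (rep_l2 (?p i j) x)))"
  proof (rule integral_cong_AE)
    have "AE x in lborel. \<forall>i j. rep_l2 (?g i j) x = rep_l2 (grad \<Omega> (component i u)) x $ j"
      unfolding AE_all_countable by (intro allI rep_l2_component)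
    moreover have "AE x in lborel. \<forall>i j. rep_l2 (?p i j) x = rep_l2 (component j w) x * rep_l2 (component i v) x"
      unfolding AE_all_countable by (intro allI rep_l2_mult w v)
    moreover have "AE x in lborel. \<forall>i. rep_l2 (component i v) x = rep_l2 v x $ i"
      unfolding AE_all_countable by (intro allI rep_l2_component)
    moreover have "AE x in lborel. \<forall>i. rep_l2 (component i w) x = rep_l2 w x $ i"
      unfolding AE_all_countable by (intro allI rep_l2_component)
    moreover have "AE x in lborel. x \<notin> \<Omega> \<longrightarrow> rep_l2 v x = 0" using v(1) by (simp add: L2_def)
    ultimately show "AE x in lborel. indicator \<Omega> x * (\<Sum>i\<in>UNIV. \<Sum>j\<in>UNIV. rep_l2 (vgrad \<Omega> u) x $ i $ j * rep_l2 w x $ j * rep_l2 v x $ i)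
        = (\<Sum>i\<in>UNIV. \<Sum>j\<in>UNIV. inner (rep_l2 (?g i j) x) (rep_l2 (?p i j) x))"
      using rep_l2_vgrad[of \<Omega> u]
    proof eventually_elim
      case (elim x)
      then show ?case by (cases "x \<in> \<Omega>") (simp_all add: mult.assoc)
    qed
  qed measurable
  also have "\<dots> = (\<Sum>i\<in>UNIV. \<Sum>j\<in>UNIV. inner (?g i j) (?p i j))"
    by (simp add: inner_l2_eq integrable_inner_square_integrable[OF square_integrable_rep_l2 square_integrable_rep_l2, where 'a = real, simplified])
  finally show ?thesis .
qed

lemma convection_linear:
  assumes \<Omega>: "open \<Omega>" and w: "w \<in> H1_0_vec \<Omega>"
  shows "v \<in> H1_0_vec \<Omega> \<Longrightarrow> lin_on (H1_0_vec \<Omega>) (\<lambda>u. convection \<Omega> w u v)"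
    and "lin_on (H1_0_vec \<Omega>) (convection \<Omega> w u)"
proof -
  note eq = convection_eq[OF H1_0_vecD(3)[OF w] _ _ \<Omega>]
  have g: "component i u \<in> H1 \<Omega>" if "u \<in> H1_0_vec \<Omega>" for i u
    using H1_0_vecD(2)[OF that] by (simp add: H1_0_def)
  show "lin_on (H1_0_vec \<Omega>) (\<lambda>u. convection \<Omega> w u v)" if v: "v \<in> H1_0_vec \<Omega>"
    by (rule lin_onI)
      (simp_all add: eq[OF H1_0_vecD(1,3)[OF v]] component_add component_scaleR g
        lin_on_add[OF lin_on_grad[OF \<Omega>]] lin_on_scaleR[OF lin_on_grad[OF \<Omega>]]
        inner_add_left sum.distrib sum_distrib_left)
  have c: "convection \<Omega> w u v = (\<Sum>i\<in>UNIV. \<Sum>j\<in>UNIV.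
      inner (component j (grad \<Omega> (component i u))) (l2_mult (component j w) (component i v)))"
    if "v \<in> L2 \<Omega>" "\<forall>i. component i v \<in> L4" for v
    using that by (intro eq) auto
  note L4w = H1_0_vecD(3)[OF w] and L4a = subspace_add[OF subspace_L4] subspace_scale[OF subspace_L4]
  show "lin_on (H1_0_vec \<Omega>) (convection \<Omega> w u)"
    by (rule lin_onI)
      (simp_all add: c H1_0_vecD L2_add L2_scaleR component_add component_scaleR L4a L4w
        l2_mult_add_right l2_mult_scaleR_right inner_add_right sum.distrib sum_distrib_left)
qed

text \<open>For each fixed \<open>i\<close> the sum over \<open>j\<close> in
  \<open>convection_eq\<close> is the transport of the scalar field
  \<open>component i u\<close>.\<close>

lemma convection_self_eq_0:
  assumes \<Omega>: "open \<Omega>" and w: "w \<in> H1_0_vec \<Omega>" "divergence \<Omega> w = 0" and u: "u \<in> H1_0_vec \<Omega>"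
  shows "convection \<Omega> w u u = 0"
proof -
  have "weak_div \<Omega> w 0"
    using weak_div_divergence[OF \<Omega>, of w] H1_vec_subset_H_div[OF \<Omega>] H1_0_vecD(4)[OF w(1)] w(2) by auto
  then show ?thesis
    unfolding convection_eq[OF H1_0_vecD(3)[OF w(1)] H1_0_vecD(1,3)[OF u] \<Omega>]
    by (intro sum.neutral ballI solenoidal_transport_eq_0 H1_0_vecD(3)[OF w(1)] H1_0_vecD(2)[OF u])
qed

lemma H1_0_vec_eq_zeroI:
  assumes "u \<in> H1_0_vec \<Omega>" "vgrad \<Omega> u = 0"
  shows "u = 0"
proof (rule l2_eqI)
  have "component i u = 0" for i
    by (rule H1_0_eq_zeroI[OF H1_0_vecD(2)[OF assms(1)] vgrad_eq_0D[OF assms(2)]])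
  then have "AE x in lborel. \<forall>i. rep_l2 0 x = rep_l2 u x $ i"
    unfolding AE_all_countable using rep_l2_component[of _ u] by simp
  then show "AE x in lborel. rep_l2 u x = rep_l2 0 x"
    using rep_l2_zero[where 'a = real] rep_l2_zero[where 'a = "real^3"]
    by eventually_elim (simp add: vec_eq_iff)
qed

text \<open>The field u x B, with \<open>B\<close> as first argument so that
  \<open>l2_cross B\<close> is an operator acting on \<open>u\<close>.\<close>

definition l2_cross :: "(real^3) l2 \<Rightarrow> (real^3) l2 \<Rightarrow> (real^3) l2" where
  "l2_cross B u = abs_l2 (\<lambda>x. cross3 (rep_l2 u x) (rep_l2 B x))"

lemma borel_measurable_cross3 [measurable (raw)]:
  assumes "f \<in> borel_measurable M" "g \<in> borel_measurable M"
  shows "(\<lambda>x. cross3 (f x) (g x)) \<in> borel_measurable M"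
  unfolding cross3_def using assms by measurable

lemma norm_cross3_le: "norm (cross3 x y) \<le> norm x * norm y"
proof (rule power2_le_imp_le)
  show "(norm (cross3 x y))\<^sup>2 \<le> (norm x * norm y)\<^sup>2"
    using norm_cross_dot[of x y] by (metis le_add_same_cancel1 zero_le_power2)
qed simp

text \<open>One factor, in the application a discrete curl or a velocity, is just in L^2;
  boundedness of the other keeps the product in L^2.\<close>

lemma square_integrable_cross3:
  assumes "essentially_bounded B"
  shows "square_integrable (\<lambda>x. cross3 (rep_l2 u x) (rep_l2 B x))"
proof -
  obtain M where M: "AE x in lborel. norm (rep_l2 B x) \<le> M"
    using assms by (auto simp: essentially_bounded_def)
  have i: "integrable lborel (\<lambda>x. M\<^sup>2 * (norm (rep_l2 u x))\<^sup>2)"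
    using square_integrable_rep_l2[of u] by (simp add: square_integrable_def)
  have "integrable lborel (\<lambda>x. (norm (cross3 (rep_l2 u x) (rep_l2 B x)))\<^sup>2)"
  proof (rule Bochner_Integration.integrable_bound[OF i])
    show "AE x in lborel. norm ((norm (cross3 (rep_l2 u x) (rep_l2 B x)))\<^sup>2) \<le> norm (M\<^sup>2 * (norm (rep_l2 u x))\<^sup>2)"
      using M
    proof eventually_elim
      case (elim x)
      have "norm (cross3 (rep_l2 u x) (rep_l2 B x)) \<le> norm (rep_l2 u x) * M"
        by (rule order_trans[OF norm_cross3_le mult_left_mono[OF elim]]) simp
      from power_mono[OF this, of 2] show ?case by (simp add: power_mult_distrib mult.commute)
    qed
  qed measurable
  then show ?thesis by (simp add: square_integrable_def)
qed

lemma lin_on_l2_cross: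
  assumes "essentially_bounded B"
  shows "lin_on UNIV (l2_cross B)"
proof (rule lin_onI)
  note si = square_integrable_cross3[OF assms]
  have ae: "AE x in lborel. rep_l2 (l2_cross B u) x = cross3 (rep_l2 u x) (rep_l2 B x)" for u
    unfolding l2_cross_def by (rule rep_abs_l2[OF si])
  show "l2_cross B (u + v) = l2_cross B u + l2_cross B v" for u v
    by (rule l2_eqI)
      (use ae[of u] ae[of v] ae[of "u + v"] rep_l2_add[of u v] rep_l2_add[of "l2_cross B u" "l2_cross B v"]
        in \<open>auto simp: cross_add_left elim!: AE_mp\<close>)
  show "l2_cross B (c *\<^sub>R u) = c *\<^sub>R l2_cross B u" for c u
    by (rule l2_eqI)
      (use ae[of u] ae[of "c *\<^sub>R u"] rep_l2_scaleR[of c u] rep_l2_scaleR[of c "l2_cross B u"]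
        in \<open>auto simp: cross_mult_left elim!: AE_mp\<close>)
qed

lemma triple_form_eq:
  assumes B: "essentially_bounded B" and w: "w \<in> L2 \<Omega>" and \<Omega>: "open \<Omega>"
  shows "triple_form \<Omega> u B w = inner (l2_cross B u) w"
proof -
  have [measurable]: "\<Omega> \<in> sets borel" using \<Omega> by simp
  have "triple_form \<Omega> u B w = (LINT x|lborel. inner (rep_l2 w x) (cross3 (rep_l2 u x) (rep_l2 B x)))"
    unfolding triple_form_def set_lebesgue_integral_def
    by (intro integral_cong_AE)
      (use w in \<open>auto simp: L2_def indicator_def inner_commute elim!: AE_mp\<close>)
  also have "\<dots> = inner w (l2_cross B u)"
    unfolding l2_cross_def by (rule inner_abs_l2[OF square_integrable_cross3[OF B], symmetric])
  finally show ?thesis by (simp add: inner_commute)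
qed

text \<open>The scalar triple product is alternating. Both cancellations come from here: the Hall
  term on the diagonal, and the Lorentz force against the induction term.\<close>

lemma l2_cross_skew:
  assumes B: "essentially_bounded B"
  shows "inner (l2_cross B u) v = - inner (l2_cross B v) u"
proof -
  have e: "inner (l2_cross B u) v = (LINT x|lborel. inner (rep_l2 v x) (cross3 (rep_l2 u x) (rep_l2 B x)))" for u v
    unfolding l2_cross_def
    using inner_abs_l2[OF square_integrable_cross3[OF B], of v u] by (simp add: inner_commute)
  have "inner (rep_l2 v x) (cross3 (rep_l2 u x) (rep_l2 B x)) = - inner (rep_l2 u x) (cross3 (rep_l2 v x) (rep_l2 B x))" for x
    by (simp add: cross3_simps forall_3 sum_3 inner_vec_def)
  then show ?thesis unfolding e by simp
qed

subsection \<open>Well-posedness\<close>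

text \<open>Riesz representation in \<open>Hc\<close>, obtained from the solvability lemma for the
  ambient inner product. The third part is the tool for proving linearity in
  \<open>B\<close>.\<close>

lemma discrete_curl_spec:
  assumes Hc: "finite_dim_subspace Hc" and curl: "lin_on Hc (curl \<Omega>)"
  shows "discrete_curl \<Omega> Hc B \<in> Hc"
    and "k \<in> Hc \<Longrightarrow> inner (discrete_curl \<Omega> Hc B) k = inner B (curl \<Omega> k)"
    and "j \<in> Hc \<Longrightarrow> (\<And>k. k \<in> Hc \<Longrightarrow> inner j k = inner B (curl \<Omega> k)) \<Longrightarrow> discrete_curl \<Omega> Hc B = j"
proof -
  have sub: "subspace Hc" using Hc by (rule finite_dim_subspace_subspace)
  have unique: "j = j'"
    if "j \<in> Hc" "\<forall>k\<in>Hc. inner j k = inner B (curl \<Omega> k)" "j' \<in> Hc" "\<forall>k\<in>Hc. inner j' k = inner B (curl \<Omega> k)"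
    for j j'
  proof -
    have "inner (j - j') (j - j') = 0"
      using that subspace_diff[OF sub that(1,3)] by (simp only: inner_diff_left)
    then show ?thesis by simp
  qed
  have "\<exists>j\<in>Hc. \<forall>k\<in>Hc. inner j k = inner B (curl \<Omega> k)"
  proof (rule bilin_on_nondegenerate_solvable[OF Hc])
    show "bilin_on Hc Hc inner" by (simp add: bilin_on_def lin_on_def inner_add_left inner_add_right)
    show "z = 0" if "z \<in> Hc" "\<And>y. y \<in> Hc \<Longrightarrow> inner z y = 0" for z using that(2)[OF that(1)] by simp
    show "lin_on Hc (\<lambda>k. inner B (curl \<Omega> k))"
      using curl by (simp add: lin_on_def inner_add_right)
  qed
  then have "\<exists>!j. j \<in> Hc \<and> (\<forall>k\<in>Hc. inner j k = inner B (curl \<Omega> k))" using unique by blast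
  then have spec: "discrete_curl \<Omega> Hc B \<in> Hc \<and> (\<forall>k\<in>Hc. inner (discrete_curl \<Omega> Hc B) k = inner B (curl \<Omega> k))"
    unfolding discrete_curl_def by (rule theI')
  then show "discrete_curl \<Omega> Hc B \<in> Hc" "k \<in> Hc \<Longrightarrow> inner (discrete_curl \<Omega> Hc B) k = inner B (curl \<Omega> k)"
    by auto
  show "discrete_curl \<Omega> Hc B = j" if "j \<in> Hc" "\<And>k. k \<in> Hc \<Longrightarrow> inner j k = inner B (curl \<Omega> k)"
    using spec that by (intro unique) auto
qed

lemma lin_on_discrete_curl:
  assumes Hc: "finite_dim_subspace Hc" and curl: "lin_on Hc (curl \<Omega>)"
  shows "lin_on UNIV (discrete_curl \<Omega> Hc)"
proof (rule lin_onI)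
  note spec = discrete_curl_spec[OF assms] and sub = finite_dim_subspace_subspace[OF Hc]
  show "discrete_curl \<Omega> Hc (A + B) = discrete_curl \<Omega> Hc A + discrete_curl \<Omega> Hc B" for A B
    using spec(1,2) by (intro spec(3) subspace_add[OF sub]) (simp_all add: inner_add_left)
  show "discrete_curl \<Omega> Hc (c *\<^sub>R B) = c *\<^sub>R discrete_curl \<Omega> Hc B" for c B
    using spec(1,2) by (intro spec(3) subspace_scale[OF sub]) simp_all
qed

lemma discrete_div_curl_eq_0:
  assumes curl: "lin_on Hc (curl \<Omega>)" and dR: "discrete_de_rham \<Omega> Hg Hc Hd Lh"
    and B: "B \<in> Hd" "divergence \<Omega> B = 0" "discrete_curl \<Omega> Hc B = 0"
  shows "B = 0"
proof -
  have Hc: "finite_dim_subspace Hc" and ex: "curl \<Omega> ` Hc = {B \<in> Hd. divergence \<Omega> B = 0}"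
    using dR by (auto simp: discrete_de_rham_def)
  obtain k where k: "k \<in> Hc" "B = curl \<Omega> k" using ex B by blast
  have "inner B B = 0" using discrete_curl_spec(2)[OF Hc curl k(1), of B] B(3) k(2) by simp
  then show ?thesis by simp
qed

theorem theorem2:
  fixes \<Omega> :: "(real^3) set"
    and Hg Lh Qh :: "real l2 set" and Hc Hd Vh :: "(real^3) l2 set"
    and um Bm :: "(real^3) l2" and Rey Rey_m S R_H :: real
  defines "Wh \<equiv> Vh \<times> Hd"
    and "a \<equiv> a_form \<Omega> Hc Rey Rey_m S R_H um Bm"
    and "b \<equiv> b_form \<Omega>"
    and "NX \<equiv> X_norm \<Omega> Hc"
  assumes "bounded \<Omega>" and "contractible \<Omega>" and "lipschitz_polyhedron \<Omega>"
    and "Rey > 0" and "Rey_m > 0" and "S > 0" and "R_H \<ge> 0"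
    and "discrete_de_rham \<Omega> Hg Hc Hd Lh"
    and "finite_dim_subspace Vh" and "Vh \<subseteq> H1_0_vec \<Omega>"
    and "finite_dim_subspace Qh" and "Qh \<subseteq> L2_mean_zero \<Omega>"
    and "inf_sup_condition \<Omega> Vh Qh"
    and "(um, Bm) \<in> Wh" and "divergence \<Omega> um = 0" and "essentially_bounded Bm"
  shows "(\<forall>h \<in> dual_space Wh NX. \<forall>g \<in> dual_space Qh norm.
            \<exists>!(x, p). mixed_solution Wh Qh a b h g (x, p)) \<and>
         (\<exists>C>0. \<forall>h \<in> dual_space Wh NX. \<forall>g \<in> dual_space Qh norm. \<forall>x p.
            mixed_solution Wh Qh a b h g (x, p) \<longrightarrow>
            NX x + norm p \<le> C * (dual_norm Wh NX h + dual_norm Qh norm g))"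
proof -
  note bounded = \<open>essentially_bounded Bm\<close>
  have \<Omega>: "open \<Omega>" using \<open>lipschitz_polyhedron \<Omega>\<close> by (simp add: lipschitz_polyhedron_def)
  have Hc: "finite_dim_subspace Hc" "Hc \<subseteq> H_curl \<Omega>" and Hd: "finite_dim_subspace Hd" "Hd \<subseteq> H_div \<Omega>"
    using \<open>discrete_de_rham \<Omega> Hg Hc Hd Lh\<close> by (auto simp: discrete_de_rham_def H0_curl_def H0_div_def)
  have sV: "subspace Vh" and sD: "subspace Hd"
    using Hd \<open>finite_dim_subspace Vh\<close> by (auto intro: finite_dim_subspace_subspace)
  have um: "um \<in> H1_0_vec \<Omega>" using \<open>(um, Bm) \<in> Wh\<close> \<open>Vh \<subseteq> H1_0_vec \<Omega>\<close> by (auto simp: Wh_def)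
  have V: "Vh \<subseteq> L2 \<Omega>" "Vh \<subseteq> H1_vec \<Omega>" "Vh \<subseteq> H1_0_vec \<Omega>" "Vh \<subseteq> H_div \<Omega>"
    using \<open>Vh \<subseteq> H1_0_vec \<Omega>\<close> H1_0_vecD(1,4) H1_vec_subset_H_div[OF \<Omega>] by blast+
  have curl: "lin_on Hc (curl \<Omega>)" by (rule lin_on_subset[OF lin_on_curl[OF \<Omega>] Hc(2)])
  define D where "D = discrete_curl \<Omega> Hc"
  have HcL2: "Hc \<subseteq> L2 \<Omega>" using Hc(2) by (auto simp: H_curl_def weak_curl_def)
  have D_L2: "D B \<in> L2 \<Omega>" for B
    using discrete_curl_spec(1)[OF Hc(1) curl] HcL2 unfolding D_def by blast
  have D: "lin_on UNIV D" unfolding D_def by (rule lin_on_discrete_curl[OF Hc(1) curl])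
  have vg: "lin_on Vh (vgrad \<Omega>)" by (rule lin_on_subset[OF lin_on_vgrad[OF \<Omega>] V(2)])
  have dv: "lin_on Vh (divergence \<Omega>)" "lin_on Hd (divergence \<Omega>)"
    by (rule lin_on_subset[OF lin_on_divergence[OF \<Omega>]], rule V Hd)+
  have cu: "lin_on Vh (\<lambda>u. convection \<Omega> um u v)" if "v \<in> Vh" for v
    using that V(3) by (intro lin_on_subset[OF convection_linear(1)[OF \<Omega> um] V(3)]) auto
  have cv: "lin_on Vh (convection \<Omega> um u)" for u
    by (rule lin_on_subset[OF convection_linear(2)[OF \<Omega> um] V(3)])
  define X where "X = l2_cross Bm"
  have X: "lin_on UNIV X" unfolding X_def by (rule lin_on_l2_cross[OF bounded])
  have skew: "inner (X u) v = - inner (X v) u" for u v unfolding X_def by (rule l2_cross_skew[OF bounded])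
  \<comment> \<open>The triple products become inner products with the operator \<open>X\<close>, so
    that bilinearity of \<open>a\<close> is obtained by rewriting.\<close>
  have a_eq: "a (u, B) (v, C) = inverse Rey * inner (vgrad \<Omega> u) (vgrad \<Omega> v) + convection \<Omega> um u v
     - S * inner (X (D B)) v + inner (divergence \<Omega> B) (divergence \<Omega> C)
     + inverse Rey_m * inner (D B) (D C) - inner (X u) (D C) + R_H * inner (X (D B)) (D C)"
    if "v \<in> Vh" for u v B C
    using that V(1) D_L2 unfolding a_def a_form_def D_def[symmetric] X_def
    by (simp add: triple_form_eq[OF bounded _ \<Omega>] subset_iff)
  \<comment> \<open>\<open>mixed_problem_well_posed\<close> asks for a norm that is the root of the
    diagonal of a bilinear form; this form is the polarization of the squared X-norm.\<close>
  define ip where "ip = (\<lambda>x y. inner (vgrad \<Omega> (fst x)) (vgrad \<Omega> (fst y)) +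
    inner (divergence \<Omega> (snd x)) (divergence \<Omega> (snd y)) + inner (D (snd x)) (D (snd y)))"
  have ip_self: "ip x x = (norm (vgrad \<Omega> (fst x)))\<^sup>2 + (norm (divergence \<Omega> (snd x)))\<^sup>2 + (norm (D (snd x)))\<^sup>2" for x
    by (simp add: ip_def power2_norm_eq_inner)
  have NX: "NX x = sqrt (ip x x)" for x
    unfolding NX_def X_norm_def D_def[symmetric] ip_self by (simp add: split_def)
  note lin = lin_on_add[OF vg] lin_on_scaleR[OF vg] lin_on_add[OF dv(1)] lin_on_scaleR[OF dv(1)]
    lin_on_add[OF dv(2)] lin_on_scaleR[OF dv(2)] lin_on_add[OF D] lin_on_scaleR[OF D]
    lin_on_add[OF X] lin_on_scaleR[OF X] lin_on_add[OF cu] lin_on_scaleR[OF cu]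
    lin_on_add[OF cv] lin_on_scaleR[OF cv]
    subspace_add[OF sV] subspace_scale[OF sV] subspace_add[OF sD] subspace_scale[OF sD]
  have a: "bilin_on Wh Wh a"
    unfolding bilin_on_def lin_on_def Wh_def
    by (auto simp: a_eq lin inner_add_left inner_add_right algebra_simps)
  have b: "bilin_on Wh Qh b"
    unfolding bilin_on_def lin_on_def Wh_def b_def b_form_def
    by (auto simp: lin inner_add_left inner_add_right)
  have ip: "bilin_on Wh Wh ip"
    unfolding bilin_on_def lin_on_def Wh_def ip_def
    by (auto simp: lin inner_add_left inner_add_right algebra_simps)
  have pos: "ip x x > 0" if x: "x \<in> Wh" "x \<noteq> 0" for x
  proof (rule ccontr)
    assume "\<not> ip x x > 0"
    then have "vgrad \<Omega> (fst x) = 0 \<and> divergence \<Omega> (snd x) = 0 \<and> D (snd x) = 0"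
      unfolding ip_self using zero_le_power2[of "norm (vgrad \<Omega> (fst x))"]
        zero_le_power2[of "norm (divergence \<Omega> (snd x))"] zero_le_power2[of "norm (D (snd x))"]
      by (smt (verit) norm_eq_zero power2_eq_iff zero_power2)
    moreover have "fst x \<in> H1_0_vec \<Omega>" "snd x \<in> Hd" using x(1) V(3) by (auto simp: Wh_def)
    ultimately have "fst x = 0" "snd x = 0"
      using H1_0_vec_eq_zeroI discrete_div_curl_eq_0[OF curl \<open>discrete_de_rham \<Omega> Hg Hc Hd Lh\<close>]
      unfolding D_def by blast+
    then show False using x(2) by (simp add: prod_eq_iff)
  qed
  text \<open>The weight \<open>S\<close> on the magnetic component makes the Lorentz force and the induction term
    cancel.\<close>
  define J where "J = (\<lambda>x :: (real^3) l2 \<times> (real^3) l2. (fst x, S *\<^sub>R snd x))"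
  \<comment> \<open>The entries are the coefficients of the three squares in
    \<open>a x (J x)\<close>, belonging to the velocity gradient, the discrete curl
    (\<open>S * inverse Rey_m\<close>) and the divergence (\<open>S\<close>).\<close>
  define c where "c = min (inverse Rey) (min S (S * inverse Rey_m))"
  obtain \<beta> where \<beta>: "\<beta> > 0" "\<And>q. q \<in> Qh \<Longrightarrow> ereal (\<beta> * norm q) \<le>
      (SUP v\<in>Vh - {0}. ereal (inner (divergence \<Omega> v) q / norm (vgrad \<Omega> v)))"
    using \<open>inf_sup_condition \<Omega> Vh Qh\<close> by (auto simp: inf_sup_condition_def)
  show ?thesis
  proof (rule mixed_problem_well_posed[OF _ \<open>finite_dim_subspace Qh\<close> a b ip _ pos NX, where J = J and m = "max 1 S" and c = c and \<beta> = \<beta>])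
    show "finite_dim_subspace Wh"
      unfolding Wh_def by (rule finite_dim_subspace_Times[OF \<open>finite_dim_subspace Vh\<close> Hd(1)])
    show "ip x y = ip y x" for x y by (simp add: ip_def inner_commute)
    show "J x \<in> Wh" if "x \<in> Wh" for x
      using that sD by (auto simp: J_def Wh_def subspace_scale)
    show "b (J x) q = b x q" for x q by (simp add: b_def b_form_def J_def split_def)
    show "c > 0" using \<open>Rey > 0\<close> \<open>Rey_m > 0\<close> \<open>S > 0\<close> by (simp add: c_def)
    show "\<beta> > 0" by (rule \<beta>(1))
  next
    fix x assume "x \<in> Wh"
    then obtain u B where x: "x = (u, B)" and u: "u \<in> Vh" and B: "B \<in> Hd" by (auto simp: Wh_def)
    \<comment> \<open>\<open>J\<close> keeps the velocity and scales the magnetic part by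
      \<open>S\<close>, so its X-norm grows by at most the larger of 1 and \<open>S\<close>.\<close>
    let ?m = "max 1 S"
    have "1 * (norm (vgrad \<Omega> u))\<^sup>2 \<le> ?m\<^sup>2 * (norm (vgrad \<Omega> u))\<^sup>2"
      by (intro mult_right_mono) auto
    moreover have S2: "S\<^sup>2 \<le> ?m\<^sup>2" using \<open>S > 0\<close> by (intro power_mono) auto
    then have "S\<^sup>2 * (norm (divergence \<Omega> B))\<^sup>2 \<le> ?m\<^sup>2 * (norm (divergence \<Omega> B))\<^sup>2"
      "S\<^sup>2 * (norm (D B))\<^sup>2 \<le> ?m\<^sup>2 * (norm (D B))\<^sup>2"
      by (auto intro: mult_right_mono)
    ultimately have "ip (J x) (J x) \<le> ?m\<^sup>2 * ip x x"
      unfolding ip_self by (simp add: x J_def B lin power_mult_distrib distrib_left)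
    then have "sqrt (ip (J x) (J x)) \<le> sqrt (?m\<^sup>2 * ip x x)" by (rule real_sqrt_le_mono)
    then show "NX (J x) \<le> ?m * NX x" by (simp add: NX real_sqrt_mult)
    have "c * (norm (vgrad \<Omega> u))\<^sup>2 \<le> inverse Rey * (norm (vgrad \<Omega> u))\<^sup>2"
      "c * (norm (divergence \<Omega> B))\<^sup>2 \<le> S * (norm (divergence \<Omega> B))\<^sup>2"
      "c * (norm (D B))\<^sup>2 \<le> S * inverse Rey_m * (norm (D B))\<^sup>2"
      by (intro mult_right_mono; simp add: c_def)+
    then have "c * ip x x \<le> inverse Rey * (norm (vgrad \<Omega> u))\<^sup>2 + S * (norm (divergence \<Omega> B))\<^sup>2
        + S * inverse Rey_m * (norm (D B))\<^sup>2"
      unfolding ip_self by (simp add: x distrib_left)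
    also have "\<dots> = a x (J x)"
    proof -
      have "convection \<Omega> um u u = 0"
        using u V(3) by (intro convection_self_eq_0[OF \<Omega> um \<open>divergence \<Omega> um = 0\<close>]) auto
      moreover have "inner (X (D B)) (D B) = 0" using skew[of "D B" "D B"] by simp
      moreover have "inner (X u) (D B) = - inner (X (D B)) u" by (rule skew)
      ultimately show ?thesis
        by (simp add: x J_def a_eq u B lin power2_norm_eq_inner)
    qed
    finally show "c * (NX x)\<^sup>2 \<le> a x (J x)"
      unfolding NX using ip_self[of x] by simp
  next
    fix q \<gamma> assume q: "q \<in> Qh" and \<gamma>: "\<gamma> \<ge> 0" and le: "\<And>y. y \<in> Wh \<Longrightarrow> b y q \<le> \<gamma> * NX y"
    \<comment> \<open>The pair \<open>(v, 0)\<close> has X-norm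
      \<open>norm (vgrad \<Omega> v)\<close>, so a bound on all of \<open>Wh\<close> bounds every
      quotient in the inf-sup condition.\<close>
    have "inner (divergence \<Omega> v) q / norm (vgrad \<Omega> v) \<le> \<gamma>" if v: "v \<in> Vh" for v
    proof -
      have "0 \<in> Hd" using sD by (rule subspace_0)
      then have "divergence \<Omega> 0 = 0" "D 0 = 0" using lin_on_zero[OF dv(2)] lin_on_zero[OF D] by auto
      then have "inner (divergence \<Omega> v) q \<le> \<gamma> * norm (vgrad \<Omega> v)"
        using le[of "(v, 0)"] v \<open>0 \<in> Hd\<close> by (simp add: Wh_def b_def b_form_def NX ip_self)
      \<comment> \<open>If the denominator is 0, the quotient is 0 by convention and
        \<open>\<gamma> \<ge> 0\<close> suffices.\<close>
      then show ?thesis using \<gamma> by (cases "norm (vgrad \<Omega> v) = 0") (auto simp: divide_le_eq)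
    qed
    then have "(SUP v\<in>Vh - {0}. ereal (inner (divergence \<Omega> v) q / norm (vgrad \<Omega> v))) \<le> ereal \<gamma>"
      by (intro SUP_least) auto
    from order_trans[OF \<beta>(2)[OF q] this] show "\<beta> * norm q \<le> \<gamma>" by simp
  qed
qed

end
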